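(* Consider the degraded Gaussian diamond-wiretap channel with parameters $P_1,P_2>0$, $C_1,C_2\ge 0$, $g\in[0,1)$, in the second scenario (a fictitious message of rate $R'$ is available only at the source and relay encoding is deterministic), and let $C_S^{(2)}$ be its secrecy capacity. Then for every $\rho\in[-1,1]$ such that $R'\ge f_5(\rho)$, $$C_S^{(2)}\ge\max\bigl(R_{\mathrm{DF}}^{(2)}(\rho),\ R_{\mathrm{PDF-DF-M}}^{(2)}(\rho),\ R_{\mathrm{PDF-PDF-M}}^{(2)}(\rho)\bigr),$$ where \begin{align*} R_{\mathrm{DF}}^{(2)}(\rho)&=\min\bigl(C_1,C_2,f_4(\rho)\bigr)-f_5(\rho),\\ R_{\mathrm{PDF-DF-M}}^{(2)}(\rho)&=\min\bigl(f_1(\rho),f_2(\rho),f_3(\rho)-f_5(\rho),f_4(\rho)\bigr)-f_5(\rho),\\ R_{\mathrm{PDF-PDF-M}}^{(2)}(\rho)&=\Bigl(\min\bigl(f_1(\rho),f_2(\rho),f_3(\rho),f_4(\rho)\bigr)-f_5(\rho)\Bigr)\cdot\mathbf 1_{\{C_1>f_6(\rho),\ C_2>f_7(\rho)\}}. \end{align*}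
   Context: Channel. A source is connected to relays 1 and 2 by orthogonal noiseless links of capacities $C_1,C_2\ge 0$ (bits per channel use); there is no direct link from the source to the destination or eavesdropper. At each time the relays send real inputs $X_1,X_2$; the legitimate destination receives $Y=X_1+X_2+N_Y$ and the eavesdropper receives $Z=\sqrt{g}\,Y+N_Z$, where $g\in[0,1)$, $N_Y\sim\mathcal N(0,1)$ and $N_Z\sim\mathcal N(0,1-g)$ are independent of each other, of the inputs, and i.i.d. over time. The power constraint at relay $k=1,2$ over $n$ channel uses is $\frac1n\sum_{i=1}^n X_{k,i}^2\le P_k$. Notation: $[i:j]=\{i,i+1,\dots,j\}$; quantities such as $2^{nR}$ are rounded to integers. Second scenario. A fictitious message $M\sim\mathrm{Unif}[1:2^{nR'}]$ is available only at the source. A $(2^{nR},n)$ secrecy code consists of a message $W\sim\mathrm{Unif}[1:2^{nR}]$ independent of $M$; a (deterministic) encoding function at the source mapping $(W,M)$ to $(J_1,J_2)\in[1:2^{nC_1}]\times[1:2^{nC_2}]$; for $k=1,2$ a deterministic encoding function at relay $k$ mapping $J_k$ to $X_k^n$ satisfying the power constraint; and a decoding function mapping $Y^n$ to $\hat W\in[1:2^{nR}]$. A secrecy rate $R$ is achievable if there is a sequence of $(2^{nR},n)$ codes with $\lim_{n\to\infty}P(\hat W\ne W)=0$ and $\lim_{n\to\infty}\frac1n I(W;Z^n)=0$. $C_S^{(2)}$ is the supremum of all achievable secrecy rates. Functions (logarithms to base 2): $f_1(\rho)=C_1+\frac12\log(1+(1-\rho^2)P_2)$, $f_2(\rho)=C_2+\frac12\log(1+(1-\rho^2)P_1)$,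 $f_3(\rho)=C_1+C_2-\frac12\log\frac{1}{1-\rho^2}$ (equal to $-\infty$ when $|\rho|=1$), $f_4(\rho)=\frac12\log(1+P_1+P_2+2\rho\sqrt{P_1P_2})$, $f_5(\rho)=\frac12\log(1+g(P_1+P_2+2\rho\sqrt{P_1P_2}))$, $f_6(\rho)=\frac12\log\frac{1+g(P_1+P_2+2\rho\sqrt{P_1P_2})}{1+g(1-\rho^2)P_2}$, $f_7(\rho)=\frac12\log\frac{1+g(P_1+P_2+2\rho\sqrt{P_1P_2})}{1+g(1-\rho^2)P_1}$. $\mathbf 1_{A}$ is $1$ if condition $A$ holds and $0$ otherwise; a product with a zero indicator is $0$. *)

theory Defs
  imports "HOL-Probability.Probability"
begin

section \<open>The degraded Gaussian diamond-wiretap channel\<close>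

text \<open>
  \<open>cap1\<close>, \<open>cap2\<close> are the capacities of the noiseless links from the source to the relays,
  \<open>pow1\<close>, \<open>pow2\<close> the power constraints of the relays, and \<open>gain\<close> is the degradation parameter \<open>g\<close>
  in \<open>Z = sqrt g * Y + N\<^sub>Z\<close>.
\<close>

record diamond_wiretap =
  cap1 :: real
  cap2 :: real
  pow1 :: real
  pow2 :: real
  gain :: real

text \<open>Rounding convention: there are \<open>\<lfloor>2 powr (n * R)\<rfloor>\<close> indices at rate \<open>R\<close>, numbered from 1.\<close>

definition index_set :: "nat \<Rightarrow> real \<Rightarrow> nat set" where
  "index_set n R = {1 .. nat \<lfloor>2 powr (real n * R)\<rfloor>}"

definition gaussian :: "real \<Rightarrow> real measure" where
  "gaussian v = density lborel (normal_density 0 (sqrt v))"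

definition gaussian_vector :: "nat \<Rightarrow> real \<Rightarrow> (nat \<Rightarrow> real) measure" where
  "gaussian_vector n v = (\<Pi>\<^sub>M i\<in>{1..n}. gaussian v)"

abbreviation real_vectors :: "nat \<Rightarrow> (nat \<Rightarrow> real) measure" where
  "real_vectors n \<equiv> (\<Pi>\<^sub>M i\<in>{1..n}. borel)"


section \<open>Codes with a fictitious message at the source\<close>

text \<open>
  \<open>source_enc w m\<close> is the pair \<open>(J\<^sub>1, J\<^sub>2)\<close> for message \<open>w\<close> and fictitious message \<open>m\<close>;
  \<open>relay1 j i\<close> is the input of relay 1 at time \<open>i\<close> upon receiving \<open>j\<close>.
  The noises enter only through the channel, so that all encoders are deterministic.
\<close>

record wiretap_code =
  source_enc :: "nat \<Rightarrow> nat \<Rightarrow> nat \<times> nat"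
  relay1 :: "nat \<Rightarrow> nat \<Rightarrow> real"
  relay2 :: "nat \<Rightarrow> nat \<Rightarrow> real"
  decoder :: "(nat \<Rightarrow> real) \<Rightarrow> nat"

definition power_constraint :: "nat \<Rightarrow> real \<Rightarrow> (nat \<Rightarrow> real) \<Rightarrow> bool" where
  "power_constraint n P x \<longleftrightarrow> (1 / real n) * (\<Sum>i=1..n. (x i)\<^sup>2) \<le> P"

definition is_secrecy_code ::
    "diamond_wiretap \<Rightarrow> real \<Rightarrow> real \<Rightarrow> nat \<Rightarrow> wiretap_code \<Rightarrow> bool" where
  "is_secrecy_code ch R' R n c \<longleftrightarrow>
     (\<forall>w\<in>index_set n R. \<forall>m\<in>index_set n R'.
        source_enc c w m \<in> index_set n (cap1 ch) \<times> index_set n (cap2 ch)) \<and>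
     (\<forall>j\<in>index_set n (cap1 ch). power_constraint n (pow1 ch) (relay1 c j)) \<and>
     (\<forall>j\<in>index_set n (cap2 ch). power_constraint n (pow2 ch) (relay2 c j)) \<and>
     decoder c \<in> real_vectors n \<rightarrow>\<^sub>M count_space (index_set n R)"

text \<open>
  An outcome is \<open>(w, m, u, v)\<close>: message, fictitious message, destination noise \<open>N\<^sub>Y\<close> and
  eavesdropper noise \<open>N\<^sub>Z\<close>, all independent.
\<close>

type_synonym outcome = "nat \<times> nat \<times> (nat \<Rightarrow> real) \<times> (nat \<Rightarrow> real)"

definition code_space :: "diamond_wiretap \<Rightarrow> real \<Rightarrow> real \<Rightarrow> nat \<Rightarrow> outcome measure" where
  "code_space ch R' R n =
     uniform_count_measure (index_set n R) \<Otimes>\<^sub>M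
     uniform_count_measure (index_set n R') \<Otimes>\<^sub>M
     gaussian_vector n 1 \<Otimes>\<^sub>M
     gaussian_vector n (1 - gain ch)"

definition message :: "outcome \<Rightarrow> nat" where
  "message = (\<lambda>(w, m, u, v). w)"

definition dest_output :: "nat \<Rightarrow> wiretap_code \<Rightarrow> outcome \<Rightarrow> (nat \<Rightarrow> real)" where
  "dest_output n c = (\<lambda>(w, m, u, v). \<lambda>i\<in>{1..n}.
     relay1 c (fst (source_enc c w m)) i + relay2 c (snd (source_enc c w m)) i + u i)"

definition eve_output ::
    "diamond_wiretap \<Rightarrow> nat \<Rightarrow> wiretap_code \<Rightarrow> outcome \<Rightarrow> (nat \<Rightarrow> real)" where
  "eve_output ch n c = (\<lambda>(w, m, u, v). \<lambda>i\<in>{1..n}.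
     sqrt (gain ch) * dest_output n c (w, m, u, v) i + v i)"

definition error_prob ::
    "diamond_wiretap \<Rightarrow> real \<Rightarrow> real \<Rightarrow> nat \<Rightarrow> wiretap_code \<Rightarrow> real" where
  "error_prob ch R' R n c =
     measure (code_space ch R' R n)
       {\<omega> \<in> space (code_space ch R' R n). decoder c (dest_output n c \<omega>) \<noteq> message \<omega>}"

definition leakage ::
    "diamond_wiretap \<Rightarrow> real \<Rightarrow> real \<Rightarrow> nat \<Rightarrow> wiretap_code \<Rightarrow> real" where
  "leakage ch R' R n c =
     prob_space.mutual_information (code_space ch R' R n) 2
       (count_space (index_set n R)) (real_vectors n) message (eve_output ch n c)"

definition achievable :: "diamond_wiretap \<Rightarrow> real \<Rightarrow> real \<Rightarrow> bool" where
  "achievable ch R' R \<longleftrightarrow> 0 \<le> R \<and>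
     (\<exists>c :: nat \<Rightarrow> wiretap_code.
        (\<forall>n\<ge>1. is_secrecy_code ch R' R n (c n)) \<and>
        (\<lambda>n. error_prob ch R' R n (c n)) \<longlonglongrightarrow> 0 \<and>
        (\<lambda>n. (1 / real n) * leakage ch R' R n (c n)) \<longlonglongrightarrow> 0)"

text \<open>The supremum is taken in the extended reals, where it needs no boundedness proof.\<close>

definition secrecy_capacity :: "diamond_wiretap \<Rightarrow> real \<Rightarrow> ereal" where
  "secrecy_capacity ch R' = (SUP R \<in> {R. achievable ch R' R}. ereal R)"


section \<open>Rate expressions\<close>

definition received_power :: "diamond_wiretap \<Rightarrow> real \<Rightarrow> real" where
  "received_power ch \<rho> = pow1 ch + pow2 ch + 2 * \<rho> * sqrt (pow1 ch * pow2 ch)"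

definition f1 :: "diamond_wiretap \<Rightarrow> real \<Rightarrow> real" where
  "f1 ch \<rho> = cap1 ch + 1/2 * log 2 (1 + (1 - \<rho>\<^sup>2) * pow2 ch)"

definition f2 :: "diamond_wiretap \<Rightarrow> real \<Rightarrow> real" where
  "f2 ch \<rho> = cap2 ch + 1/2 * log 2 (1 + (1 - \<rho>\<^sup>2) * pow1 ch)"

definition f3 :: "diamond_wiretap \<Rightarrow> real \<Rightarrow> ereal" where
  "f3 ch \<rho> =
     (if \<bar>\<rho>\<bar> = 1 then -\<infinity> else ereal (cap1 ch + cap2 ch - 1/2 * log 2 (1 / (1 - \<rho>\<^sup>2))))"

definition f4 :: "diamond_wiretap \<Rightarrow> real \<Rightarrow> real" where
  "f4 ch \<rho> = 1/2 * log 2 (1 + received_power ch \<rho>)"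

definition f5 :: "diamond_wiretap \<Rightarrow> real \<Rightarrow> real" where
  "f5 ch \<rho> = 1/2 * log 2 (1 + gain ch * received_power ch \<rho>)"

definition f6 :: "diamond_wiretap \<Rightarrow> real \<Rightarrow> real" where
  "f6 ch \<rho> =
     1/2 * log 2 ((1 + gain ch * received_power ch \<rho>) / (1 + gain ch * (1 - \<rho>\<^sup>2) * pow2 ch))"

definition f7 :: "diamond_wiretap \<Rightarrow> real \<Rightarrow> real" where
  "f7 ch \<rho> =
     1/2 * log 2 ((1 + gain ch * received_power ch \<rho>) / (1 + gain ch * (1 - \<rho>\<^sup>2) * pow1 ch))"

definition R_DF :: "diamond_wiretap \<Rightarrow> real \<Rightarrow> ereal" where
  "R_DF ch \<rho> = ereal (Min {cap1 ch, cap2 ch, f4 ch \<rho>} - f5 ch \<rho>)"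

definition R_PDF_DF_M :: "diamond_wiretap \<Rightarrow> real \<Rightarrow> ereal" where
  "R_PDF_DF_M ch \<rho> =
     Min {ereal (f1 ch \<rho>), ereal (f2 ch \<rho>), f3 ch \<rho> - ereal (f5 ch \<rho>), ereal (f4 ch \<rho>)}
       - ereal (f5 ch \<rho>)"

text \<open>The product below is in \<open>ereal\<close>, where \<open>-\<infinity> * 0 = 0\<close>.\<close>

definition R_PDF_PDF_M :: "diamond_wiretap \<Rightarrow> real \<Rightarrow> ereal" where
  "R_PDF_PDF_M ch \<rho> =
     (Min {ereal (f1 ch \<rho>), ereal (f2 ch \<rho>), f3 ch \<rho>, ereal (f4 ch \<rho>)} - ereal (f5 ch \<rho>))
       * (if cap1 ch > f6 ch \<rho> \<and> cap2 ch > f7 ch \<rho> then 1 else 0)"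

end

theory Submission
  imports Defs "HOL-Number_Theory.Cong" "HOL-Real_Asymp.Real_Asymp"
begin

text \<open>
  Random coding with independent Gaussian codebooks at the two relays. A pair \<open>t = (w, k)\<close> of message and
  randomness gets a codeword of relay 1 and a block of about \<open>exp (n * I(X\<^sub>1; X\<^sub>2))\<close> codewords of relay 2, and
  uses the first one in its block that is jointly typical with the codeword of relay 1. Restricted to typical pairs, the
  product law is at most \<open>exp (- n * I(X\<^sub>1; X\<^sub>2))\<close> times the correlated Gaussian law, so Markov's inequality
  for likelihood ratios bounds the probability that a wrong pair is decodable. This gives reliable decoding of \<open>t\<close>
  from \<open>Y\<close> when its rate is below \<open>min (f\<^sub>1, f\<^sub>2, f\<^sub>3, f\<^sub>4)\<close>, and of \<open>k\<close> from \<open>Z\<close>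
  given \<open>w\<close> when the rate of \<open>k\<close> is below \<open>f\<^sub>5\<close> and \<open>C\<^sub>1 > f\<^sub>6\<close>, \<open>C\<^sub>2 > f\<^sub>7\<close>.
  By a Fano-type inequality the leakage is then at most \<open>n * f\<^sub>5\<close> minus the entropy of \<open>k\<close>, which is
  small when the rate of \<open>k\<close> is close to \<open>f\<^sub>5\<close>.

  If one link carries all of \<open>t\<close>, its relay can evaluate the codeword selection itself, so its codebook may be
  arbitrarily large; this covers decode-forward. If \<open>C\<^sub>1 \<le> f\<^sub>6\<close>, the rate \<open>R_PDF_DF_M\<close> is
  already achieved by relay 2 alone, with power \<open>(1 - \<rho>\<^sup>2) * P\<^sub>2\<close>.
\<close>

section \<open>Gaussian vectors\<close>

text \<open>Secrecy comes without a soft-covering argument. Given \<open>w\<close>, the output law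
  is a mixture over \<open>k\<close>, and its relative entropy to a white Gaussian law falls short
  of that of a single codeword by about the entropy of \<open>k\<close>, provided \<open>k\<close>
  can be decoded. So both receivers pose the same packing problem, at gains 1 and
  \<open>sqrt g\<close>, and one codebook is drawn for both. A relay sees only its own index, so
  correlated inputs must be bought by selecting among independent codewords; the price is the term
  subtracted in \<open>f3\<close>. A wrong pair may share the codeword of relay 1 or the block of
  relay 2. At the destination this gives \<open>f1\<close> and \<open>f2\<close>; at the
  eavesdropper the same two bounds, with the rate of \<open>k\<close> near \<open>f5\<close>, are
  \<open>cap1 > f6\<close> and \<open>cap2 > f7\<close>. Two demands on \<open>k\<close> conflict:
  its rate must lie below \<open>f5\<close> to be decodable, and close to \<open>f5\<close> to keep
  the leakage small. It is therefore adapted to the permitted leakage before the block length grows.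
  Selection needs a nondegenerate covariance, so boundary values such as |\<rho>| = 1 are reached by
  a perturbation of powers and covariance.\<close>

declare One_nat_def [simp del]

lemma sets_gaussian [measurable_cong, simp]: "sets (gaussian v) = sets borel"
  by (simp add: gaussian_def)

lemma space_gaussian [simp]: "space (gaussian v) = UNIV"
  by (simp add: gaussian_def)

lemma prob_space_gaussian: "0 < v \<Longrightarrow> prob_space (gaussian v)"
  unfolding gaussian_def by (rule prob_space_normal_density) simp

lemma sets_gaussian_vector [measurable_cong, simp]:
  "sets (gaussian_vector n v) = sets (real_vectors n)"
  unfolding gaussian_vector_def by (intro sets_PiM_cong) auto

lemma space_gaussian_vector: "space (gaussian_vector n v) = space (real_vectors n)"
  using sets_eq_imp_space_eq[OF sets_gaussian_vector] .

lemma prob_space_gaussian_vector: "0 < v \<Longrightarrow> prob_space (gaussian_vector n v)"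
  unfolding gaussian_vector_def by (intro prob_space_PiM prob_space_gaussian)

lemma product_sigma_finite_gaussian: "0 < v \<Longrightarrow> product_sigma_finite (\<lambda>_. gaussian v)"
  using prob_space_gaussian
  by (intro product_sigma_finite.intro) (auto intro: prob_space_imp_sigma_finite)

lemma nn_integral_gaussian:
  assumes "f \<in> borel_measurable borel"
  shows "(\<integral>\<^sup>+x. f x \<partial>gaussian v) = (\<integral>\<^sup>+x. ennreal (normal_density 0 (sqrt v) x) * f x \<partial>lborel)"
  unfolding gaussian_def using assms by (subst nn_integral_density) auto

lemma has_bochner_integral_gaussian:
  assumes "f \<in> borel_measurable borel"
    and "has_bochner_integral lborel (\<lambda>x. normal_density 0 (sqrt v) x * f x) y"
  shows "has_bochner_integral (gaussian v) f (y::real)"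
  unfolding gaussian_def using assms
  by (intro has_bochner_integral_density) (auto simp: normal_density_nonneg)

text \<open>The last two claims give mean and variance of \<open>x^2 - v\<close>, the input of
  Chebyshev's inequality for squared norms.\<close>

lemma gaussian_moments:
  assumes v: "0 < v"
  shows "has_bochner_integral (gaussian v) (\<lambda>x. x) 0"
    and "has_bochner_integral (gaussian v) (\<lambda>x. x\<^sup>2) v"
    and "has_bochner_integral (gaussian v) (\<lambda>x. x\<^sup>2 - v) 0"
    and "has_bochner_integral (gaussian v) (\<lambda>x. (x\<^sup>2 - v)\<^sup>2) (2 * v\<^sup>2)"
proof -
  interpret prob_space "gaussian v" by (rule prob_space_gaussian[OF v])
  have c: "has_bochner_integral (gaussian v) (\<lambda>x. w) w" for w :: real
    using prob_space by (simp add: has_bochner_integral_iff)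
  have even: "has_bochner_integral (gaussian v) (\<lambda>x. x ^ (2 * k)) (fact (2 * k) / ((2 / v)^k * fact k))" for k
  proof (rule has_bochner_integral_gaussian)
    show "has_bochner_integral lborel (\<lambda>x. normal_density 0 (sqrt v) x * x ^ (2 * k))
        (fact (2 * k) / ((2 / v)^k * fact k))"
      using normal_moment_even[of "sqrt v" 0 k] v by simp
  qed simp
  show "has_bochner_integral (gaussian v) (\<lambda>x. x) 0"
    using normal_moment_nz_1[of "sqrt v" 0] v
    by (intro has_bochner_integral_gaussian) auto
  show 2: "has_bochner_integral (gaussian v) (\<lambda>x. x\<^sup>2) v"
    using even[of 1] v by (simp add: field_simps)
  have 4: "has_bochner_integral (gaussian v) (\<lambda>x. x^4) (3 * v\<^sup>2)"
    using even[of 2] v by (simp add: field_simps power2_eq_square fact_numeral)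
  show "has_bochner_integral (gaussian v) (\<lambda>x. x\<^sup>2 - v) 0"
    using has_bochner_integral_diff[OF 2 c[of v]] by simp
  have "has_bochner_integral (gaussian v) (\<lambda>x. x^4 - 2 * v * x\<^sup>2 + v\<^sup>2) (3 * v\<^sup>2 - 2 * v * v + v\<^sup>2)"
    by (intro has_bochner_integral_add has_bochner_integral_diff has_bochner_integral_mult_right 4 2 c)
  then show "has_bochner_integral (gaussian v) (\<lambda>x. (x\<^sup>2 - v)\<^sup>2) (2 * v\<^sup>2)"
    by (simp add: power2_diff algebra_simps power2_eq_square power4_eq_xxxx)
qed

text \<open>Independence kills the mixed terms, so only the second moments \<open>s i\<close>
  survive. The functions may differ between coordinates because inner products with a fixed vector
  use \<open>f i x = c i * x\<close>.\<close>

lemma PiM_sum_second_moment: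
  fixes f :: "'i \<Rightarrow> 'a \<Rightarrow> real"
  assumes I: "finite I" and M: "\<And>i. prob_space (M i)"
    and f0: "\<And>i. i \<in> I \<Longrightarrow> has_bochner_integral (M i) (f i) 0"
    and f2: "\<And>i. i \<in> I \<Longrightarrow> has_bochner_integral (M i) (\<lambda>x. (f i x)\<^sup>2) (s i)"
  shows "has_bochner_integral (PiM I M) (\<lambda>x. (\<Sum>i\<in>I. f i (x i))\<^sup>2) (\<Sum>i\<in>I. s i)"
proof -
  interpret product_sigma_finite M
    by (intro product_sigma_finite.intro prob_space_imp_sigma_finite M)
  have one: "has_bochner_integral (M k) (\<lambda>x. 1) (1::real)" for k
  proof -
    interpret prob_space "M k" by fact
    show ?thesis by (simp add: has_bochner_integral_iff prob_space)
  qed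
  have ij: "has_bochner_integral (PiM I M) (\<lambda>x. f i (x i) * f j (x j)) (if i = j then s i else 0)"
    if "i \<in> I" "j \<in> I" for i j
  proof -
    \<comment> \<open>Writes \<open>f i * f j\<close> as a product over all coordinates, with factor
      1 away from \<open>i\<close> and \<open>j\<close>, so that the product rule for integrals
      covers diagonal and mixed terms alike.\<close>
    define g where "g k = (if k = i \<and> k = j then (\<lambda>x. (f k x)\<^sup>2) else if k = i \<or> k = j then f k else (\<lambda>_. 1))" for k
    define c where "c k = (if k = i \<and> k = j then s k else if k = i \<or> k = j then 0 else 1)" for k
    have g: "has_bochner_integral (M k) (g k) (c k)" if "k \<in> I" for k
      using that f0 f2 one by (auto simp: g_def c_def)
    have gp: "(\<Prod>k\<in>I. g k (x k)) = f i (x i) * f j (x j)" for x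
    proof (cases "i = j")
      case True
      have "(\<Prod>k\<in>I. g k (x k)) = g i (x i) * (\<Prod>k\<in>I - {i}. g k (x k))"
        using I that by (simp add: prod.remove)
      also have "(\<Prod>k\<in>I - {i}. g k (x k)) = 1"
        by (rule prod.neutral) (auto simp: g_def True)
      finally show ?thesis by (simp add: g_def True power2_eq_square)
    next
      case False
      have "(\<Prod>k\<in>I. g k (x k)) = g i (x i) * (g j (x j) * (\<Prod>k\<in>I - {i} - {j}. g k (x k)))"
        using I that False by (subst prod.remove[of _ i], simp, simp, subst prod.remove[of _ j]) auto
      also have "(\<Prod>k\<in>I - {i} - {j}. g k (x k)) = 1"
        by (rule prod.neutral) (auto simp: g_def)
      finally show ?thesis using False by (simp add: g_def)
    qed
    have cp: "(\<Prod>k\<in>I. c k) = (if i = j then s i else 0)"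
    proof (cases "i = j")
      case True
      have "(\<Prod>k\<in>I. c k) = c i * (\<Prod>k\<in>I - {i}. c k)"
        using I that by (simp add: prod.remove)
      also have "(\<Prod>k\<in>I - {i}. c k) = 1"
        by (rule prod.neutral) (auto simp: c_def True)
      finally show ?thesis by (simp add: c_def True)
    next
      case False
      then have "c i = 0" by (auto simp: c_def)
      then show ?thesis using that I False by auto
    qed
    have "integrable (PiM I M) (\<lambda>x. \<Prod>k\<in>I. g k (x k))"
      by (rule product_integrable_prod[OF I]) (use g in \<open>auto simp: has_bochner_integral_iff\<close>)
    moreover have "(\<integral>x. (\<Prod>k\<in>I. g k (x k)) \<partial>PiM I M) = (\<Prod>k\<in>I. c k)"
      by (subst product_integral_prod[OF I])
         (use g in \<open>auto simp: has_bochner_integral_iff intro!: prod.cong\<close>)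
    ultimately show ?thesis
      unfolding gp cp by (simp add: has_bochner_integral_iff)
  qed
  have "has_bochner_integral (PiM I M) (\<lambda>x. \<Sum>i\<in>I. \<Sum>j\<in>I. f i (x i) * f j (x j))
      (\<Sum>i\<in>I. \<Sum>j\<in>I. if i = j then s i else 0)"
    by (intro has_bochner_integral_sum ij)
  then show ?thesis
    using I by (simp add: power2_eq_square sum_product)
qed

lemma PiM_Chebyshev:
  fixes f :: "'i \<Rightarrow> 'a \<Rightarrow> real"
  assumes I: "finite I" and M: "\<And>i. prob_space (M i)"
    and f0: "\<And>i. i \<in> I \<Longrightarrow> has_bochner_integral (M i) (f i) 0"
    and f2: "\<And>i. i \<in> I \<Longrightarrow> has_bochner_integral (M i) (\<lambda>x. (f i x)\<^sup>2) (s i)"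
    and a: "0 < a"
  shows "measure (PiM I M) {x\<in>space (PiM I M). a \<le> \<bar>\<Sum>i\<in>I. f i (x i)\<bar>} \<le> (\<Sum>i\<in>I. s i) / a\<^sup>2"
proof -
  interpret prob_space "PiM I M" by (intro prob_space_PiM M)
  note m = PiM_sum_second_moment[OF I M f0 f2]
  have [measurable]: "f i \<in> borel_measurable (M i)" if "i \<in> I" for i
    using f0[OF that] by (auto simp: has_bochner_integral_iff)
  have "prob {x\<in>space (PiM I M). a \<le> \<bar>\<Sum>i\<in>I. f i (x i)\<bar>}
      \<le> expectation (\<lambda>x. (\<Sum>i\<in>I. f i (x i))\<^sup>2) / a\<^sup>2"
    by (intro second_moment_method) (use m a in \<open>auto simp: has_bochner_integral_iff\<close>)
  then show ?thesis using m by (simp add: has_bochner_integral_iff)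
qed

lemma gaussian_vector_norm_deviation:
  assumes v: "0 < v" and e: "0 < e" and n: "0 < n"
  shows "measure (gaussian_vector n v) {x\<in>space (gaussian_vector n v).
      real n * e \<le> \<bar>(\<Sum>i=1..n. (x i)\<^sup>2) - real n * v\<bar>} \<le> 2 * v\<^sup>2 / (real n * e\<^sup>2)"
proof -
  have "measure (PiM {1..n} (\<lambda>_. gaussian v)) {x\<in>space (PiM {1..n} (\<lambda>_. gaussian v)).
      real n * e \<le> \<bar>\<Sum>i\<in>{1..n}. ((x i)\<^sup>2 - v)\<bar>} \<le> (\<Sum>i\<in>{1..n}. 2 * v\<^sup>2) / (real n * e)\<^sup>2"
    by (rule PiM_Chebyshev) (use v e n prob_space_gaussian gaussian_moments in auto)
  then show ?thesis using n e
    by (simp add: gaussian_vector_def sum_subtractf power2_eq_square field_simps)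
qed

lemma gaussian_vector_inner_deviation:
  assumes v: "0 < v" and a: "0 < a"
  shows "measure (gaussian_vector n v) {x\<in>space (gaussian_vector n v).
      a \<le> \<bar>\<Sum>i=1..n. c i * x i\<bar>} \<le> v * (\<Sum>i=1..n. (c i)\<^sup>2) / a\<^sup>2"
proof -
  have "measure (PiM {1..n} (\<lambda>_. gaussian v)) {x\<in>space (PiM {1..n} (\<lambda>_. gaussian v)).
      a \<le> \<bar>\<Sum>i\<in>{1..n}. c i * x i\<bar>} \<le> (\<Sum>i\<in>{1..n}. (c i)\<^sup>2 * v) / a\<^sup>2"
    by (rule PiM_Chebyshev[where f="\<lambda>i x. c i * x"])
      (use v a prob_space_gaussian gaussian_moments[OF v] in
        \<open>auto simp: power_mult_distrib intro!: has_bochner_integral_mult_right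
          has_bochner_integral_mult_right[where x=0, simplified]\<close>)
  then show ?thesis
    by (simp add: gaussian_vector_def sum_distrib_left mult.commute)
qed

section \<open>Likelihood ratios and translated Gaussian laws\<close>

definition gaussian_ratio :: "real \<Rightarrow> real \<Rightarrow> real \<Rightarrow> real \<Rightarrow> real" where
  "gaussian_ratio m v v' x = normal_density m (sqrt v) x / normal_density 0 (sqrt v') x"

lemma gaussian_ratio_measurable [measurable (raw)]:
  assumes "f \<in> borel_measurable M" "g \<in> borel_measurable M"
  shows "(\<lambda>x. gaussian_ratio (f x) v v' (g x)) \<in> borel_measurable M"
  unfolding gaussian_ratio_def normal_density_def using assms by measurable

lemma gaussian_ratio_pos: "0 < v \<Longrightarrow> 0 < v' \<Longrightarrow> 0 < gaussian_ratio m v v' x"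
  by (simp add: gaussian_ratio_def normal_density_pos)

lemma nn_integral_gaussian_ratio:
  assumes v: "0 < v" "0 < v'" and [measurable]: "f \<in> borel_measurable borel"
  shows "(\<integral>\<^sup>+x. ennreal (gaussian_ratio m v v' x) * f x \<partial>gaussian v') = (\<integral>\<^sup>+x. f (m + x) \<partial>gaussian v)"
proof -
  have "(\<integral>\<^sup>+x. ennreal (gaussian_ratio m v v' x) * f x \<partial>gaussian v')
      = (\<integral>\<^sup>+x. ennreal (normal_density m (sqrt v) x) * f x \<partial>lborel)"
    using v by (subst nn_integral_gaussian, measurable, intro nn_integral_cong)
      (simp add: gaussian_ratio_def mult.assoc[symmetric] ennreal_mult'[symmetric] normal_density_pos
        less_imp_neq[THEN not_sym])
  also have "\<dots> = (\<integral>\<^sup>+x. ennreal (normal_density m (sqrt v) (m + x)) * f (m + x) \<partial>lborel)"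
    by (subst nn_integral_real_affine[where c=1 and t=m]) (auto simp: normal_density_def)
  also have "\<dots> = (\<integral>\<^sup>+x. f (m + x) \<partial>gaussian v)"
    by (subst nn_integral_gaussian) (auto simp: normal_density_def)
  finally show ?thesis .
qed

text \<open>Averaging a normal density over its random centre \<open>b + a * x\<close> is a
  convolution of normal densities. The substitution \<open>t = a * x\<close> behind this requires
  \<open>a \<noteq> 0\<close>, hence the case split.\<close>

lemma nn_integral_normal_density_gaussian:
  assumes v: "0 < v" "0 < w"
  shows "(\<integral>\<^sup>+x. ennreal (normal_density (b + a * x) (sqrt w) y) \<partial>gaussian v)
    = ennreal (normal_density b (sqrt (w + a\<^sup>2 * v)) y)"
proof (cases "a = 0")
  case True
  interpret prob_space "gaussian v" by (rule prob_space_gaussian[OF v(1)])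
  show ?thesis using True emeasure_space_1 by simp
next
  case False
  have "ennreal (normal_density b (sqrt (w + a\<^sup>2 * v)) y)
      = ennreal (normal_density 0 (sqrt ((sqrt w)\<^sup>2 + (\<bar>a\<bar> * sqrt v)\<^sup>2)) (y - b))"
    using v by (simp add: normal_density_def power_mult_distrib)
  also have "\<dots> = (\<integral>\<^sup>+t. ennreal (normal_density 0 (sqrt w) ((y - b) - t) * normal_density 0 (\<bar>a\<bar> * sqrt v) t) \<partial>lborel)"
    using conv_normal_density_zero_mean[of "sqrt w" "\<bar>a\<bar> * sqrt v"] v False
    by (auto dest!: fun_cong[where x="y - b"])
  also have "\<dots> = \<bar>a\<bar> * (\<integral>\<^sup>+x. ennreal (normal_density 0 (sqrt w) ((y - b) - (0 + a * x))
      * normal_density 0 (\<bar>a\<bar> * sqrt v) (0 + a * x)) \<partial>lborel)"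
    using False by (subst nn_integral_real_affine[where c=a and t=0]) auto
  also have "\<dots> = (\<integral>\<^sup>+x. ennreal \<bar>a\<bar> * ennreal (normal_density 0 (sqrt w) ((y - b) - (0 + a * x))
      * normal_density 0 (\<bar>a\<bar> * sqrt v) (0 + a * x)) \<partial>lborel)"
    by (subst nn_integral_cmult) auto
  also have "\<dots> = (\<integral>\<^sup>+x. ennreal (normal_density 0 (sqrt v) x) * ennreal (normal_density (b + a * x) (sqrt w) y) \<partial>lborel)"
  proof (intro nn_integral_cong)
    fix x
    have 1: "normal_density 0 (sqrt w) ((y - b) - (0 + a * x)) = normal_density (b + a * x) (sqrt w) y"
      by (simp add: normal_density_def algebra_simps)
    have 2: "\<bar>a\<bar> * normal_density 0 (\<bar>a\<bar> * sqrt v) (0 + a * x) = normal_density 0 (sqrt v) x"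
    proof -
      have "sqrt (2 * pi * (a\<^sup>2 * v)) = \<bar>a\<bar> * sqrt (2 * pi * v)"
        by (simp add: real_sqrt_mult)
      then show ?thesis using v False
        by (simp add: normal_density_def power_mult_distrib)
    qed
    show "ennreal \<bar>a\<bar> * ennreal (normal_density 0 (sqrt w) ((y - b) - (0 + a * x))
      * normal_density 0 (\<bar>a\<bar> * sqrt v) (0 + a * x))
      = ennreal (normal_density 0 (sqrt v) x) * ennreal (normal_density (b + a * x) (sqrt w) y)"
      unfolding 1 2[symmetric]
      by (simp add: ennreal_mult'[symmetric] ennreal_mult''[symmetric] normal_density_nonneg ac_simps)
  qed
  also have "\<dots> = (\<integral>\<^sup>+x. ennreal (normal_density (b + a * x) (sqrt w) y) \<partial>gaussian v)"
    by (subst nn_integral_gaussian) (auto simp: normal_density_def)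
  finally show ?thesis by simp
qed

lemma nn_integral_gaussian_vector_prod:
  assumes "0 < v" and "\<And>i. i \<in> {1..n} \<Longrightarrow> f i \<in> borel_measurable borel"
  shows "(\<integral>\<^sup>+x. (\<Prod>i=1..n. f i (x i)) \<partial>gaussian_vector n v) = (\<Prod>i=1..n. \<integral>\<^sup>+x. f i x \<partial>gaussian v)"
proof -
  interpret product_sigma_finite "\<lambda>_. gaussian v" by (rule product_sigma_finite_gaussian) fact
  show ?thesis unfolding gaussian_vector_def
    using assms by (intro product_nn_integral_prod) auto
qed

lemma indicator_PiE_prod:
  assumes "finite I" "x \<in> extensional I"
  shows "indicator (Pi\<^sub>E I A) x = (\<Prod>i\<in>I. indicator (A i) (x i) :: ennreal)"
  using assms by (auto simp: indicator_def PiE_iff)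

lemma emeasure_distr_eq_nn_integral:
  assumes "f \<in> M \<rightarrow>\<^sub>M N" "A \<in> sets N"
  shows "emeasure (distr M N f) A = (\<integral>\<^sup>+x. indicator A (f x) \<partial>M)"
  using nn_integral_distr[OF assms(1), of "indicator A"] assms by simp

lemma gaussian_vector_eqI:
  assumes v: "\<And>i. i \<in> {1..n} \<Longrightarrow> prob_space (M i)" "\<And>i. i \<in> {1..n} \<Longrightarrow> sets (M i) = sets borel"
    and "sets P = sets (real_vectors n)" "sets P' = sets (real_vectors n)"
    and P: "\<And>A. (\<And>i. i \<in> {1..n} \<Longrightarrow> A i \<in> sets borel) \<Longrightarrow>
      emeasure P (Pi\<^sub>E {1..n} A) = (\<Prod>i=1..n. emeasure (M i) (A i))"
    and P': "\<And>A. (\<And>i. i \<in> {1..n} \<Longrightarrow> A i \<in> sets borel) \<Longrightarrow>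
      emeasure P' (Pi\<^sub>E {1..n} A) = (\<Prod>i=1..n. emeasure (M i) (A i))"
  shows "P = (P' :: (nat \<Rightarrow> real) measure)"
proof -
  \<comment> \<open>The product locale quantifies over all indices, so coordinates outside
    \<open>{1..n}\<close> have to receive some probability measure as well.\<close>
  define K where "K i = (if i \<in> {1..n} then M i else gaussian 1)" for i
  have K: "prob_space (K i)" "sets (K i) = sets borel" for i
    using v prob_space_gaussian[of 1] by (auto simp: K_def)
  interpret product_sigma_finite K
    by (intro product_sigma_finite.intro prob_space_imp_sigma_finite K)
  have s: "sets (PiM {1..n} K) = sets (real_vectors n)"
    using K by (intro sets_PiM_cong) auto
  have "P = PiM {1..n} K"
    using assms K s by (intro PiM_eqI) (auto simp: K_def intro!: prod.cong)
  moreover have "P' = PiM {1..n} K"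
    using assms K s by (intro PiM_eqI) (auto simp: K_def intro!: prod.cong)
  ultimately show ?thesis by simp
qed

lemma prob_space_gaussian_shift:
  assumes "0 < v" shows "prob_space (distr (gaussian v) borel (\<lambda>x. m + x))"
  by (rule prob_space.prob_space_distr[OF prob_space_gaussian[OF assms]]) simp

text \<open>Lets a correlated codeword or a channel output be compared with an independent centred
  vector: on boxes both laws factor into the one-dimensional change of measure.\<close>

lemma distr_gaussian_vector_shift:
  assumes v: "0 < v" "0 < v'"
  shows "distr (gaussian_vector n v) (real_vectors n) (\<lambda>x. \<lambda>i\<in>{1..n}. m i + x i)
    = density (gaussian_vector n v') (\<lambda>x. \<Prod>i=1..n. ennreal (gaussian_ratio (m i) v v' (x i)))"
proof (rule gaussian_vector_eqI[where M="\<lambda>i. distr (gaussian v) borel (\<lambda>x. m i + x)"])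
  fix A :: "nat \<Rightarrow> real set"
  assume A: "\<And>i. i \<in> {1..n} \<Longrightarrow> A i \<in> sets borel"
  have [measurable]: "Pi\<^sub>E {1..n} A \<in> sets (real_vectors n)"
    using A by (intro sets_PiM_I_finite) auto
  have ext: "x \<in> extensional {1..n}" if "x \<in> space (gaussian_vector n w)" for x w
    using that by (auto simp: space_gaussian_vector space_PiM PiE_iff)
  have e: "emeasure (distr (gaussian v) borel (\<lambda>x. m i + x)) (A i)
      = (\<integral>\<^sup>+x. indicator (A i) (m i + x) \<partial>gaussian v)" if "i \<in> {1..n}" for i
    using A[OF that]
    by (subst emeasure_distr_eq_nn_integral) auto
  have "emeasure (distr (gaussian_vector n v) (real_vectors n) (\<lambda>x. \<lambda>i\<in>{1..n}. m i + x i)) (Pi\<^sub>E {1..n} A)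
      = (\<integral>\<^sup>+x. indicator (Pi\<^sub>E {1..n} A) (\<lambda>i\<in>{1..n}. m i + x i) \<partial>gaussian_vector n v)"
    by (subst emeasure_distr_eq_nn_integral) auto
  also have "\<dots> = (\<integral>\<^sup>+x. (\<Prod>i=1..n. indicator (A i) (m i + x i)) \<partial>gaussian_vector n v)"
    by (intro nn_integral_cong, subst indicator_PiE_prod) auto
  also have "\<dots> = (\<Prod>i=1..n. emeasure (distr (gaussian v) borel (\<lambda>x. m i + x)) (A i))"
    using A v by (subst nn_integral_gaussian_vector_prod[of v n "\<lambda>i x. indicator (A i) (m i + x)"])
      (auto simp: e intro!: prod.cong)
  finally show "emeasure (distr (gaussian_vector n v) (real_vectors n) (\<lambda>x. \<lambda>i\<in>{1..n}. m i + x i)) (Pi\<^sub>E {1..n} A)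
      = (\<Prod>i=1..n. emeasure (distr (gaussian v) borel (\<lambda>x. m i + x)) (A i))" .
  have "emeasure (density (gaussian_vector n v') (\<lambda>x. \<Prod>i=1..n. ennreal (gaussian_ratio (m i) v v' (x i)))) (Pi\<^sub>E {1..n} A)
      = (\<integral>\<^sup>+x. (\<Prod>i=1..n. ennreal (gaussian_ratio (m i) v v' (x i))) * indicator (Pi\<^sub>E {1..n} A) x \<partial>gaussian_vector n v')"
    by (subst emeasure_density) auto
  also have "\<dots> = (\<integral>\<^sup>+x. (\<Prod>i=1..n. ennreal (gaussian_ratio (m i) v v' (x i)) * indicator (A i) (x i)) \<partial>gaussian_vector n v')"
    by (intro nn_integral_cong, subst indicator_PiE_prod) (auto simp: prod.distrib ext)
  also have "\<dots> = (\<Prod>i=1..n. \<integral>\<^sup>+x. ennreal (gaussian_ratio (m i) v v' x) * indicator (A i) x \<partial>gaussian v')"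
    using A v by (subst nn_integral_gaussian_vector_prod) auto
  also have "\<dots> = (\<Prod>i=1..n. emeasure (distr (gaussian v) borel (\<lambda>x. m i + x)) (A i))"
    using A v by (intro prod.cong refl, subst nn_integral_gaussian_ratio) (auto simp: e)
  finally show "emeasure (density (gaussian_vector n v') (\<lambda>x. \<Prod>i=1..n. ennreal (gaussian_ratio (m i) v v' (x i)))) (Pi\<^sub>E {1..n} A)
      = (\<Prod>i=1..n. emeasure (distr (gaussian v) borel (\<lambda>x. m i + x)) (A i))" .
qed (use v in \<open>auto intro: prob_space_gaussian_shift\<close>)

text \<open>Serves the eavesdropper: with \<open>a = sqrt g\<close> the two noises combine to
  variance \<open>g + (1 - g) = 1\<close>, so its channel is that of the destination with the input
  scaled by \<open>sqrt g\<close>.\<close>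

lemma distr_gaussian_vector_add:
  assumes v: "0 < v" "0 < w"
  shows "distr (gaussian_vector n v \<Otimes>\<^sub>M gaussian_vector n w) (real_vectors n)
      (\<lambda>(x, y). \<lambda>i\<in>{1..n}. a * x i + y i) = gaussian_vector n (w + a\<^sup>2 * v)"
proof (rule gaussian_vector_eqI[where M="\<lambda>i. gaussian (w + a\<^sup>2 * v)"])
  interpret W: prob_space "gaussian_vector n w" by (rule prob_space_gaussian_vector[OF v(2)])
  interpret w: prob_space "gaussian w" by (rule prob_space_gaussian[OF v(2)])
  interpret V: prob_space "gaussian v" by (rule prob_space_gaussian[OF v(1)])
  interpret L: pair_sigma_finite lborel "gaussian v" ..
  have wa: "0 < w + a\<^sup>2 * v" using v by (simp add: add_pos_nonneg)
  fix A :: "nat \<Rightarrow> real set"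
  assume A: "\<And>i. i \<in> {1..n} \<Longrightarrow> A i \<in> sets borel"
  have [measurable]: "Pi\<^sub>E {1..n} A \<in> sets (real_vectors n)"
    using A by (intro sets_PiM_I_finite) auto
  interpret product_sigma_finite "\<lambda>_. gaussian (w + a\<^sup>2 * v)"
    by (rule product_sigma_finite_gaussian[OF wa])
  show "emeasure (gaussian_vector n (w + a\<^sup>2 * v)) (Pi\<^sub>E {1..n} A) = (\<Prod>i=1..n. emeasure (gaussian (w + a\<^sup>2 * v)) (A i))"
    unfolding gaussian_vector_def using A by (intro emeasure_PiM) auto
  \<comment> \<open>One coordinate of the convolution: the inner integral has a density centred at
    \<open>a * x\<close>, and exchanging the integrals allows this density to be averaged over
    \<open>x\<close> first.\<close>
  have one: "(\<integral>\<^sup>+x. \<integral>\<^sup>+y. indicator (A i) (a * x + y) \<partial>gaussian w \<partial>gaussian v)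
      = emeasure (gaussian (w + a\<^sup>2 * v)) (A i)" if i: "i \<in> {1..n}" for i
  proof -
    note [measurable] = A[OF i]
    have "(\<integral>\<^sup>+x. \<integral>\<^sup>+y. indicator (A i) (a * x + y) \<partial>gaussian w \<partial>gaussian v)
      = (\<integral>\<^sup>+x. \<integral>\<^sup>+y. ennreal (normal_density (a * x) (sqrt w) y) * indicator (A i) y \<partial>lborel \<partial>gaussian v)"
    proof (intro nn_integral_cong)
      fix x
      have "(\<integral>\<^sup>+y. indicator (A i) (a * x + y) \<partial>gaussian w)
        = (\<integral>\<^sup>+y. ennreal (normal_density 0 (sqrt w) y) * indicator (A i) (a * x + y) \<partial>lborel)"
        by (subst nn_integral_gaussian) auto
      also have "\<dots> = (\<integral>\<^sup>+y. ennreal (normal_density (a * x) (sqrt w) y) * indicator (A i) y \<partial>lborel)"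
        by (subst (2) nn_integral_real_affine[where c=1 and t="a * x"]) (auto simp: normal_density_def)
      finally show "(\<integral>\<^sup>+y. indicator (A i) (a * x + y) \<partial>gaussian w)
        = (\<integral>\<^sup>+y. ennreal (normal_density (a * x) (sqrt w) y) * indicator (A i) y \<partial>lborel)" .
    qed
    also have "\<dots> = (\<integral>\<^sup>+y. \<integral>\<^sup>+x. ennreal (normal_density (a * x) (sqrt w) y) * indicator (A i) y \<partial>gaussian v \<partial>lborel)"
      by (subst L.Fubini') (auto simp: normal_density_def)
    also have "\<dots> = (\<integral>\<^sup>+y. ennreal (normal_density 0 (sqrt (w + a\<^sup>2 * v)) y) * indicator (A i) y \<partial>lborel)"
      using nn_integral_normal_density_gaussian[OF v, of 0 a]
      by (intro nn_integral_cong, subst nn_integral_multc) (auto simp: normal_density_def)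
    also have "\<dots> = emeasure (gaussian (w + a\<^sup>2 * v)) (A i)"
      unfolding gaussian_def by (subst emeasure_density) auto
    finally show ?thesis .
  qed
  have "emeasure (distr (gaussian_vector n v \<Otimes>\<^sub>M gaussian_vector n w) (real_vectors n)
      (\<lambda>(x, y). \<lambda>i\<in>{1..n}. a * x i + y i)) (Pi\<^sub>E {1..n} A)
    = (\<integral>\<^sup>+p. indicator (Pi\<^sub>E {1..n} A) (\<lambda>i\<in>{1..n}. a * fst p i + snd p i) \<partial>(gaussian_vector n v \<Otimes>\<^sub>M gaussian_vector n w))"
    by (subst emeasure_distr_eq_nn_integral) (auto simp: split_beta')
  also have "\<dots> = (\<integral>\<^sup>+x. \<integral>\<^sup>+y. indicator (Pi\<^sub>E {1..n} A) (\<lambda>i\<in>{1..n}. a * x i + y i) \<partial>gaussian_vector n w \<partial>gaussian_vector n v)"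
    by (subst W.nn_integral_fst[symmetric]) auto
  also have "\<dots> = (\<integral>\<^sup>+x. \<integral>\<^sup>+y. (\<Prod>i=1..n. indicator (A i) (a * x i + y i)) \<partial>gaussian_vector n w \<partial>gaussian_vector n v)"
    by (intro nn_integral_cong, subst indicator_PiE_prod) auto
  also have "\<dots> = (\<integral>\<^sup>+x. (\<Prod>i=1..n. \<integral>\<^sup>+y. indicator (A i) (a * x i + y) \<partial>gaussian w) \<partial>gaussian_vector n v)"
    using A v(2) by (intro nn_integral_cong,
      subst nn_integral_gaussian_vector_prod[of w n "\<lambda>i y. indicator (A i) (a * _ i + y)"]) auto
  also have "\<dots> = (\<Prod>i=1..n. \<integral>\<^sup>+x. \<integral>\<^sup>+y. indicator (A i) (a * x + y) \<partial>gaussian w \<partial>gaussian v)"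
    using A v(1) by (subst nn_integral_gaussian_vector_prod[of v n "\<lambda>i x. \<integral>\<^sup>+y. indicator (A i) (a * x + y) \<partial>gaussian w"]) auto
  also have "\<dots> = (\<Prod>i=1..n. emeasure (gaussian (w + a\<^sup>2 * v)) (A i))"
    by (intro prod.cong refl one)
  finally show "emeasure (distr (gaussian_vector n v \<Otimes>\<^sub>M gaussian_vector n w) (real_vectors n)
      (\<lambda>(x, y). \<lambda>i\<in>{1..n}. a * x i + y i)) (Pi\<^sub>E {1..n} A) = (\<Prod>i=1..n. emeasure (gaussian (w + a\<^sup>2 * v)) (A i))" .
qed (use v in \<open>auto intro!: prob_space_gaussian add_pos_nonneg\<close>)

section \<open>Typical pairs of correlated Gaussian vectors\<close>

lemma normal_density_neq_0: "0 < s \<Longrightarrow> normal_density m s x \<noteq> 0"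
  using normal_density_pos[of s m x] by simp

definition ip :: "nat \<Rightarrow> (nat \<Rightarrow> real) \<Rightarrow> (nat \<Rightarrow> real) \<Rightarrow> real" where
  "ip n x y = (\<Sum>i=1..n. x i * y i)"

lemma ip_commute: "ip n x y = ip n y x"
  by (simp add: ip_def mult.commute)

lemma ip_linear:
  "ip n (\<lambda>i. x i + y i) z = ip n x z + ip n y z" "ip n z (\<lambda>i. x i + y i) = ip n z x + ip n z y"
  "ip n (\<lambda>i. x i - y i) z = ip n x z - ip n y z" "ip n z (\<lambda>i. x i - y i) = ip n z x - ip n z y"
  "ip n (\<lambda>i. c * x i) z = c * ip n x z" "ip n z (\<lambda>i. c * x i) = c * ip n z x"
  by (simp_all add: ip_def algebra_simps sum.distrib sum_subtractf sum_distrib_left)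

lemma ip_measurable [measurable (raw)]:
  assumes "f \<in> M \<rightarrow>\<^sub>M real_vectors n" "g \<in> M \<rightarrow>\<^sub>M real_vectors n"
  shows "(\<lambda>x. ip n (f x) (g x)) \<in> borel_measurable M"
  unfolding ip_def using assms by measurable

lemma ip_cong: "(\<And>i. i \<in> {1..n} \<Longrightarrow> x i = x' i) \<Longrightarrow> (\<And>i. i \<in> {1..n} \<Longrightarrow> y i = y' i) \<Longrightarrow> ip n x y = ip n x' y'"
  by (simp add: ip_def)

section \<open>Exponents of likelihood ratios and the threshold test of the decoder\<close>

lemma gaussian_ratio_eq_exp:
  assumes "0 < v" "0 < v'"
  shows "gaussian_ratio m v v' x = exp (1/2 * ln (v' / v) - (x - m)\<^sup>2 / (2 * v) + x\<^sup>2 / (2 * v'))"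
proof -
  have "exp (1/2 * ln (v' / v)) = sqrt (v' / v)"
    using assms by (simp add: ln_sqrt[symmetric])
  moreover have "gaussian_ratio m v v' x
      = sqrt (v' / v) * (exp (- (x - m)\<^sup>2 / (2 * v)) / exp (- x\<^sup>2 / (2 * v')))"
    using assms by (simp add: gaussian_ratio_def normal_density_def real_sqrt_divide real_sqrt_mult)
  moreover have "exp (1/2 * ln (v' / v) - (x - m)\<^sup>2 / (2 * v) + x\<^sup>2 / (2 * v'))
      = exp (1/2 * ln (v' / v)) * (exp (- (x - m)\<^sup>2 / (2 * v)) / exp (- x\<^sup>2 / (2 * v')))"
    unfolding exp_diff[symmetric] exp_add[symmetric] by (rule arg_cong[where f=exp]) simp
  ultimately show ?thesis by simp
qed

lemma prod_gaussian_ratio_eq_exp: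
  assumes "0 < v" "0 < v'"
  shows "(\<Prod>i=1..n. gaussian_ratio (m i) v v' (x i))
    = exp (real n / 2 * ln (v' / v) - (\<Sum>i=1..n. (x i - m i)\<^sup>2) / (2 * v) + (\<Sum>i=1..n. (x i)\<^sup>2) / (2 * v'))"
  using assms
  by (simp add: gaussian_ratio_eq_exp exp_sum[symmetric] sum.distrib sum_subtractf sum_divide_distrib)

text \<open>Thresholds the likelihood ratio of the output given an input part \<open>U\<close>, of
  variance \<open>u\<close> per coordinate, against the output without it. The rest
  \<open>X - U\<close> of the input is regarded as known and is subtracted with gain
  \<open>s\<close>. \<open>U = X\<close> tests both codewords at once; a regression residual as
  \<open>U\<close> tests one codeword given the other.\<close>

definition info_ge :: "nat \<Rightarrow> real \<Rightarrow> real \<Rightarrow> real \<Rightarrow> (nat \<Rightarrow> real) \<Rightarrow> (nat \<Rightarrow> real) \<Rightarrow> (nat \<Rightarrow> real) \<Rightarrow> bool" where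
  "info_ge n s u g U X y \<longleftrightarrow>
     exp (real n * g) \<le> (\<Prod>i=1..n. gaussian_ratio (s * U i) 1 (1 + s\<^sup>2 * u) (y i - s * (X i - U i)))"

text \<open>With \<open>t = 1 + s^2 * u\<close> the log-ratio is
  \<open>n/2 * ln t - |z|^2 / 2 + |s * U + z|^2 / (2 * t)\<close>, so only the norm of the noise and
  its inner product with \<open>U\<close> can spoil it. Chebyshev with deviation \<open>h/2\<close>
  contributes \<open>8\<close> and \<open>4 * u + 2 * h\<close> to the constant.\<close>

lemma info_ge_typical:
  assumes u: "0 \<le> u" and s: "0 \<le> s" "s \<le> 1" and h: "0 < h" and n: "0 < n"
    and U: "\<bar>ip n U U - real n * u\<bar> \<le> real n * (h / 2)"
  shows "measure (gaussian_vector n 1) {z\<in>space (gaussian_vector n 1).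
      \<not> info_ge n s u (1/2 * ln (1 + s\<^sup>2 * u) - h) U X (\<lambda>i. s * X i + z i)}
    \<le> (8 + 4 * u + 2 * h) / h\<^sup>2 / real n" (is "measure ?G ?B \<le> _")
proof -
  interpret prob_space ?G by (rule prob_space_gaussian_vector) simp
  define t where "t = 1 + s\<^sup>2 * u"
  have t: "1 \<le> t" using u by (simp add: t_def)
  define B1 where "B1 = {z\<in>space ?G. real n * (h/2) \<le> \<bar>(\<Sum>i=1..n. (z i)\<^sup>2) - real n * 1\<bar>}"
  define B2 where "B2 = {z\<in>space ?G. real n * (h/2) \<le> \<bar>\<Sum>i=1..n. U i * z i\<bar>}"
  have B12: "B1 \<in> sets ?G" "B2 \<in> sets ?G" unfolding B1_def B2_def by measurable
  note [measurable] = B12[unfolded sets_gaussian_vector]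
  have b1: "prob B1 \<le> 2 * 1\<^sup>2 / (real n * (h/2)\<^sup>2)"
    unfolding B1_def by (rule gaussian_vector_norm_deviation) (use h n in auto)
  have b2: "prob B2 \<le> 1 * (\<Sum>i=1..n. (U i)\<^sup>2) / (real n * (h/2))\<^sup>2"
    unfolding B2_def by (rule gaussian_vector_inner_deviation) (use h n in auto)
  have uu: "(\<Sum>i=1..n. (U i)\<^sup>2) \<le> real n * (u + h/2)"
  proof -
    have "ip n U U \<le> real n * u + real n * (h / 2)" using U by linarith
    then show ?thesis by (simp add: ip_def power2_eq_square algebra_simps)
  qed
  have "?B \<subseteq> B1 \<union> B2"
  proof (rule ccontr)
    assume "\<not> ?B \<subseteq> B1 \<union> B2"
    then obtain z where z: "z \<in> ?B" "z \<notin> B1" "z \<notin> B2" by auto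
    have z1: "ip n z z \<le> real n * (1 + h/2)" and z2: "- (real n * (h/2)) \<le> ip n U z"
    proof -
      have "\<not> real n * (h/2) \<le> \<bar>ip n z z - real n * 1\<bar>" "\<not> real n * (h/2) \<le> \<bar>ip n U z\<bar>"
        using z by (auto simp: B1_def B2_def ip_def power2_eq_square)
      then have "ip n z z \<le> real n * 1 + real n * (h/2)" "- (real n * (h/2)) \<le> ip n U z" by linarith+
      then show "ip n z z \<le> real n * (1 + h/2)" "- (real n * (h/2)) \<le> ip n U z"
        by (simp_all add: distrib_left)
    qed
    have "(\<Sum>i=1..n. (s * U i + z i)\<^sup>2) = s\<^sup>2 * ip n U U + 2 * s * ip n U z + ip n z z"
      by (simp add: ip_def power2_eq_square algebra_simps sum.distrib sum_distrib_left)
    moreover have "(\<Sum>i=1..n. (s * U i + z i - s * U i)\<^sup>2) = ip n z z"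
      by (simp add: ip_def power2_eq_square)
    ultimately have eq: "(\<Prod>i=1..n. gaussian_ratio (s * U i) 1 t (s * X i + z i - s * (X i - U i)))
       = exp (real n / 2 * ln t - ip n z z / 2 + (s\<^sup>2 * ip n U U + 2 * s * ip n U z + ip n z z) / (2 * t))"
      using t by (subst prod_gaussian_ratio_eq_exp[where x="\<lambda>i. s * X i + z i - s * (X i - U i)"])
         (simp_all add: algebra_simps)
    have st: "s\<^sup>2 \<le> 1" using s by (simp add: power_le_one)
    have 1: "s\<^sup>2 * (real n * u - real n * (h/2)) \<le> s\<^sup>2 * ip n U U"
    proof (intro mult_left_mono)
      show "real n * u - real n * (h/2) \<le> ip n U U" using U by linarith
    qed simp
    have 2: "2 * s * (- (real n * (h/2))) \<le> 2 * s * ip n U z"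
      using z2 s by (intro mult_left_mono) auto
    have 3: "(t - 1) * ip n z z \<le> (t - 1) * (real n * (1 + h/2))"
      using z1 t by (intro mult_left_mono) auto
    have 4: "s\<^sup>2 * (real n * (h/2)) \<le> 1 * (real n * (h/2))" "2 * s * (real n * (h/2)) \<le> 2 * (real n * (h/2))"
      using st s h by (intro mult_right_mono; simp)+
    have 6: "real n * h \<le> t * (real n * h)"
      using t h mult_right_mono[of 1 t "real n * h"] by simp
    have 5: "2 * s * (- (real n * (h/2))) = - (2 * s * (real n * (h/2)))" "2 * (real n * (h/2)) = real n * h"
      "1 * (real n * (h/2)) = real n * h / 2"
      "s\<^sup>2 * (real n * u - real n * (h/2)) = (t - 1) * real n - s\<^sup>2 * (real n * (h/2))"
      "(t - 1) * (real n * (1 + h/2)) = (t - 1) * real n + t * (real n * h) / 2 - real n * h / 2"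
      by (simp_all add: t_def field_simps)
    \<comment> \<open>\<open>2 * t\<close> times the deviation of the exponent from
      \<open>n/2 * ln t\<close> is at least \<open>- 2 * t * n * h\<close>.\<close>
    have "0 \<le> - ((t - 1) * ip n z z) + s\<^sup>2 * ip n U U + 2 * s * ip n U z + 2 * (t * (real n * h))"
      using 1 2 3 4 6 mult_nonneg_nonneg[OF of_nat_0_le_iff[of n] less_imp_le[OF h]] unfolding 5 by linarith
    then have "0 \<le> - (t - 1) * ip n z z + s\<^sup>2 * ip n U U + 2 * s * ip n U z + 2 * t * (real n * h)"
      by (simp add: algebra_simps)
    then have "0 \<le> (- (t - 1) * ip n z z + s\<^sup>2 * ip n U U + 2 * s * ip n U z + 2 * t * (real n * h)) / (2 * t)"
      using t by (intro divide_nonneg_nonneg) auto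
    also have "\<dots> = - ip n z z / 2 + (s\<^sup>2 * ip n U U + 2 * s * ip n U z + ip n z z) / (2 * t) + real n * h"
      using t by (simp add: field_simps)
    finally have "real n * (1/2 * ln t - h)
       \<le> real n / 2 * ln t - ip n z z / 2 + (s\<^sup>2 * ip n U U + 2 * s * ip n U z + ip n z z) / (2 * t)"
      by (simp add: algebra_simps)
    then have "info_ge n s u (1/2 * ln (1 + s\<^sup>2 * u) - h) U X (\<lambda>i. s * X i + z i)"
      unfolding info_ge_def t_def[symmetric] eq by simp
    with z show False by simp
  qed
  then have "prob ?B \<le> prob (B1 \<union> B2)"
    by (intro finite_measure_mono sets.Un B12)
  also have "\<dots> \<le> prob B1 + prob B2"
    by (intro measure_Un_le B12)
  also have "\<dots> \<le> 2 * 1\<^sup>2 / (real n * (h/2)\<^sup>2) + 1 * (real n * (u + h/2)) / (real n * (h/2))\<^sup>2"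
    by (intro add_mono b1 order_trans[OF b2] divide_right_mono mult_left_mono uu) auto
  also have "\<dots> = (8 + 4 * u + 2 * h) / h\<^sup>2 / real n"
    using h n by (simp add: field_simps power2_eq_square)
  finally show ?thesis .
qed

text \<open>Target joint law of the two inputs, with variances \<open>p1\<close>, \<open>p2\<close>
  and covariance \<open>kap\<close>. Nondegeneracy keeps the conditional variances positive, so that
  all densities exist.\<close>

locale gaussian_pair =
  fixes p1 p2 kap :: real
  assumes p1: "0 < p1" and p2: "0 < p2" and det: "kap\<^sup>2 < p1 * p2"
begin

text \<open>\<open>slope\<close> is the regression coefficient of the second input on the first,
  \<open>rvar\<close> the conditional variance, \<open>sump\<close> the variance of the sum and
  \<open>mi\<close> the mutual information in nats. \<open>modulus\<close> bounds how far an
  accuracy \<open>e\<close> in the typicality conditions is magnified in exponents: its first two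
  terms serve \<open>joint_ratio\<close>, the third the residual \<open>y - slope * x\<close>, and
  \<open>8\<close> the sum of the codewords.\<close>

definition "slope = kap / p1"
definition "rvar = p2 - kap\<^sup>2 / p1"
definition "sump = p1 + p2 + 2 * kap"
definition "mi = 1/2 * ln (p1 * p2 / (p1 * p2 - kap\<^sup>2))"
definition "modulus = (1 + \<bar>slope\<bar>)\<^sup>2 / (2 * rvar) + 1 / (2 * p2) + 2 * (1 + \<bar>slope\<bar>)\<^sup>2 + 8"

definition typical :: "nat \<Rightarrow> real \<Rightarrow> (nat \<Rightarrow> real) \<Rightarrow> (nat \<Rightarrow> real) \<Rightarrow> bool" where
  "typical n e x y \<longleftrightarrow> \<bar>ip n x x - real n * p1\<bar> \<le> real n * e \<and> \<bar>ip n y y - real n * p2\<bar> \<le> real n * e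
     \<and> \<bar>ip n x y - real n * kap\<bar> \<le> real n * e"

lemma rvar_pos: "0 < rvar"
  using p1 det by (simp add: rvar_def field_simps)

lemma rvar_eq: "rvar = p2 - slope * kap" "rvar = p2 - slope\<^sup>2 * p1" "slope * p1 = kap"
    "rvar = p2 - 2 * slope * kap + slope\<^sup>2 * p1"
  using p1 by (simp_all add: rvar_def slope_def power2_eq_square field_simps)

lemma mi_eq: "mi = 1/2 * ln (p2 / rvar)"
proof -
  have "p2 / rvar = p1 * p2 / (p1 * p2 - kap\<^sup>2)"
    using p1 det by (simp add: rvar_def field_simps)
  then show ?thesis by (simp add: mi_def)
qed

lemma mi_nonneg: "0 \<le> mi"
proof -
  have "1 \<le> p2 / rvar" using rvar_pos p1 by (simp add: rvar_def)
  then show ?thesis unfolding mi_eq by simp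
qed

lemma sump_eq: "sump = (1 + slope)\<^sup>2 * p1 + rvar"
  using p1 by (simp add: sump_def rvar_def slope_def power2_eq_square field_simps)

lemma sump_pos: "0 < sump"
  unfolding sump_eq using p1 rvar_pos by (simp add: add_nonneg_pos)

lemma modulus_nonneg: "8 \<le> modulus"
  using rvar_pos p2 by (simp add: modulus_def)

lemma typical_residual:
  assumes "typical n e x y" and "e * modulus \<le> h" "0 < e"
  shows "\<bar>ip n (\<lambda>i. y i - slope * x i) (\<lambda>i. y i - slope * x i) - real n * rvar\<bar> \<le> real n * (e * (1 + \<bar>slope\<bar>)\<^sup>2)"
    and "e * (1 + \<bar>slope\<bar>)\<^sup>2 \<le> h / 2"
proof -
  have eq: "ip n (\<lambda>i. y i - slope * x i) (\<lambda>i. y i - slope * x i) - real n * rvar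
    = (ip n y y - real n * p2) - 2 * slope * (ip n x y - real n * kap) + slope\<^sup>2 * (ip n x x - real n * p1)"
    unfolding rvar_eq(4) ip_linear by (simp add: ip_commute[of n y x] power2_eq_square algebra_simps)
  have "\<bar>ip n (\<lambda>i. y i - slope * x i) (\<lambda>i. y i - slope * x i) - real n * rvar\<bar> \<le> \<bar>ip n y y - real n * p2\<bar> + \<bar>2 * slope * (ip n x y - real n * kap)\<bar> + \<bar>slope\<^sup>2 * (ip n x x - real n * p1)\<bar>"
    unfolding eq by linarith
  also have "\<dots> \<le> real n * e + 2 * \<bar>slope\<bar> * (real n * e) + slope\<^sup>2 * (real n * e)"
    unfolding abs_mult using assms by (intro add_mono mult_mono) (auto simp: typical_def)
  also have "\<dots> = real n * (e * (1 + \<bar>slope\<bar>)\<^sup>2)"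
    by (simp add: power2_eq_square algebra_simps)
  finally show "\<bar>ip n (\<lambda>i. y i - slope * x i) (\<lambda>i. y i - slope * x i) - real n * rvar\<bar> \<le> real n * (e * (1 + \<bar>slope\<bar>)\<^sup>2)" .
  have "e * (2 * (1 + \<bar>slope\<bar>)\<^sup>2) \<le> e * modulus"
    using assms rvar_pos p2 by (intro mult_left_mono) (auto simp: modulus_def)
  moreover have "e * (2 * (1 + \<bar>slope\<bar>)\<^sup>2) = 2 * (e * (1 + \<bar>slope\<bar>)\<^sup>2)" by simp
  ultimately show "e * (1 + \<bar>slope\<bar>)\<^sup>2 \<le> h / 2" using assms by linarith
qed

lemma abs_combination:
  fixes a b c E :: real
  assumes "\<bar>a\<bar> \<le> E" "\<bar>b\<bar> \<le> E" "\<bar>c\<bar> \<le> E"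
  shows "\<bar>a + b + 2 * c\<bar> \<le> 4 * E"
  using assms by linarith

lemma typical_sum:
  assumes "typical n e x y" and "e * modulus \<le> h" "0 < e"
  shows "\<bar>ip n (\<lambda>i. x i + y i) (\<lambda>i. x i + y i) - real n * sump\<bar> \<le> real n * (4 * e)" "4 * e \<le> h / 2"
proof -
  have "ip n (\<lambda>i. x i + y i) (\<lambda>i. x i + y i) - real n * sump
    = (ip n x x - real n * p1) + (ip n y y - real n * p2) + 2 * (ip n x y - real n * kap)"
    by (simp add: ip_linear ip_commute[of n y x] sump_def algebra_simps)
  moreover have "\<bar>(ip n x x - real n * p1) + (ip n y y - real n * p2) + 2 * (ip n x y - real n * kap)\<bar> \<le> 4 * (real n * e)"
    using assms(1) by (intro abs_combination) (auto simp: typical_def)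
  ultimately show "\<bar>ip n (\<lambda>i. x i + y i) (\<lambda>i. x i + y i) - real n * sump\<bar> \<le> real n * (4 * e)"
    by simp
  have "e * 8 \<le> e * modulus" using assms modulus_nonneg by (intro mult_left_mono) auto
  then show "4 * e \<le> h / 2" using assms by linarith
qed

text \<open>The density of the correlated law of the pair relative to the product law; only the
  conditional law of the second vector changes.\<close>

definition joint_ratio :: "nat \<Rightarrow> (nat \<Rightarrow> real) \<Rightarrow> (nat \<Rightarrow> real) \<Rightarrow> real" where
  "joint_ratio n x y = (\<Prod>i=1..n. gaussian_ratio (slope * x i) rvar p2 (y i))"

text \<open>The exponent is \<open>n * mi\<close> plus a combination of the deviations of
  \<open>|y - slope * x|^2\<close> and \<open>|y|^2\<close> from their means, and typicality
  controls both.\<close>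

lemma joint_ratio_typical:
  assumes T: "typical n e x y" and e: "e * modulus \<le> h" "0 < e"
  shows "joint_ratio n x y \<le> exp (real n * (mi + h))" "exp (real n * (mi - h)) \<le> joint_ratio n x y"
proof -
  let ?R = "ip n (\<lambda>i. y i - slope * x i) (\<lambda>i. y i - slope * x i)"
  have eq: "joint_ratio n x y = exp (real n * mi - ?R / (2 * rvar) + ip n y y / (2 * p2))"
    unfolding joint_ratio_def mi_eq
    using rvar_pos p2 by (subst prod_gaussian_ratio_eq_exp) (auto simp: ip_def power2_eq_square)
  have eq': "- ?R / (2 * rvar) + ip n y y / (2 * p2) = - ((?R - real n * rvar) / (2 * rvar)) + (ip n y y - real n * p2) / (2 * p2)"
    using rvar_pos p2 by (simp add: field_simps)
  have "\<bar>- ?R / (2 * rvar) + ip n y y / (2 * p2)\<bar> \<le> \<bar>(?R - real n * rvar) / (2 * rvar)\<bar> + \<bar>(ip n y y - real n * p2) / (2 * p2)\<bar>"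
    unfolding eq' by linarith
  also have "\<dots> \<le> real n * (e * (1 + \<bar>slope\<bar>)\<^sup>2) / (2 * rvar) + real n * e / (2 * p2)"
    unfolding abs_divide using typical_residual(1)[OF assms] T rvar_pos p2
    by (intro add_mono divide_mono) (auto simp: typical_def)
  also have "\<dots> = real n * (e * ((1 + \<bar>slope\<bar>)\<^sup>2 / (2 * rvar) + 1 / (2 * p2)))"
    by (simp add: algebra_simps)
  also have "\<dots> \<le> real n * (e * modulus)"
    using e by (intro mult_left_mono) (auto simp: modulus_def)
  also have "\<dots> \<le> real n * h"
    using e by (intro mult_left_mono) auto
  finally have b: "\<bar>- ?R / (2 * rvar) + ip n y y / (2 * p2)\<bar> \<le> real n * h" .
  show "joint_ratio n x y \<le> exp (real n * (mi + h))" "exp (real n * (mi - h)) \<le> joint_ratio n x y"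
    using b unfolding eq by (auto simp: algebra_simps)
qed

lemma typical_measurable [measurable (raw)]:
  assumes "f \<in> M \<rightarrow>\<^sub>M real_vectors n" "g \<in> M \<rightarrow>\<^sub>M real_vectors n"
  shows "Measurable.pred M (\<lambda>x. typical n e (f x) (g x))"
  unfolding typical_def using assms by measurable

text \<open>Markov's inequality for a product of two likelihood ratios. On the event both exceed
  their thresholds, so the indicator is at most \<open>exp (- n * (mi - h)) * exp (- n * g)\<close>
  times their product. This product integrates to 1: the first ratio turns the law of
  \<open>y\<close> into the conditional law given \<open>x\<close>, and averaging the output density
  over that law yields the denominator of the second ratio.\<close>

lemma nn_integral_typical_info_conditional:
  assumes e: "e * modulus \<le> h" "0 < e"
  shows "(\<integral>\<^sup>+y. indicator {y. typical n e x y \<and> info_ge n s rvar g (\<lambda>i. y i - slope * x i) (\<lambda>i. x i + y i) z} y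
      \<partial>gaussian_vector n p2) \<le> ennreal (exp (- (real n * (mi - h))) * exp (- (real n * g)))"
proof -
  define t where "t = 1 + s\<^sup>2 * rvar"
  have t: "0 < t" using rvar_pos by (simp add: t_def add_pos_nonneg)
  define f where "f i y = gaussian_ratio (slope * x i) rvar p2 y
      * gaussian_ratio (s * (y - slope * x i)) 1 t (z i - s * ((1 + slope) * x i))" for i y
  have f_nn: "0 \<le> f i y" for i y
    using rvar_pos p2 t by (simp add: f_def gaussian_ratio_pos less_imp_le)
  have f_m: "f i \<in> borel_measurable borel" for i
    unfolding f_def by measurable
  have f1: "(\<integral>\<^sup>+y. ennreal (f i y) \<partial>gaussian p2) = 1" for i
  proof -
    have "(\<integral>\<^sup>+y. ennreal (f i y) \<partial>gaussian p2) =
        (\<integral>\<^sup>+y. ennreal (gaussian_ratio (slope * x i) rvar p2 y)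
          * ennreal (gaussian_ratio (s * (y - slope * x i)) 1 t (z i - s * ((1 + slope) * x i))) \<partial>gaussian p2)"
      using rvar_pos p2 t
      by (intro nn_integral_cong) (simp add: f_def ennreal_mult' gaussian_ratio_pos less_imp_le)
    also have "\<dots> = (\<integral>\<^sup>+y. ennreal (gaussian_ratio (s * y) 1 t (z i - s * ((1 + slope) * x i))) \<partial>gaussian rvar)"
      using rvar_pos p2 by (subst nn_integral_gaussian_ratio) auto
    also have "\<dots> = (\<integral>\<^sup>+y. ennreal (normal_density (0 + s * y) (sqrt 1) (z i - s * ((1 + slope) * x i)))
        / ennreal (normal_density 0 (sqrt t) (z i - s * ((1 + slope) * x i))) \<partial>gaussian rvar)"
      using t by (intro nn_integral_cong) (simp add: gaussian_ratio_def divide_ennreal normal_density_pos normal_density_nonneg)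
    also have "\<dots> = ennreal (normal_density 0 (sqrt (1 + s\<^sup>2 * rvar)) (z i - s * ((1 + slope) * x i)))
        / ennreal (normal_density 0 (sqrt t) (z i - s * ((1 + slope) * x i)))"
      using rvar_pos by (subst nn_integral_divide, simp add: normal_density_def, subst nn_integral_normal_density_gaussian) auto
    also have "\<dots> = 1"
      using t by (simp add: t_def[symmetric] divide_ennreal normal_density_pos normal_density_nonneg normal_density_neq_0)
    finally show ?thesis .
  qed
  have "(\<integral>\<^sup>+y. indicator {y. typical n e x y \<and> info_ge n s rvar g (\<lambda>i. y i - slope * x i) (\<lambda>i. x i + y i) z} y
      \<partial>gaussian_vector n p2)
    \<le> (\<integral>\<^sup>+y. ennreal (exp (- (real n * (mi - h))) * exp (- (real n * g))) * (\<Prod>i=1..n. ennreal (f i (y i))) \<partial>gaussian_vector n p2)"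
  proof (intro nn_integral_mono)
    fix y
    show "indicator {y. typical n e x y \<and> info_ge n s rvar g (\<lambda>i. y i - slope * x i) (\<lambda>i. x i + y i) z} y
      \<le> ennreal (exp (- (real n * (mi - h))) * exp (- (real n * g))) * (\<Prod>i=1..n. ennreal (f i (y i)))"
    proof (cases "typical n e x y \<and> info_ge n s rvar g (\<lambda>i. y i - slope * x i) (\<lambda>i. x i + y i) z")
      case True
      have a: "exp (real n * (mi - h)) \<le> joint_ratio n x y"
        using True e by (intro joint_ratio_typical(2)) auto
      have b: "exp (real n * g) \<le> (\<Prod>i=1..n. gaussian_ratio (s * (y i - slope * x i)) 1 t (z i - s * ((1 + slope) * x i)))"
        using True by (simp add: info_ge_def t_def algebra_simps)
      have "1 = (exp (- (real n * (mi - h))) * exp (- (real n * g))) * (exp (real n * (mi - h)) * exp (real n * g))"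
        by (simp add: exp_add[symmetric])
      also have "\<dots> \<le> (exp (- (real n * (mi - h))) * exp (- (real n * g))) * (\<Prod>i=1..n. f i (y i))"
      proof (rule mult_left_mono)
        show "exp (real n * (mi - h)) * exp (real n * g) \<le> (\<Prod>i=1..n. f i (y i))"
          unfolding f_def prod.distrib using a b
          by (intro mult_mono) (auto simp: joint_ratio_def intro: order_trans[OF less_imp_le[OF exp_gt_zero]])
      qed simp
      finally have "ennreal 1 \<le> ennreal ((exp (- (real n * (mi - h))) * exp (- (real n * g))) * (\<Prod>i=1..n. f i (y i)))"
        by (rule ennreal_leI)
      then show ?thesis
        using True f_nn by (simp add: ennreal_mult'' prod_nonneg prod_ennreal)
    qed simp
  qed
  also have "\<dots> = ennreal (exp (- (real n * (mi - h))) * exp (- (real n * g))) * (\<Prod>i=1..n. \<integral>\<^sup>+y. ennreal (f i y) \<partial>gaussian p2)"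
    using p2 f_m by (subst nn_integral_cmult, measurable, subst nn_integral_gaussian_vector_prod) auto
  also have "\<dots> = ennreal (exp (- (real n * (mi - h))) * exp (- (real n * g)))"
    by (simp add: f1)
  finally show ?thesis .
qed

text \<open>As in the conditional bound, but integrating over \<open>y\<close> leaves a factor
  depending on \<open>x\<close>, the output density given \<open>x\<close> divided by the output
  density. It becomes 1 only after averaging over \<open>x\<close>.\<close>

lemma nn_integral_typical_info_joint:
  assumes e: "e * modulus \<le> h" "0 < e"
  shows "(\<integral>\<^sup>+x. \<integral>\<^sup>+y. indicator {y. typical n e x y \<and> info_ge n s sump g (\<lambda>i. x i + y i) (\<lambda>i. x i + y i) z} y
      \<partial>gaussian_vector n p2 \<partial>gaussian_vector n p1) \<le> ennreal (exp (- (real n * (mi - h))) * exp (- (real n * g)))"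
proof -
  define t where "t = 1 + s\<^sup>2 * sump"
  define t' where "t' = 1 + s\<^sup>2 * rvar"
  have t: "0 < t" "0 < t'" using rvar_pos sump_pos by (simp_all add: t_def t'_def add_pos_nonneg)
  define f where "f i x y = gaussian_ratio (slope * x) rvar p2 y * gaussian_ratio (s * (x + y)) 1 t (z i)" for i x y
  have f_nn: "0 \<le> f i x y" for i x y
    using rvar_pos p2 t by (simp add: f_def gaussian_ratio_pos less_imp_le)
  have f_m [measurable]: "(\<lambda>y. f i x y) \<in> borel_measurable borel" for i x
    unfolding f_def by measurable
  have f1: "(\<integral>\<^sup>+y. ennreal (f i x y) \<partial>gaussian p2)
      = ennreal (normal_density (s * (1 + slope) * x) (sqrt t') (z i)) / ennreal (normal_density 0 (sqrt t) (z i))" for i x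
  proof -
    have "(\<integral>\<^sup>+y. ennreal (f i x y) \<partial>gaussian p2) =
        (\<integral>\<^sup>+y. ennreal (gaussian_ratio (slope * x) rvar p2 y)
          * ennreal (gaussian_ratio (s * (x + y)) 1 t (z i)) \<partial>gaussian p2)"
      using rvar_pos p2 t
      by (intro nn_integral_cong) (simp add: f_def ennreal_mult' gaussian_ratio_pos less_imp_le)
    also have "\<dots> = (\<integral>\<^sup>+y. ennreal (gaussian_ratio (s * (x + (slope * x + y))) 1 t (z i)) \<partial>gaussian rvar)"
      using rvar_pos p2 by (subst nn_integral_gaussian_ratio) auto
    also have "\<dots> = (\<integral>\<^sup>+y. ennreal (normal_density (s * (1 + slope) * x + s * y) (sqrt 1) (z i))
        / ennreal (normal_density 0 (sqrt t) (z i)) \<partial>gaussian rvar)"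
      using t by (intro nn_integral_cong)
        (simp add: gaussian_ratio_def divide_ennreal normal_density_pos normal_density_nonneg algebra_simps)
    also have "\<dots> = ennreal (normal_density (s * (1 + slope) * x) (sqrt t') (z i)) / ennreal (normal_density 0 (sqrt t) (z i))"
      using rvar_pos by (subst nn_integral_divide, simp add: normal_density_def, subst nn_integral_normal_density_gaussian)
        (auto simp: t'_def)
    finally show ?thesis .
  qed
  have f2: "(\<integral>\<^sup>+x. ennreal (normal_density (s * (1 + slope) * x) (sqrt t') (z i)) / ennreal (normal_density 0 (sqrt t) (z i))
      \<partial>gaussian p1) = 1" for i
  proof -
    \<comment> \<open>Law of total variance for the output: the variance given \<open>x\<close> plus
      the variance explained by \<open>x\<close>.\<close>
    have "t' + (s * (1 + slope))\<^sup>2 * p1 = t"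
      by (simp add: t_def t'_def sump_eq power2_eq_square algebra_simps)
    then have "(\<integral>\<^sup>+x. ennreal (normal_density (s * (1 + slope) * x) (sqrt t') (z i)) \<partial>gaussian p1)
        = ennreal (normal_density 0 (sqrt t) (z i))"
      using nn_integral_normal_density_gaussian[OF p1 t(2), of 0 "s * (1 + slope)" "z i"] by simp
    then show ?thesis
      using t by (subst nn_integral_divide) (auto simp: normal_density_def divide_ennreal)
  qed
  have "(\<integral>\<^sup>+y. indicator {y. typical n e x y \<and> info_ge n s sump g (\<lambda>i. x i + y i) (\<lambda>i. x i + y i) z} y
      \<partial>gaussian_vector n p2)
    \<le> ennreal (exp (- (real n * (mi - h))) * exp (- (real n * g))) *
      (\<Prod>i=1..n. ennreal (normal_density (s * (1 + slope) * x i) (sqrt t') (z i)) / ennreal (normal_density 0 (sqrt t) (z i)))"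
    (is "_ \<le> ?c * _") for x
  proof -
    have "(\<integral>\<^sup>+y. indicator {y. typical n e x y \<and> info_ge n s sump g (\<lambda>i. x i + y i) (\<lambda>i. x i + y i) z} y
      \<partial>gaussian_vector n p2) \<le> (\<integral>\<^sup>+y. ?c * (\<Prod>i=1..n. ennreal (f i (x i) (y i))) \<partial>gaussian_vector n p2)"
    proof (intro nn_integral_mono)
      fix y
      show "indicator {y. typical n e x y \<and> info_ge n s sump g (\<lambda>i. x i + y i) (\<lambda>i. x i + y i) z} y
        \<le> ?c * (\<Prod>i=1..n. ennreal (f i (x i) (y i)))"
      proof (cases "typical n e x y \<and> info_ge n s sump g (\<lambda>i. x i + y i) (\<lambda>i. x i + y i) z")
        case True
        have a: "exp (real n * (mi - h)) \<le> joint_ratio n x y"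
          using True e by (intro joint_ratio_typical(2)) auto
        have b: "exp (real n * g) \<le> (\<Prod>i=1..n. gaussian_ratio (s * (x i + y i)) 1 t (z i))"
          using True by (simp add: info_ge_def t_def)
        have "1 = (exp (- (real n * (mi - h))) * exp (- (real n * g))) * (exp (real n * (mi - h)) * exp (real n * g))"
          by (simp add: exp_add[symmetric])
        also have "\<dots> \<le> (exp (- (real n * (mi - h))) * exp (- (real n * g))) * (\<Prod>i=1..n. f i (x i) (y i))"
        proof (rule mult_left_mono)
          show "exp (real n * (mi - h)) * exp (real n * g) \<le> (\<Prod>i=1..n. f i (x i) (y i))"
            unfolding f_def prod.distrib using a b
            by (intro mult_mono) (auto simp: joint_ratio_def intro: order_trans[OF less_imp_le[OF exp_gt_zero]])
        qed simp
        finally have "ennreal 1 \<le> ennreal ((exp (- (real n * (mi - h))) * exp (- (real n * g))) * (\<Prod>i=1..n. f i (x i) (y i)))"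
          by (rule ennreal_leI)
        then show ?thesis
          using True f_nn by (simp add: ennreal_mult'' prod_nonneg prod_ennreal)
      qed simp
    qed
    also have "\<dots> = ?c * (\<Prod>i=1..n. \<integral>\<^sup>+y. ennreal (f i (x i) y) \<partial>gaussian p2)"
      using p2 by (subst nn_integral_cmult, measurable, subst nn_integral_gaussian_vector_prod) auto
    finally show ?thesis unfolding f1 .
  qed
  then have "(\<integral>\<^sup>+x. \<integral>\<^sup>+y. indicator {y. typical n e x y \<and> info_ge n s sump g (\<lambda>i. x i + y i) (\<lambda>i. x i + y i) z} y
      \<partial>gaussian_vector n p2 \<partial>gaussian_vector n p1)
    \<le> (\<integral>\<^sup>+x. ?c * (\<Prod>i=1..n. ennreal (normal_density (s * (1 + slope) * x i) (sqrt t') (z i)) / ennreal (normal_density 0 (sqrt t) (z i)))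
      \<partial>gaussian_vector n p1)"
    by (intro nn_integral_mono)
  also have "\<dots> = ?c * (\<Prod>i=1..n. \<integral>\<^sup>+x. ennreal (normal_density (s * (1 + slope) * x) (sqrt t') (z i)) / ennreal (normal_density 0 (sqrt t) (z i)) \<partial>gaussian p1)"
    using p1 by (subst nn_integral_cmult, simp add: normal_density_def, measurable,
      subst nn_integral_gaussian_vector_prod[where f="\<lambda>i x. ennreal (normal_density (s * (1 + slope) * x) (sqrt t') (z i)) / ennreal (normal_density 0 (sqrt t) (z i))"])
      (auto simp: normal_density_def)
  also have "\<dots> = ?c" by (simp add: f2)
  finally show ?thesis .
qed

lemma nn_integral_typical:
  assumes e: "e * modulus \<le> h" "0 < e"
  shows "(\<integral>\<^sup>+y. indicator {y. typical n e x y} y \<partial>gaussian_vector n p2) \<le> ennreal (exp (- (real n * (mi - h))))"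
proof -
  \<comment> \<open>At gain 0 the two densities coincide, so the threshold is always met and only
    typicality remains.\<close>
  have "info_ge n 0 rvar 0 U X z" for U X z
    by (simp add: info_ge_def gaussian_ratio_eq_exp)
  then show ?thesis
    using nn_integral_typical_info_conditional[OF e, of n x 0 0 x] by simp
qed

text \<open>Covering needs the reverse of the packing bound. Under the conditional law,
  \<open>y = slope * x + v\<close>, the pair is typical with probability at least 1/2 by Chebyshev;
  returning to the independent law costs at most \<open>exp (n * (mi + h))\<close>. The tolerance
  \<open>d\<close> for \<open>x\<close> and \<open>v\<close> leaves room for the regression, which
  magnifies errors by up to \<open>(1 + |slope|)^2\<close>.\<close>

lemma typical_covering:
  assumes e: "e * modulus \<le> h" "0 < e"
  defines "d \<equiv> e / (1 + \<bar>slope\<bar>)\<^sup>2"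
  assumes n: "real n \<ge> 2 * (2 * rvar\<^sup>2 + rvar * (p1 + d)) / d\<^sup>2" "0 < n"
    and x: "\<bar>ip n x x - real n * p1\<bar> \<le> real n * d"
  shows "1/2 * exp (- (real n * (mi + h))) \<le> measure (gaussian_vector n p2) {y\<in>space (gaussian_vector n p2). typical n e x y}"
proof -
  have d: "0 < d" "d \<le> e" "d * (1 + \<bar>slope\<bar>)\<^sup>2 = e" "d * (1 + \<bar>slope\<bar>) \<le> e"
  proof -
    have 1: "1 \<le> 1 + \<bar>slope\<bar>" by simp
    show "0 < d" using e 1 by (simp add: d_def)
    show 2: "d * (1 + \<bar>slope\<bar>)\<^sup>2 = e" using 1 by (simp add: d_def)
    have "(1 + \<bar>slope\<bar>) * 1 \<le> (1 + \<bar>slope\<bar>) * (1 + \<bar>slope\<bar>)" using 1 by (intro mult_left_mono) auto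
    then show 3: "d * (1 + \<bar>slope\<bar>) \<le> e" unfolding 2[symmetric] using \<open>0 < d\<close>
      by (intro mult_left_mono) (auto simp: power2_eq_square)
    have "d * 1 \<le> d * (1 + \<bar>slope\<bar>)" using \<open>0 < d\<close> by (intro mult_left_mono) auto
    then show "d \<le> e" using 3 by simp
  qed
  let ?G = "gaussian_vector n rvar" and ?H = "gaussian_vector n p2"
  interpret G: prob_space ?G by (rule prob_space_gaussian_vector[OF rvar_pos])
  interpret H: prob_space ?H by (rule prob_space_gaussian_vector[OF p2])
  let ?sh = "\<lambda>v. \<lambda>i\<in>{1..n}. slope * x i + v i"
  define A where "A = {y\<in>space (real_vectors n). typical n e x y}"
  have xs[measurable]: "Measurable.pred (real_vectors n) (\<lambda>y. typical n e x y)"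
    unfolding typical_def ip_def by measurable
  have A[measurable]: "A \<in> sets (real_vectors n)" unfolding A_def by measurable
  define B1 where "B1 = {v\<in>space ?G. real n * d \<le> \<bar>(\<Sum>i=1..n. (v i)\<^sup>2) - real n * rvar\<bar>}"
  define B2 where "B2 = {v\<in>space ?G. real n * d \<le> \<bar>\<Sum>i=1..n. x i * v i\<bar>}"
  have B12: "B1 \<in> sets ?G" "B2 \<in> sets ?G" unfolding B1_def B2_def by measurable
  note [measurable] = B12[unfolded sets_gaussian_vector]
  have b1: "G.prob B1 \<le> 2 * rvar\<^sup>2 / (real n * d\<^sup>2)"
    unfolding B1_def by (rule gaussian_vector_norm_deviation) (use d n rvar_pos in auto)
  have b2: "G.prob B2 \<le> rvar * (\<Sum>i=1..n. (x i)\<^sup>2) / (real n * d)\<^sup>2"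
    unfolding B2_def by (rule gaussian_vector_inner_deviation) (use d n rvar_pos in auto)
  have xx: "(\<Sum>i=1..n. (x i)\<^sup>2) \<le> real n * (p1 + d)"
  proof -
    have "ip n x x \<le> real n * p1 + real n * d" using x by linarith
    then show ?thesis by (simp add: ip_def power2_eq_square algebra_simps)
  qed
  have "G.prob (B1 \<union> B2) \<le> G.prob B1 + G.prob B2"
    by (intro measure_Un_le B12)
  also have "\<dots> \<le> 2 * rvar\<^sup>2 / (real n * d\<^sup>2) + rvar * (real n * (p1 + d)) / (real n * d)\<^sup>2"
    using rvar_pos by (intro add_mono b1 order_trans[OF b2] divide_right_mono mult_left_mono xx) auto
  also have "\<dots> = (2 * rvar\<^sup>2 + rvar * (p1 + d)) / d\<^sup>2 / real n"
    using d n by (simp add: field_simps power2_eq_square)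
  also have "\<dots> \<le> 1/2"
  proof -
    define q where "q = (2 * rvar\<^sup>2 + rvar * (p1 + d)) / d\<^sup>2"
    have "2 * q \<le> real n" using n(1) unfolding q_def times_divide_eq_right .
    then have "q / real n \<le> 1/2" using n(2) by (simp add: pos_divide_le_eq)
    then show ?thesis by (simp add: q_def)
  qed
  finally have B: "G.prob (B1 \<union> B2) \<le> 1/2" .
  have sub: "space ?G - (B1 \<union> B2) \<subseteq> ?sh -` A \<inter> space ?G"
  proof
    fix v assume v: "v \<in> space ?G - (B1 \<union> B2)"
    have v1: "\<bar>ip n v v - real n * rvar\<bar> \<le> real n * d" and v2: "\<bar>ip n x v\<bar> \<le> real n * d"
      using v by (auto simp: B1_def B2_def ip_def power2_eq_square)
    define y where "y = (\<lambda>i. slope * x i + v i)"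
    have "ip n y y - real n * p2 = slope\<^sup>2 * (ip n x x - real n * p1) + 2 * slope * ip n x v + (ip n v v - real n * rvar)"
      unfolding y_def ip_linear rvar_eq(2) by (simp add: ip_commute[of n v x] power2_eq_square algebra_simps)
    also have "\<bar>\<dots>\<bar> \<le> \<bar>slope\<^sup>2 * (ip n x x - real n * p1)\<bar> + \<bar>2 * slope * ip n x v\<bar> + \<bar>ip n v v - real n * rvar\<bar>"
      by linarith
    finally have y1: "\<bar>ip n y y - real n * p2\<bar> \<le> \<bar>slope\<^sup>2 * (ip n x x - real n * p1)\<bar> + \<bar>2 * slope * ip n x v\<bar> + \<bar>ip n v v - real n * rvar\<bar>" .
    also have "\<dots> \<le> slope\<^sup>2 * (real n * d) + 2 * \<bar>slope\<bar> * (real n * d) + real n * d"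
      unfolding abs_mult using x v1 v2 by (intro add_mono mult_mono) auto
    also have "\<dots> = real n * (d * (1 + \<bar>slope\<bar>)\<^sup>2)"
      by (simp add: power2_eq_square algebra_simps)
    finally have y2: "\<bar>ip n y y - real n * p2\<bar> \<le> real n * e" unfolding d .
    have eq: "ip n x y - real n * kap = slope * (ip n x x - real n * p1) + ip n x v"
      unfolding y_def ip_linear using rvar_eq(3) by (simp add: algebra_simps)
    have "\<bar>ip n x y - real n * kap\<bar> \<le> \<bar>slope * (ip n x x - real n * p1)\<bar> + \<bar>ip n x v\<bar>"
      unfolding eq by linarith
    also have "\<dots> \<le> \<bar>slope\<bar> * (real n * d) + real n * d"
      unfolding abs_mult using x v2 by (intro add_mono mult_mono) auto
    also have "\<dots> = real n * (d * (1 + \<bar>slope\<bar>))" by (simp add: algebra_simps)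
    also have "\<dots> \<le> real n * e" using d by (intro mult_left_mono) auto
    finally have y3: "\<bar>ip n x y - real n * kap\<bar> \<le> real n * e" .
    have x1: "\<bar>ip n x x - real n * p1\<bar> \<le> real n * e"
      using x d mult_left_mono[of d e "real n"] by linarith
    have "ip n (?sh v) (?sh v) = ip n y y" "ip n x (?sh v) = ip n x y"
      by (auto intro!: ip_cong simp: y_def)
    then have "typical n e x (?sh v)"
      using x1 y2 y3 by (simp add: typical_def)
    then show "v \<in> ?sh -` A \<inter> space ?G"
      using v by (auto simp: A_def space_PiM)
  qed
  have "1/2 \<le> 1 - G.prob (B1 \<union> B2)" using B by simp
  also have "\<dots> = G.prob (space ?G - (B1 \<union> B2))"
    by (subst G.prob_compl) auto
  also have "\<dots> \<le> G.prob (?sh -` A \<inter> space ?G)"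
    by (intro G.finite_measure_mono sub) measurable
  finally have "ennreal (1/2) \<le> emeasure ?G (?sh -` A \<inter> space ?G)"
    unfolding G.emeasure_eq_measure by (rule ennreal_leI)
  also have "\<dots> = emeasure (distr ?G (real_vectors n) ?sh) A"
    by (subst emeasure_distr) auto
  also have "\<dots> = (\<integral>\<^sup>+y. (\<Prod>i=1..n. ennreal (gaussian_ratio (slope * x i) rvar p2 (y i))) * indicator A y \<partial>?H)"
    using rvar_pos p2 by (subst distr_gaussian_vector_shift[of _ p2]) (auto simp: emeasure_density)
  also have "\<dots> \<le> (\<integral>\<^sup>+y. ennreal (exp (real n * (mi + h))) * indicator A y \<partial>?H)"
  proof (intro nn_integral_mono)
    fix y
    show "(\<Prod>i=1..n. ennreal (gaussian_ratio (slope * x i) rvar p2 (y i))) * indicator A y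
      \<le> ennreal (exp (real n * (mi + h))) * indicator A y"
    proof (cases "y \<in> A")
      case True
      then have "joint_ratio n x y \<le> exp (real n * (mi + h))"
        by (intro joint_ratio_typical(1)[OF _ e]) (auto simp: A_def)
      then show ?thesis using True rvar_pos p2
        by (simp add: joint_ratio_def prod_ennreal gaussian_ratio_pos less_imp_le)
    qed simp
  qed
  also have "\<dots> = ennreal (exp (real n * (mi + h))) * ennreal (H.prob A)"
    by (subst nn_integral_cmult) (auto simp: H.emeasure_eq_measure)
  finally have "ennreal (1/2) \<le> ennreal (exp (real n * (mi + h)) * H.prob A)"
    by (simp only: ennreal_mult''[OF measure_nonneg])
  then have "1/2 \<le> exp (real n * (mi + h)) * H.prob A"
    by (subst (asm) ennreal_le_iff) auto
  then have "1/2 * exp (- (real n * (mi + h))) \<le> H.prob A"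
    by (simp only: exp_minus) (simp add: inverse_eq_divide divide_le_eq mult.commute)
  then show ?thesis by (simp add: A_def space_gaussian_vector)
qed

end

text \<open>Exchanges the inputs, so that every statement about the second codeword given the first
  is available with the roles reversed.\<close>

sublocale gaussian_pair \<subseteq> swap: gaussian_pair p2 p1 kap
  using p1 p2 det by unfold_locales (auto simp: mult.commute)

context gaussian_pair
begin

lemma swap_typical: "swap.typical n e y x = typical n e x y"
  by (auto simp: typical_def swap.typical_def ip_commute)

lemma swap_mi: "swap.mi = mi"
  by (simp add: mi_def swap.mi_def mult.commute)

end

section \<open>Random coding with block selection\<close>

lemma nn_integral_PiM_component:
  assumes "prob_space M" "i \<in> I" and [measurable]: "f \<in> borel_measurable M"
  shows "(\<integral>\<^sup>+X. f (X i) \<partial>PiM I (\<lambda>_. M)) = (\<integral>\<^sup>+x. f x \<partial>M)"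
proof -
  have "(\<integral>\<^sup>+x. f x \<partial>M) = (\<integral>\<^sup>+x. f x \<partial>distr (PiM I (\<lambda>_. M)) M (\<lambda>\<omega>. \<omega> i))"
    using assms by (subst distr_PiM_component[of I "\<lambda>_. M" i]) auto
  also have "\<dots> = (\<integral>\<^sup>+X. f (X i) \<partial>PiM I (\<lambda>_. M))"
    using assms by (subst nn_integral_distr) auto
  finally show ?thesis by simp
qed

lemma nn_integral_PiM_two_components:
  assumes M: "prob_space M" and I: "finite I" "i \<in> I" "j \<in> I" "i \<noteq> j"
    and f: "(\<lambda>(x, y). f x y) \<in> borel_measurable (M \<Otimes>\<^sub>M M)"
  shows "(\<integral>\<^sup>+X. f (X i) (X j) \<partial>PiM I (\<lambda>_. M)) = (\<integral>\<^sup>+x. \<integral>\<^sup>+y. f x y \<partial>M \<partial>M)"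
proof -
  interpret M: prob_space M by fact
  interpret product_sigma_finite "\<lambda>_. M" by unfold_locales
  define J where "J = I - {i}"
  have J: "I = insert i J" "i \<notin> J" "finite J" "j \<in> J" using I by (auto simp: J_def)
  have [measurable]: "(\<lambda>X. f (X i) (X j)) \<in> borel_measurable (PiM (insert i J) (\<lambda>_. M))"
    using measurable_compose[OF _ f, of "\<lambda>X. (X i, X j)" "PiM (insert i J) (\<lambda>_. M)"] J(4) by simp
  have "(\<integral>\<^sup>+X. f (X i) (X j) \<partial>PiM (insert i J) (\<lambda>_. M))
      = (\<integral>\<^sup>+y. \<integral>\<^sup>+X. f ((X(i := y)) i) ((X(i := y)) j) \<partial>PiM J (\<lambda>_. M) \<partial>M)"
    using J by (subst product_nn_integral_insert_rev) auto
  also have "\<dots> = (\<integral>\<^sup>+y. \<integral>\<^sup>+x. f y x \<partial>M \<partial>M)"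
  proof (intro nn_integral_cong)
    fix y assume y: "y \<in> space M"
    have [measurable]: "f y \<in> borel_measurable M"
      using measurable_compose[OF _ f, of "\<lambda>x. (y, x)" M] y by simp
    show "(\<integral>\<^sup>+X. f ((X(i := y)) i) ((X(i := y)) j) \<partial>PiM J (\<lambda>_. M)) = (\<integral>\<^sup>+x. f y x \<partial>M)"
      using I J nn_integral_PiM_component[OF M, of j J "f y"] by simp
  qed
  finally show ?thesis using J by simp
qed

lemma (in prob_space) nn_integral_le_const:
  "(\<And>x. x \<in> space M \<Longrightarrow> f x \<le> c) \<Longrightarrow> (\<integral>\<^sup>+x. f x \<partial>M) \<le> c"
  using nn_integral_mono[of M f "\<lambda>_. c"] by (simp add: emeasure_space_1)

text \<open>Turns a bound on the mean over random codebooks into one good codebook.\<close>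

lemma (in prob_space) nn_integral_less_imp_ex:
  assumes "(\<integral>\<^sup>+x. f x \<partial>M) < c"
  shows "\<exists>x\<in>space M. f x < c"
proof (rule ccontr)
  assume "\<not> ?thesis"
  then have "\<And>x. x \<in> space M \<Longrightarrow> c \<le> f x" by (auto simp: not_less)
  then have "(\<integral>\<^sup>+x. c \<partial>M) \<le> (\<integral>\<^sup>+x. f x \<partial>M)" by (intro nn_integral_mono)
  then show False using assms by (simp add: emeasure_space_1)
qed

text \<open>Codeword laws and acceptance test are kept abstract: the counting relies only on the
  fact that an independent second codeword is accepted with probability at most
  \<open>q\<close>.\<close>

locale random_coding = Q1: prob_space Q1 + Q2: prob_space Q2
  for Q1 :: "'a measure" and Q2 :: "'b measure" +
  fixes acc :: "'a \<Rightarrow> 'b \<Rightarrow> bool" and q :: ennreal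
    and I1 I2 :: "nat set"
  assumes acc_pred: "Measurable.pred (Q1 \<Otimes>\<^sub>M Q2) (\<lambda>z. acc (fst z) (snd z))"
    and acc_le: "\<And>x. x \<in> space Q1 \<Longrightarrow> (\<integral>\<^sup>+y. indicator {y. acc x y} y \<partial>Q2) \<le> q"
    and fin: "finite I1" "finite I2"
begin

abbreviation "P1 \<equiv> PiM I1 (\<lambda>_. Q1)"
abbreviation "P2 \<equiv> PiM I2 (\<lambda>_. Q2)"

sublocale P1: prob_space P1 by (intro prob_space_PiM Q1.prob_space_axioms)
sublocale P2: prob_space P2 by (intro prob_space_PiM Q2.prob_space_axioms)

lemma acc_measurable [measurable (raw)]:
  assumes "f \<in> M \<rightarrow>\<^sub>M Q1" "g \<in> M \<rightarrow>\<^sub>M Q2"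
  shows "Measurable.pred M (\<lambda>x. acc (f x) (g x))"
  using measurable_compose[OF measurable_Pair[OF assms] acc_pred] by simp

definition A :: "'a \<Rightarrow> 'b \<Rightarrow> ennreal" where "A x y = (if acc x y then 1 else 0)"

lemma A_measurable [measurable (raw)]:
  assumes [measurable]: "f \<in> M \<rightarrow>\<^sub>M Q1" "g \<in> M \<rightarrow>\<^sub>M Q2"
  shows "(\<lambda>x. A (f x) (g x)) \<in> borel_measurable M"
  unfolding A_def by measurable

lemma A_le: "x \<in> space Q1 \<Longrightarrow> (\<integral>\<^sup>+y. A x y \<partial>Q2) \<le> q"
  using acc_le[of x] by (simp add: A_def indicator_def of_bool_def)

lemma A_le_joint: "(\<integral>\<^sup>+x. \<integral>\<^sup>+y. A x y \<partial>Q2 \<partial>Q1) \<le> q"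
  by (intro Q1.nn_integral_le_const A_le)

lemma A_le_joint_mult: "(\<integral>\<^sup>+x. \<integral>\<^sup>+y. A x y * c \<partial>Q2 \<partial>Q1) \<le> q * c"
proof -
  have "(\<integral>\<^sup>+x. \<integral>\<^sup>+y. A x y * c \<partial>Q2 \<partial>Q1) = (\<integral>\<^sup>+x. (\<integral>\<^sup>+y. A x y \<partial>Q2) * c \<partial>Q1)"
    by (intro nn_integral_cong nn_integral_multc) measurable
  also have "\<dots> = (\<integral>\<^sup>+x. \<integral>\<^sup>+y. A x y \<partial>Q2 \<partial>Q1) * c"
    by (intro nn_integral_multc) measurable
  also have "\<dots> \<le> q * c"
    by (intro mult_right_mono A_le_joint) simp
  finally show ?thesis .
qed

end

text \<open>\<open>W x y x' y'\<close> stands for the probability that \<open>(x', y')\<close>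
  passes the decoder when \<open>(x, y)\<close> is sent. A wrong pair costs \<open>e12\<close> if
  both codewords are fresh, \<open>e1\<close> if it shares the first codeword and \<open>e2\<close>
  if it shares the second, each time beside the factor \<open>q\<close> for its own
  acceptance.\<close>

locale random_coding_channel = random_coding +
  fixes W :: "'a \<Rightarrow> 'b \<Rightarrow> 'a \<Rightarrow> 'b \<Rightarrow> ennreal" and e1 e2 e12 :: ennreal
  assumes W_meas: "(\<lambda>z. W (fst z) (fst (snd z)) (fst (snd (snd z))) (snd (snd (snd z))))
      \<in> borel_measurable (Q1 \<Otimes>\<^sub>M Q2 \<Otimes>\<^sub>M Q1 \<Otimes>\<^sub>M Q2)"
    and W12: "\<And>x y. x \<in> space Q1 \<Longrightarrow> y \<in> space Q2 \<Longrightarrow>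
      (\<integral>\<^sup>+x'. \<integral>\<^sup>+y'. A x' y' * W x y x' y' \<partial>Q2 \<partial>Q1) \<le> q * e12"
    and W1: "\<And>x y. x \<in> space Q1 \<Longrightarrow> y \<in> space Q2 \<Longrightarrow>
      (\<integral>\<^sup>+y'. A x y' * W x y x y' \<partial>Q2) \<le> q * e1"
    and W2: "\<And>x y. x \<in> space Q1 \<Longrightarrow> y \<in> space Q2 \<Longrightarrow>
      (\<integral>\<^sup>+x'. A x' y * W x y x' y \<partial>Q1) \<le> q * e2"
begin

lemma W_measurable [measurable (raw)]:
  assumes "f \<in> M \<rightarrow>\<^sub>M Q1" "g \<in> M \<rightarrow>\<^sub>M Q2" "f' \<in> M \<rightarrow>\<^sub>M Q1" "g' \<in> M \<rightarrow>\<^sub>M Q2"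
  shows "(\<lambda>x. W (f x) (g x) (f' x) (g' x)) \<in> borel_measurable M"
  using measurable_compose[OF measurable_Pair[OF assms(1) measurable_Pair[OF assms(2) measurable_Pair[OF assms(3,4)]]] W_meas]
  by simp

definition collision :: "(nat \<Rightarrow> 'a) \<Rightarrow> (nat \<Rightarrow> 'b) \<Rightarrow> nat \<Rightarrow> nat \<Rightarrow> nat \<Rightarrow> nat \<Rightarrow> ennreal" where
  "collision X Y a b a' b' = A (X a) (Y b) * A (X a') (Y b') * W (X a) (Y b) (X a') (Y b')"

lemma collision_measurable [measurable (raw)]:
  assumes [measurable]: "f \<in> M \<rightarrow>\<^sub>M P1" "g \<in> M \<rightarrow>\<^sub>M P2"
    and "a \<in> I1" "b \<in> I2" "a' \<in> I1" "b' \<in> I2"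
  shows "(\<lambda>x. collision (f x) (g x) a b a' b') \<in> borel_measurable M"
  unfolding collision_def using assms(3-) by measurable

text \<open>The true pair is accepted with probability at most \<open>q\<close>, and given it the
  independent wrong pair contributes at most \<open>q * e12\<close>; Fubini moves the integrals of
  the true pair outside.\<close>

lemma collision_distinct:
  assumes ab: "a \<in> I1" "b \<in> I2" "a' \<in> I1" "b' \<in> I2" "a \<noteq> a'" "b \<noteq> b'"
  shows "(\<integral>\<^sup>+X. \<integral>\<^sup>+Y. collision X Y a b a' b' \<partial>P2 \<partial>P1) \<le> q * (q * e12)"
proof -
  interpret P: pair_sigma_finite Q1 Q2 ..
  have "(\<integral>\<^sup>+X. \<integral>\<^sup>+Y. collision X Y a b a' b' \<partial>P2 \<partial>P1)
      = (\<integral>\<^sup>+X. \<integral>\<^sup>+y. \<integral>\<^sup>+y'. A (X a) y * A (X a') y' * W (X a) y (X a') y' \<partial>Q2 \<partial>Q2 \<partial>P1)"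
    unfolding collision_def using ab fin
    by (intro nn_integral_cong, subst nn_integral_PiM_two_components[OF Q2.prob_space_axioms]) (auto simp: space_PiM PiE_iff)
  also have "\<dots> = (\<integral>\<^sup>+x. \<integral>\<^sup>+x'. \<integral>\<^sup>+y. \<integral>\<^sup>+y'. A x y * A x' y' * W x y x' y' \<partial>Q2 \<partial>Q2 \<partial>Q1 \<partial>Q1)"
    using ab fin
    by (subst nn_integral_PiM_two_components[OF Q1.prob_space_axioms,
      where f="\<lambda>x x'. \<integral>\<^sup>+y. \<integral>\<^sup>+y'. A x y * A x' y' * W x y x' y' \<partial>Q2 \<partial>Q2"]) auto
  also have "\<dots> = (\<integral>\<^sup>+x. \<integral>\<^sup>+y. \<integral>\<^sup>+x'. \<integral>\<^sup>+y'. A x y * A x' y' * W x y x' y' \<partial>Q2 \<partial>Q1 \<partial>Q2 \<partial>Q1)"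
    by (intro nn_integral_cong P.Fubini'[symmetric]) auto
  also have "\<dots> = (\<integral>\<^sup>+x. \<integral>\<^sup>+y. A x y * (\<integral>\<^sup>+x'. \<integral>\<^sup>+y'. A x' y' * W x y x' y' \<partial>Q2 \<partial>Q1) \<partial>Q2 \<partial>Q1)"
  proof (intro nn_integral_cong)
    fix x y assume [simp]: "x \<in> space Q1" "y \<in> space Q2"
    have "(\<integral>\<^sup>+x'. \<integral>\<^sup>+y'. A x y * A x' y' * W x y x' y' \<partial>Q2 \<partial>Q1) = (\<integral>\<^sup>+x'. A x y * (\<integral>\<^sup>+y'. A x' y' * W x y x' y' \<partial>Q2) \<partial>Q1)"
      by (intro nn_integral_cong) (subst nn_integral_cmult[symmetric], measurable, simp add: mult.assoc)
    also have "\<dots> = A x y * (\<integral>\<^sup>+x'. \<integral>\<^sup>+y'. A x' y' * W x y x' y' \<partial>Q2 \<partial>Q1)"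
      by (intro nn_integral_cmult) measurable
    finally show "(\<integral>\<^sup>+x'. \<integral>\<^sup>+y'. A x y * A x' y' * W x y x' y' \<partial>Q2 \<partial>Q1) = A x y * (\<integral>\<^sup>+x'. \<integral>\<^sup>+y'. A x' y' * W x y x' y' \<partial>Q2 \<partial>Q1)" .
  qed
  also have "\<dots> \<le> (\<integral>\<^sup>+x. \<integral>\<^sup>+y. A x y * (q * e12) \<partial>Q2 \<partial>Q1)"
    by (intro nn_integral_mono mult_left_mono W12) auto
  also have "\<dots> \<le> q * (q * e12)"
    by (rule A_le_joint_mult)
  finally show ?thesis .
qed

lemma collision_same_fst:
  assumes ab: "a \<in> I1" "b \<in> I2" "b' \<in> I2" "b \<noteq> b'"
  shows "(\<integral>\<^sup>+X. \<integral>\<^sup>+Y. collision X Y a b a b' \<partial>P2 \<partial>P1) \<le> q * (q * e1)"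
proof -
  have "(\<integral>\<^sup>+X. \<integral>\<^sup>+Y. collision X Y a b a b' \<partial>P2 \<partial>P1)
      = (\<integral>\<^sup>+X. \<integral>\<^sup>+y. \<integral>\<^sup>+y'. A (X a) y * A (X a) y' * W (X a) y (X a) y' \<partial>Q2 \<partial>Q2 \<partial>P1)"
    unfolding collision_def using ab fin
    by (intro nn_integral_cong, subst nn_integral_PiM_two_components[OF Q2.prob_space_axioms]) (auto simp: space_PiM PiE_iff)
  also have "\<dots> = (\<integral>\<^sup>+x. \<integral>\<^sup>+y. \<integral>\<^sup>+y'. A x y * A x y' * W x y x y' \<partial>Q2 \<partial>Q2 \<partial>Q1)"
    using ab by (subst nn_integral_PiM_component[OF Q1.prob_space_axioms,
        where f="\<lambda>x. \<integral>\<^sup>+y. \<integral>\<^sup>+y'. A x y * A x y' * W x y x y' \<partial>Q2 \<partial>Q2"]) auto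
  also have "\<dots> = (\<integral>\<^sup>+x. \<integral>\<^sup>+y. A x y * (\<integral>\<^sup>+y'. A x y' * W x y x y' \<partial>Q2) \<partial>Q2 \<partial>Q1)"
    by (intro nn_integral_cong) (subst nn_integral_cmult[symmetric], measurable, simp add: mult.assoc)
  also have "\<dots> \<le> (\<integral>\<^sup>+x. \<integral>\<^sup>+y. A x y * (q * e1) \<partial>Q2 \<partial>Q1)"
    by (intro nn_integral_mono mult_left_mono W1) auto
  also have "\<dots> \<le> q * (q * e1)"
    by (rule A_le_joint_mult)
  finally show ?thesis .
qed

lemma collision_same_snd:
  assumes ab: "a \<in> I1" "a' \<in> I1" "b \<in> I2" "a \<noteq> a'"
  shows "(\<integral>\<^sup>+X. \<integral>\<^sup>+Y. collision X Y a b a' b \<partial>P2 \<partial>P1) \<le> q * (q * e2)"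
proof -
  interpret P: pair_sigma_finite Q1 Q2 ..
  have "(\<integral>\<^sup>+X. \<integral>\<^sup>+Y. collision X Y a b a' b \<partial>P2 \<partial>P1)
      = (\<integral>\<^sup>+X. \<integral>\<^sup>+y. A (X a) y * A (X a') y * W (X a) y (X a') y \<partial>Q2 \<partial>P1)"
    unfolding collision_def using ab fin
    by (intro nn_integral_cong, subst nn_integral_PiM_component[OF Q2.prob_space_axioms]) (auto simp: space_PiM PiE_iff)
  also have "\<dots> = (\<integral>\<^sup>+x. \<integral>\<^sup>+x'. \<integral>\<^sup>+y. A x y * A x' y * W x y x' y \<partial>Q2 \<partial>Q1 \<partial>Q1)"
    using ab fin
    by (subst nn_integral_PiM_two_components[OF Q1.prob_space_axioms,
      where f="\<lambda>x x'. \<integral>\<^sup>+y. A x y * A x' y * W x y x' y \<partial>Q2"]) auto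
  also have "\<dots> = (\<integral>\<^sup>+x. \<integral>\<^sup>+y. \<integral>\<^sup>+x'. A x y * A x' y * W x y x' y \<partial>Q1 \<partial>Q2 \<partial>Q1)"
    by (intro nn_integral_cong P.Fubini'[symmetric]) auto
  also have "\<dots> = (\<integral>\<^sup>+x. \<integral>\<^sup>+y. A x y * (\<integral>\<^sup>+x'. A x' y * W x y x' y \<partial>Q1) \<partial>Q2 \<partial>Q1)"
    by (intro nn_integral_cong) (subst nn_integral_cmult[symmetric], measurable, simp add: mult.assoc)
  also have "\<dots> \<le> (\<integral>\<^sup>+x. \<integral>\<^sup>+y. A x y * (q * e2) \<partial>Q2 \<partial>Q1)"
    by (intro nn_integral_mono mult_left_mono W2) auto
  also have "\<dots> \<le> q * (q * e2)"
    by (rule A_le_joint_mult)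
  finally show ?thesis .
qed

definition block :: "nat \<Rightarrow> nat \<Rightarrow> nat set" where "block S k = {k * S..<k * S + S}"

lemma card_block [simp]: "card (block S k) = S" and finite_block [simp]: "finite (block S k)"
  by (simp_all add: block_def)

lemma block_disjoint: "b \<in> block S k \<Longrightarrow> b \<in> block S l \<Longrightarrow> k = l"
proof -
  assume "b \<in> block S k" "b \<in> block S l"
  then have "b div S = k" "b div S = l"
    by (auto simp: block_def mult.commute intro!: div_nat_eqI)
  then show ?thesis by simp
qed

text \<open>Sums over all candidates of both blocks instead of the selected ones. The selection
  depends on the codebook and would destroy independence, whereas this sum bounds the collision of
  whichever accepted codewords are chosen.\<close>

definition "collisions S aa bb X Y t t' =
  (\<Sum>b\<in>block S (bb t). \<Sum>b'\<in>block S (bb t'). collision X Y (aa t) b (aa t') b')"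

text \<open>A shared block contributes only the \<open>S\<close> diagonal terms
  \<open>b = b'\<close>, against \<open>S * S\<close> terms of the other two kinds; hence the single
  factor \<open>S\<close> beside \<open>e2\<close>.\<close>

lemma collisions_expectation:
  assumes t: "aa t \<in> I1" "aa t' \<in> I1" "block S (bb t) \<subseteq> I2" "block S (bb t') \<subseteq> I2"
    and d: "aa t \<noteq> aa t' \<or> bb t \<noteq> bb t'"
  shows "(\<integral>\<^sup>+X. \<integral>\<^sup>+Y. collisions S aa bb X Y t t' \<partial>P2 \<partial>P1)
    \<le> q * q * (of_nat (S * S) * e12 + (if aa t = aa t' then of_nat (S * S) * e1 else 0)
        + (if bb t = bb t' then of_nat S * e2 else 0))"
proof -
  have m: "(\<lambda>Y. collision X Y (aa t) b (aa t') b') \<in> borel_measurable P2"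
    if "X \<in> space P1" "b \<in> block S (bb t)" "b' \<in> block S (bb t')" for X b b'
    using that t by (intro collision_measurable) auto
  have "(\<integral>\<^sup>+X. \<integral>\<^sup>+Y. collisions S aa bb X Y t t' \<partial>P2 \<partial>P1)
      = (\<integral>\<^sup>+X. (\<Sum>b\<in>block S (bb t). \<Sum>b'\<in>block S (bb t'). \<integral>\<^sup>+Y. collision X Y (aa t) b (aa t') b' \<partial>P2) \<partial>P1)"
    unfolding collisions_def
    by (intro nn_integral_cong, subst nn_integral_sum, (intro borel_measurable_sum m; simp), 
       intro sum.cong refl, subst nn_integral_sum) (auto intro!: m)
  also have "\<dots> = (\<Sum>b\<in>block S (bb t). \<Sum>b'\<in>block S (bb t'). \<integral>\<^sup>+X. \<integral>\<^sup>+Y. collision X Y (aa t) b (aa t') b' \<partial>P2 \<partial>P1)"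
  proof -
    have m2: "(\<lambda>X. \<integral>\<^sup>+Y. collision X Y (aa t) b (aa t') b' \<partial>P2) \<in> borel_measurable P1"
      if "b \<in> block S (bb t)" "b' \<in> block S (bb t')" for b b'
      using that t by (intro P2.borel_measurable_nn_integral)
        (auto simp: split_beta' intro!: collision_measurable)
    then show ?thesis
      by (subst nn_integral_sum, (intro borel_measurable_sum m2; simp), intro sum.cong refl, subst nn_integral_sum) auto
  qed
  also have "\<dots> \<le> (\<Sum>b\<in>block S (bb t). \<Sum>b'\<in>block S (bb t').
      q * q * (e12 + (if aa t = aa t' then e1 else 0) + (if b = b' then e2 else 0)))"
  proof (intro sum_mono)
    fix b b' assume b: "b \<in> block S (bb t)" "b' \<in> block S (bb t')"
    consider "aa t \<noteq> aa t'" "b \<noteq> b'" | "aa t = aa t'" | "aa t \<noteq> aa t'" "b = b'" by blast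
    then show "(\<integral>\<^sup>+X. \<integral>\<^sup>+Y. collision X Y (aa t) b (aa t') b' \<partial>P2 \<partial>P1)
      \<le> q * q * (e12 + (if aa t = aa t' then e1 else 0) + (if b = b' then e2 else 0))"
    proof cases
      case 1
      then show ?thesis using collision_distinct[of "aa t" b "aa t'" b'] b t by (auto simp: mult.assoc)
    next
      case 2
      \<comment> \<open>Pairs with the same first codeword use different, hence disjoint, blocks, so
        the two kinds of coincidence never meet.\<close>
      then have "b \<noteq> b'" using d b block_disjoint by metis
      then have "(\<integral>\<^sup>+X. \<integral>\<^sup>+Y. collision X Y (aa t) b (aa t') b' \<partial>P2 \<partial>P1) \<le> q * q * e1"
        using 2 collision_same_fst[of "aa t" b b'] b t by (auto simp: mult.assoc)
      also have "\<dots> \<le> q * q * (e12 + (if aa t = aa t' then e1 else 0) + (if b = b' then e2 else 0))"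
        using 2 by (intro mult_left_mono) (auto simp: add_increasing add_increasing2)
      finally show ?thesis .
    next
      case 3
      then have "(\<integral>\<^sup>+X. \<integral>\<^sup>+Y. collision X Y (aa t) b (aa t') b' \<partial>P2 \<partial>P1) \<le> q * q * e2"
        using collision_same_snd[of "aa t" "aa t'" b] b t by (auto simp: mult.assoc)
      also have "\<dots> \<le> q * q * (e12 + (if aa t = aa t' then e1 else 0) + (if b = b' then e2 else 0))"
        using 3 by (intro mult_left_mono) (auto simp: add_increasing add_increasing2)
      finally show ?thesis .
    qed
  qed
  also have "\<dots> = q * q * (\<Sum>b\<in>block S (bb t). \<Sum>b'\<in>block S (bb t').
      (e12 + (if aa t = aa t' then e1 else 0) + (if b = b' then e2 else 0)))"
    by (simp add: sum_distrib_left)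
  also have "\<dots> \<le> q * q * (of_nat (S * S) * e12 + (if aa t = aa t' then of_nat (S * S) * e1 else 0)
        + (if bb t = bb t' then of_nat S * e2 else 0))"
  proof (intro mult_left_mono)
    have s1: "(\<Sum>b'\<in>block S (bb t'). if b = b' then e2 else 0) \<le> (if bb t = bb t' then e2 else 0)"
      if "b \<in> block S (bb t)" for b
      using that block_disjoint[of b S "bb t" "bb t'"] by (auto simp: sum.delta)
    have "(\<Sum>b\<in>block S (bb t). \<Sum>b'\<in>block S (bb t').
        (e12 + (if aa t = aa t' then e1 else 0) + (if b = b' then e2 else 0)))
      \<le> (\<Sum>b\<in>block S (bb t). of_nat S * e12 + of_nat S * (if aa t = aa t' then e1 else 0) + (if bb t = bb t' then e2 else 0))"
    proof -
      have s2: "(\<Sum>b\<in>block S (bb t). \<Sum>b'\<in>block S (bb t'). if b = b' then e2 else 0)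
          \<le> (\<Sum>b\<in>block S (bb t). if bb t = bb t' then e2 else 0)"
        by (intro sum_mono s1)
      show ?thesis
        unfolding sum.distrib by (intro add_mono s2) (simp_all only: sum_constant card_block order_refl)
    qed
    also have "\<dots> = of_nat (S * S) * e12 + (if aa t = aa t' then of_nat (S * S) * e1 else 0)
        + (if bb t = bb t' then of_nat S * e2 else 0)"
      by (simp add: distrib_left mult.assoc)
    finally show "(\<Sum>b\<in>block S (bb t). \<Sum>b'\<in>block S (bb t').
        (e12 + (if aa t = aa t' then e1 else 0) + (if b = b' then e2 else 0)))
      \<le> of_nat (S * S) * e12 + (if aa t = aa t' then of_nat (S * S) * e1 else 0)
        + (if bb t = bb t' then of_nat S * e2 else 0)" .
  qed simp
  finally show ?thesis .
qed

lemma collisions_measurable: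
  assumes "f \<in> M \<rightarrow>\<^sub>M P1" "g \<in> M \<rightarrow>\<^sub>M P2"
    and "aa t \<in> I1" "aa t' \<in> I1" "block S (bb t) \<subseteq> I2" "block S (bb t') \<subseteq> I2"
  shows "(\<lambda>x. collisions S aa bb (f x) (g x) t t') \<in> borel_measurable M"
  unfolding collisions_def using assms by (intro borel_measurable_sum collision_measurable) auto

text \<open>\<open>G t\<close> are the competitors of \<open>t\<close>; \<open>m\<close>,
  \<open>m1\<close> and \<open>m2\<close> count all of them, those sharing the first codeword and
  those sharing the block.\<close>

lemma group_collisions_expectation:
  assumes T: "finite T" "\<And>t. t \<in> T \<Longrightarrow> aa t \<in> I1" "\<And>t. t \<in> T \<Longrightarrow> block S (bb t) \<subseteq> I2"
    and d: "\<And>t t'. t \<in> T \<Longrightarrow> t' \<in> T \<Longrightarrow> t \<noteq> t' \<Longrightarrow> aa t \<noteq> aa t' \<or> bb t \<noteq> bb t'"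
    and G: "\<And>t. t \<in> T \<Longrightarrow> G t \<subseteq> T - {t}"
    and m: "\<And>t. t \<in> T \<Longrightarrow> of_nat (card (G t)) \<le> m"
      "\<And>t. t \<in> T \<Longrightarrow> of_nat (card {t'\<in>G t. aa t = aa t'}) \<le> m1"
      "\<And>t. t \<in> T \<Longrightarrow> of_nat (card {t'\<in>G t. bb t = bb t'}) \<le> m2"
  shows "(\<integral>\<^sup>+X. \<integral>\<^sup>+Y. (\<Sum>t\<in>T. \<Sum>t'\<in>G t. collisions S aa bb X Y t t') \<partial>P2 \<partial>P1)
    \<le> of_nat (card T) * (q * q * (m * of_nat (S * S) * e12 + m1 * of_nat (S * S) * e1 + m2 * of_nat S * e2))"
proof -
  have fG: "finite (G t)" if "t \<in> T" for t using G[OF that] T finite_subset by blast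
  have GT: "t' \<in> T" "t' \<noteq> t" if "t \<in> T" "t' \<in> G t" for t t' using G that by auto
  have mm: "(\<lambda>Y. collisions S aa bb X Y t t') \<in> borel_measurable P2"
    if "X \<in> space P1" "t \<in> T" "t' \<in> G t" for X t t'
    using that T GT by (intro collisions_measurable) auto
  have m2: "(\<lambda>X. \<integral>\<^sup>+Y. collisions S aa bb X Y t t' \<partial>P2) \<in> borel_measurable P1"
    if "t \<in> T" "t' \<in> G t" for t t'
    using that T GT by (intro P2.borel_measurable_nn_integral)
      (auto simp: split_beta' intro!: collisions_measurable)
  have "(\<integral>\<^sup>+X. \<integral>\<^sup>+Y. (\<Sum>t\<in>T. \<Sum>t'\<in>G t. collisions S aa bb X Y t t') \<partial>P2 \<partial>P1)
      = (\<integral>\<^sup>+X. (\<Sum>t\<in>T. \<Sum>t'\<in>G t. \<integral>\<^sup>+Y. collisions S aa bb X Y t t' \<partial>P2) \<partial>P1)"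
    by (intro nn_integral_cong, subst nn_integral_sum, (intro borel_measurable_sum mm; simp),
       intro sum.cong refl, subst nn_integral_sum) (auto intro!: mm)
  also have "\<dots> = (\<Sum>t\<in>T. \<Sum>t'\<in>G t. \<integral>\<^sup>+X. \<integral>\<^sup>+Y. collisions S aa bb X Y t t' \<partial>P2 \<partial>P1)"
    by (subst nn_integral_sum, (intro borel_measurable_sum m2; simp), intro sum.cong refl, subst nn_integral_sum)
      (auto intro!: m2)
  also have "\<dots> \<le> (\<Sum>t\<in>T. q * q * (m * of_nat (S * S) * e12 + m1 * of_nat (S * S) * e1 + m2 * of_nat S * e2))"
  proof (intro sum_mono)
    fix t assume t: "t \<in> T"
    have "(\<Sum>t'\<in>G t. \<integral>\<^sup>+X. \<integral>\<^sup>+Y. collisions S aa bb X Y t t' \<partial>P2 \<partial>P1)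
      \<le> (\<Sum>t'\<in>G t. q * q * (of_nat (S * S) * e12 + (if aa t = aa t' then of_nat (S * S) * e1 else 0)
        + (if bb t = bb t' then of_nat S * e2 else 0)))"
      using t GT T d[of t] by (intro sum_mono collisions_expectation) blast+
    also have "\<dots> = q * q * (of_nat (card (G t)) * (of_nat (S * S) * e12)
        + of_nat (card {t'\<in>G t. aa t = aa t'}) * (of_nat (S * S) * e1)
        + of_nat (card {t'\<in>G t. bb t = bb t'}) * (of_nat S * e2))"
      using fG[OF t] by (simp add: sum_distrib_left[symmetric] sum.distrib sum.inter_filter[symmetric])
    also have "\<dots> \<le> q * q * (m * (of_nat (S * S) * e12) + m1 * (of_nat (S * S) * e1) + m2 * (of_nat S * e2))"
      using m[OF t] by (intro mult_left_mono add_mono mult_right_mono) auto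
    finally show "(\<Sum>t'\<in>G t. \<integral>\<^sup>+X. \<integral>\<^sup>+Y. collisions S aa bb X Y t t' \<partial>P2 \<partial>P1)
      \<le> q * q * (m * of_nat (S * S) * e12 + m1 * of_nat (S * S) * e1 + m2 * of_nat S * e2)"
      by (simp add: mult.assoc)
  qed
  finally show ?thesis by simp
qed

end

section \<open>Failure to find an accepted codeword in a block\<close>

context random_coding
begin

definition "encoding_fails B X Y a \<longleftrightarrow> (\<forall>b\<in>B. \<not> acc (X a) (Y b))"

lemma encoding_fails_measurable:
  assumes [measurable]: "f \<in> M \<rightarrow>\<^sub>M P1" "g \<in> M \<rightarrow>\<^sub>M P2" and "a \<in> I1" "B \<subseteq> I2"
  shows "Measurable.pred M (\<lambda>x. encoding_fails B (f x) (g x) a)"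
proof -
  have "finite B" using assms fin finite_subset by blast
  then show ?thesis
    unfolding encoding_fails_def using assms(3,4) by measurable (use assms in auto)
qed

text \<open>Given the first codeword \<open>x\<close>, the codewords of the block are independent,
  so for \<open>x\<close> in the good set \<open>E\<close> all are rejected with probability at most
  \<open>(1 - p) ^ card B \<le> exp (- p * card B)\<close>. Outside \<open>E\<close> the trivial
  bound 1 is paid with probability at most \<open>p'\<close>.\<close>

lemma encoding_failure_expectation:
  assumes ab: "a \<in> I1" "B \<subseteq> I2" and E: "E \<in> sets Q1" "emeasure Q1 (space Q1 - E) \<le> ennreal p'"
    and p: "0 \<le> p" "\<And>x. x \<in> E \<Longrightarrow> p \<le> measure Q2 {y\<in>space Q2. acc x y}" and "0 \<le> p'"
  shows "(\<integral>\<^sup>+X. \<integral>\<^sup>+Y. (if encoding_fails B X Y a then 1 else 0) \<partial>P2 \<partial>P1) \<le> ennreal (p' + exp (- p * card B))"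
proof -
  have fB: "finite B" using ab fin finite_subset by blast
  interpret pp: product_prob_space "\<lambda>_. Q2" I2 by unfold_locales
  define F where "F x = {y\<in>space Q2. \<not> acc x y}" for x
  have acc1: "Measurable.pred Q2 (acc x)" if "x \<in> space Q1" for x
    using that acc_measurable[of "\<lambda>_. x" Q2 "\<lambda>y. y"] by simp
  have Fm: "F x \<in> sets Q2" if "x \<in> space Q1" for x
    unfolding F_def using acc1[OF that] by measurable
  have FF[measurable]: "(\<lambda>x. emeasure Q2 (F x)) \<in> borel_measurable Q1"
  proof -
    have "(\<lambda>x. \<integral>\<^sup>+y. (if acc x y then 0 else 1) \<partial>Q2) \<in> borel_measurable Q1"
      by measurable
    moreover have "(\<integral>\<^sup>+y. (if acc x y then 0 else 1) \<partial>Q2) = emeasure Q2 (F x)" if "x \<in> space Q1" for x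
    proof -
      have "(\<integral>\<^sup>+y. (if acc x y then 0 else 1) \<partial>Q2) = (\<integral>\<^sup>+y. indicator (F x) y \<partial>Q2)"
        by (intro nn_integral_cong) (auto simp: F_def)
      then show ?thesis using Fm[OF that] by simp
    qed
    ultimately show ?thesis by (simp cong: measurable_cong)
  qed
  have "(\<integral>\<^sup>+X. \<integral>\<^sup>+Y. (if encoding_fails B X Y a then 1 else 0) \<partial>P2 \<partial>P1)
      = (\<integral>\<^sup>+X. emeasure Q2 (F (X a)) ^ card B \<partial>P1)"
  proof (intro nn_integral_cong)
    fix X assume X: "X \<in> space P1"
    then have Xa: "X a \<in> space Q1" using ab by (auto simp: space_PiM)
    have "(\<integral>\<^sup>+Y. (if encoding_fails B X Y a then 1 else 0) \<partial>P2)
        = (\<integral>\<^sup>+Y. indicator {Y\<in>space P2. \<forall>b\<in>B. Y b \<in> F (X a)} Y \<partial>P2)"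
      using ab by (intro nn_integral_cong)
        (auto simp: encoding_fails_def F_def indicator_def space_PiM PiE_iff of_bool_def subset_iff)
    also have "\<dots> = emeasure P2 {Y\<in>space P2. \<forall>b\<in>B. Y b \<in> F (X a)}"
      using Fm[OF Xa] fB ab by (intro nn_integral_indicator) (measurable, auto)
    also have "\<dots> = (\<Prod>b\<in>B. emeasure Q2 (F (X a)))"
      using Fm[OF Xa] fB ab by (intro pp.emeasure_PiM_Collect) auto
    finally show "(\<integral>\<^sup>+Y. (if encoding_fails B X Y a then 1 else 0) \<partial>P2) = emeasure Q2 (F (X a)) ^ card B"
      by simp
  qed
  also have "\<dots> = (\<integral>\<^sup>+x. emeasure Q2 (F x) ^ card B \<partial>Q1)"
    using ab by (intro nn_integral_PiM_component[OF Q1.prob_space_axioms]) auto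
  also have "\<dots> \<le> (\<integral>\<^sup>+x. indicator (space Q1 - E) x + ennreal (exp (- p * card B)) \<partial>Q1)"
  proof (intro nn_integral_mono)
    fix x assume x: "x \<in> space Q1"
    show "emeasure Q2 (F x) ^ card B \<le> indicator (space Q1 - E) x + ennreal (exp (- p * card B))"
    proof (cases "x \<in> E")
      case True
      have [measurable]: "Measurable.pred Q2 (acc x)" by (rule acc1[OF x])
      have "Q2.prob (F x) = 1 - Q2.prob {y\<in>space Q2. acc x y}"
        unfolding F_def using Q2.prob_neg[of "acc x"] by simp
      also have "\<dots> \<le> 1 - p" using p(2)[OF True] by simp
      also have "\<dots> \<le> exp (- p)" using exp_ge_add_one_self[of "- p"] by simp
      finally have "Q2.prob (F x) ^ card B \<le> exp (- p) ^ card B"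
        by (intro power_mono) auto
      also have "\<dots> = exp (- p * card B)"
        by (simp add: exp_of_nat_mult[symmetric] mult.commute)
      finally have "ennreal (Q2.prob (F x) ^ card B) \<le> ennreal (exp (- p * card B))"
        by (rule ennreal_leI)
      then show ?thesis
        by (simp add: Q2.emeasure_eq_measure ennreal_power add_increasing)
    next
      case False
      have "emeasure Q2 (F x) ^ card B \<le> 1 ^ card B"
        by (intro power_mono) (auto simp: Q2.measure_le_1)
      then show ?thesis using False x by (simp add: add_increasing2)
    qed
  qed
  also have "\<dots> = emeasure Q1 (space Q1 - E) + ennreal (exp (- p * card B))"
    using E by (subst nn_integral_add) (auto simp: Q1.emeasure_space_1)
  also have "\<dots> \<le> ennreal p' + ennreal (exp (- p * card B))"
    using E by (intro add_right_mono)
  also have "\<dots> = ennreal (p' + exp (- p * card B))"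
    using assms by (simp add: ennreal_plus)
  finally show ?thesis .
qed

end

section \<open>Gaussian codebooks of fixed length\<close>

text \<open>The competitors of \<open>t\<close> for a decoder that is told the interval of length
  \<open>L\<close> containing \<open>t\<close>.\<close>

definition peers :: "nat \<Rightarrow> nat \<Rightarrow> nat \<Rightarrow> nat set" where
  "peers N L t = {t'. t' < N \<and> t' div L = t div L \<and> t' \<noteq> t}"

lemma finite_peers [simp]: "finite (peers N L t)"
  by (simp add: peers_def)

text \<open>The competitors congruent to \<open>t\<close> lie at distances \<open>d\<close>,
  \<open>2 * d\<close> and so on, below and above \<open>t\<close> within its interval. As
  \<open>t\<close> itself is excluded there is no rounding term: the bound vanishes for
  \<open>L = 1\<close> and stays proportional to \<open>1 / d\<close> even when \<open>d\<close>
  exceeds \<open>L\<close>.\<close>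

lemma card_peers_mod:
  assumes L: "0 < L" and d: "0 < d"
  shows "real (card {t'\<in>peers N L t. t mod d = t' mod d}) \<le> real (L - 1) / real d"
proof -
  define x where "x = t mod L"
  have x: "x < L" "t = t div L * L + x" using L by (simp_all add: x_def)
  let ?A = "(\<lambda>k. t - d * k) ` {1..x div d}" and ?B = "(\<lambda>k. t + d * k) ` {1..(L - 1 - x) div d}"
  have "{t'\<in>peers N L t. t mod d = t' mod d} \<subseteq> ?A \<union> ?B"
  proof
    fix t' assume "t' \<in> {t'\<in>peers N L t. t mod d = t' mod d}"
    then have t': "t' div L = t div L" "t' \<noteq> t" "t mod d = t' mod d" by (auto simp: peers_def)
    have t'2: "t' = t div L * L + t' mod L" "t' mod L < L" using t'(1) L by (metis div_mult_mod_eq, simp)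
    show "t' \<in> ?A \<union> ?B"
    proof (cases "t' < t")
      case True
      then have "d dvd t - t'" using t'(3) by (metis mod_eq_dvd_iff_nat less_imp_le)
      then obtain k where k: "t - t' = d * k" by (elim dvdE)
      have "d * k \<le> x" using k x t'2 by linarith
      then have "k \<le> x div d" using d by (simp add: less_eq_div_iff_mult_less_eq mult.commute)
      moreover have "k \<noteq> 0" using k True by (cases k) auto
      ultimately have "k \<in> {1..x div d}" by simp
      moreover have "t' = t - d * k" using k True by simp
      ultimately show ?thesis by blast
    next
      case False
      then have tt: "t < t'" using t' by simp
      then have "d dvd t' - t" using t'(3) by (metis mod_eq_dvd_iff_nat less_imp_le)
      then obtain k where k: "t' - t = d * k" by (elim dvdE)
      have "d * k \<le> L - 1 - x" using k x t'2 tt by linarith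
      then have "k \<le> (L - 1 - x) div d" using d by (simp add: less_eq_div_iff_mult_less_eq mult.commute)
      moreover have "k \<noteq> 0" using k tt by (cases k) auto
      ultimately have "k \<in> {1..(L - 1 - x) div d}" by simp
      moreover have "t' = t + d * k" using k tt by simp
      ultimately show ?thesis by blast
    qed
  qed
  then have "card {t'\<in>peers N L t. t mod d = t' mod d} \<le> card (?A \<union> ?B)"
    by (intro card_mono) auto
  also have "\<dots> \<le> card ?A + card ?B" by (rule card_Un_le)
  also have "\<dots> \<le> x div d + (L - 1 - x) div d"
    using card_image_le[of "{1..x div d}" "\<lambda>k. t - d * k"]
      card_image_le[of "{1..(L - 1 - x) div d}" "\<lambda>k. t + d * k"] by simp
  finally have c: "card {t'\<in>peers N L t. t mod d = t' mod d} \<le> x div d + (L - 1 - x) div d" .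
  have "(x div d + (L - 1 - x) div d) * d = x div d * d + (L - 1 - x) div d * d"
    by (simp add: distrib_right)
  also have "\<dots> \<le> x + (L - 1 - x)" by (intro add_mono) (simp_all add: div_times_less_eq_dividend)
  also have "\<dots> \<le> L - 1" using x by simp
  finally have "card {t'\<in>peers N L t. t mod d = t' mod d} * d \<le> L - 1"
    using c mult_le_mono1 order_trans by blast
  then have "real (card {t'\<in>peers N L t. t mod d = t' mod d}) * real d \<le> real (L - 1)"
    by (metis of_nat_le_iff of_nat_mult)
  then show ?thesis using d by (simp add: pos_le_divide_eq)
qed

lemma card_peers: "0 < L \<Longrightarrow> real (card (peers N L t)) \<le> real (L - 1)"
  using card_peers_mod[of L 1 N t] by simp

lemma peers_subset: "peers N L t \<subseteq> {..<N} - {t}"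
  by (auto simp: peers_def)

section \<open>The Gaussian channel, its decoding tests and their error exponents\<close>

definition channel_out :: "nat \<Rightarrow> real \<Rightarrow> (nat \<Rightarrow> real) \<Rightarrow> (nat \<Rightarrow> real) \<Rightarrow> (nat \<Rightarrow> real) \<Rightarrow> nat \<Rightarrow> real" where
  "channel_out n s x y u = (\<lambda>i\<in>{1..n}. s * (x i + y i) + u i)"

lemma channel_out_measurable [measurable (raw)]:
  assumes [measurable]: "f \<in> M \<rightarrow>\<^sub>M real_vectors n" "g \<in> M \<rightarrow>\<^sub>M real_vectors n" "k \<in> M \<rightarrow>\<^sub>M real_vectors n"
  shows "(\<lambda>x. channel_out n s (f x) (g x) (k x)) \<in> M \<rightarrow>\<^sub>M real_vectors n"
  unfolding channel_out_def by measurable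

lemma channel_out_measurable_noise [measurable]:
  "(\<lambda>u. channel_out n s x y u) \<in> real_vectors n \<rightarrow>\<^sub>M real_vectors n"
  unfolding channel_out_def by measurable

lemma info_ge_cong:
  assumes "\<And>i. i \<in> {1..n} \<Longrightarrow> X i = X' i" "\<And>i. i \<in> {1..n} \<Longrightarrow> y i = y' i"
  shows "info_ge n s u g U X y = info_ge n s u g U X' y'"
  unfolding info_ge_def using assms
  by (intro arg_cong[where f="\<lambda>z. exp (real n * g) \<le> z"] prod.cong refl) simp

context gaussian_pair
begin

definition "cap12 s = 1/2 * ln (1 + s\<^sup>2 * sump)"
definition "cap_cond s = 1/2 * ln (1 + s\<^sup>2 * rvar)"

end

context gaussian_pair
begin

text \<open>One test for each way a wrong pair may differ from the true one: in both codewords, only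
  in the second, only in the first. Joint typicality is imposed at selection rather than by the
  decoder.\<close>

definition decodable :: "nat \<Rightarrow> real \<Rightarrow> real \<Rightarrow> (nat \<Rightarrow> real) \<Rightarrow> (nat \<Rightarrow> real) \<Rightarrow> (nat \<Rightarrow> real) \<Rightarrow> bool" where
  "decodable n s h x y z \<longleftrightarrow>
     info_ge n s sump (cap12 s - h) (\<lambda>i. x i + y i) (\<lambda>i. x i + y i) z \<and>
     info_ge n s rvar (cap_cond s - h) (\<lambda>i. y i - slope * x i) (\<lambda>i. x i + y i) z \<and>
     info_ge n s swap.rvar (swap.cap_cond s - h) (\<lambda>i. x i - swap.slope * y i) (\<lambda>i. x i + y i) z"

lemma decodable_measurable [measurable (raw)]:
  assumes [measurable]: "f \<in> M \<rightarrow>\<^sub>M real_vectors n" "g \<in> M \<rightarrow>\<^sub>M real_vectors n" "k \<in> M \<rightarrow>\<^sub>M real_vectors n"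
  shows "Measurable.pred M (\<lambda>x. decodable n s h (f x) (g x) (k x))"
  unfolding decodable_def info_ge_def by measurable

lemma decodable_measurable_output [measurable]:
  "Measurable.pred (real_vectors n) (\<lambda>z. decodable n s h x y z)"
  unfolding decodable_def info_ge_def by measurable

definition confusion :: "nat \<Rightarrow> real \<Rightarrow> real \<Rightarrow> (nat \<Rightarrow> real) \<Rightarrow> (nat \<Rightarrow> real) \<Rightarrow> (nat \<Rightarrow> real) \<Rightarrow> (nat \<Rightarrow> real) \<Rightarrow> ennreal" where
  "confusion n s h x y x' y' =
     (\<integral>\<^sup>+u. (if decodable n s h x' y' (channel_out n s x y u) then 1 else 0) \<partial>gaussian_vector n 1)"

text \<open>Three times the Chebyshev constant of a single test, with the variance of each tested
  part bounded by the sum of all three.\<close>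

definition "not_decodable_const h = 3 * (8 + 4 * (sump + rvar + swap.rvar) + 2 * h) / h\<^sup>2"

lemma decodable_typical:
  assumes n: "0 < n" and h: "0 < h" and s: "0 \<le> s" "s \<le> 1"
    and e: "0 < e" "e * modulus \<le> h" "e * swap.modulus \<le> h" and T: "typical n e x y"
  shows "(\<integral>\<^sup>+u. (if decodable n s h x y (channel_out n s x y u) then 0 else 1) \<partial>gaussian_vector n 1)
    \<le> ennreal (not_decodable_const h / real n)"
proof -
  let ?N = "gaussian_vector n 1"
  interpret N: prob_space ?N by (rule prob_space_gaussian_vector) simp
  define Bd where "Bd v U = {z\<in>space ?N. \<not> info_ge n s v (1/2 * ln (1 + s\<^sup>2 * v) - h) U (\<lambda>i. x i + y i) (\<lambda>i. s * (x i + y i) + z i)}" for v U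
  have Bm: "Bd v U \<in> sets ?N" for v U
    unfolding Bd_def info_ge_def by measurable
  have Bp: "N.prob (Bd v U) \<le> (8 + 4 * (sump + rvar + swap.rvar) + 2 * h) / h\<^sup>2 / real n"
    if "0 \<le> v" "v \<le> sump + rvar + swap.rvar" "\<bar>ip n U U - real n * v\<bar> \<le> real n * (h / 2)" for v U
  proof -
    have "N.prob (Bd v U) \<le> (8 + 4 * v + 2 * h) / h\<^sup>2 / real n"
      unfolding Bd_def by (rule info_ge_typical) (use that s h n in auto)
    also have "\<dots> \<le> (8 + 4 * (sump + rvar + swap.rvar) + 2 * h) / h\<^sup>2 / real n"
      using that by (intro divide_right_mono) auto
    finally show ?thesis .
  qed
  have three: "3 * c = c + c + c" for c :: real by simp
  have weaken: "\<bar>z\<bar> \<le> real n * (h / 2)" if "\<bar>z\<bar> \<le> real n * c" "c \<le> h / 2" for z c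
    using that mult_left_mono[of c "h/2" "real n"] by linarith
  note pos = sump_pos rvar_pos swap.rvar_pos
  let ?U1 = "\<lambda>i. x i + y i" and ?U2 = "\<lambda>i. y i - slope * x i" and ?U3 = "\<lambda>i. x i - swap.slope * y i"
  have 1: "N.prob (Bd sump ?U1) \<le> (8 + 4 * (sump + rvar + swap.rvar) + 2 * h) / h\<^sup>2 / real n"
    using pos by (intro Bp weaken[OF typical_sum[OF T e(2,1)]]) auto
  have 2: "N.prob (Bd rvar ?U2) \<le> (8 + 4 * (sump + rvar + swap.rvar) + 2 * h) / h\<^sup>2 / real n"
    using pos by (intro Bp weaken[OF typical_residual[OF T e(2,1)]]) auto
  have T': "swap.typical n e y x" using T by (simp add: swap_typical)
  have 3: "N.prob (Bd swap.rvar ?U3) \<le> (8 + 4 * (sump + rvar + swap.rvar) + 2 * h) / h\<^sup>2 / real n"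
    using pos by (intro Bp weaken[OF swap.typical_residual[OF T' e(3,1)]]) auto
  have eq: "info_ge n s v g U X (channel_out n s x y u) = info_ge n s v g U X (\<lambda>i. s * (x i + y i) + u i)" for v g U X u
    by (intro info_ge_cong) (auto simp: channel_out_def)
  have "(\<integral>\<^sup>+u. (if decodable n s h x y (channel_out n s x y u) then 0 else 1) \<partial>?N)
    \<le> (\<integral>\<^sup>+u. indicator (Bd sump ?U1 \<union> Bd rvar ?U2 \<union> Bd swap.rvar ?U3) u \<partial>?N)"
    by (intro nn_integral_mono) (auto simp: decodable_def eq Bd_def cap12_def cap_cond_def swap.cap_cond_def)
  also have "\<dots> = ennreal (N.prob (Bd sump ?U1 \<union> Bd rvar ?U2 \<union> Bd swap.rvar ?U3))"
    using Bm by (subst nn_integral_indicator) (auto simp: N.emeasure_eq_measure)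
  also have "\<dots> \<le> ennreal (not_decodable_const h / real n)"
  proof (rule ennreal_leI)
    have "N.prob (Bd sump ?U1 \<union> Bd rvar ?U2 \<union> Bd swap.rvar ?U3)
      \<le> N.prob (Bd sump ?U1) + N.prob (Bd rvar ?U2) + N.prob (Bd swap.rvar ?U3)"
      using measure_Un_le[of "Bd sump ?U1 \<union> Bd rvar ?U2" ?N "Bd swap.rvar ?U3"]
        measure_Un_le[of "Bd sump ?U1" ?N "Bd rvar ?U2"] Bm by fastforce
    also have "\<dots> \<le> 3 * ((8 + 4 * (sump + rvar + swap.rvar) + 2 * h) / h\<^sup>2 / real n)"
      using add_mono[OF add_mono[OF 1 2] 3] by (simp only: three)
    also have "\<dots> = not_decodable_const h / real n"
      by (simp add: not_decodable_const_def)
    finally show "N.prob (Bd sump ?U1 \<union> Bd rvar ?U2 \<union> Bd swap.rvar ?U3) \<le> not_decodable_const h / real n" .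
  qed
  finally show ?thesis .
qed

lemma random_coding_gaussian:
  assumes e: "0 < e" "e * modulus \<le> h" and I: "finite I1" "finite I2"
  shows "random_coding (gaussian_vector n p1) (gaussian_vector n p2) (typical n e) (ennreal (exp (- (real n * (mi - h))))) I1 I2"
proof -
  interpret Q1: prob_space "gaussian_vector n p1" by (rule prob_space_gaussian_vector[OF p1])
  interpret Q2: prob_space "gaussian_vector n p2" by (rule prob_space_gaussian_vector[OF p2])
  show ?thesis
  proof unfold_locales
    show "Measurable.pred (gaussian_vector n p1 \<Otimes>\<^sub>M gaussian_vector n p2) (\<lambda>z. typical n e (fst z) (snd z))"
      by measurable
    show "(\<integral>\<^sup>+y. indicator {y. typical n e x y} y \<partial>gaussian_vector n p2) \<le> ennreal (exp (- (real n * (mi - h))))" for x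
      using e by (intro nn_integral_typical) auto
  qed (use I in auto)
qed

text \<open>Each kind of wrong pair is excluded by the matching test. Fubini moves the noise
  integral outside, after which the likelihood ratio bound applies to every fixed output, whichever
  pair was sent.\<close>

lemma random_coding_channel_gaussian:
  assumes e: "0 < e" "e * modulus \<le> h" "e * swap.modulus \<le> h" and I: "finite I1" "finite I2"
  shows "random_coding_channel (gaussian_vector n p1) (gaussian_vector n p2) (typical n e) (ennreal (exp (- (real n * (mi - h))))) I1 I2
    (confusion n s h) (ennreal (exp (- (real n * (cap_cond s - h))))) (ennreal (exp (- (real n * (swap.cap_cond s - h)))))
    (ennreal (exp (- (real n * (cap12 s - h)))))"
proof -
  let ?Q1 = "gaussian_vector n p1" and ?Q2 = "gaussian_vector n p2" and ?N = "gaussian_vector n 1"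
  let ?q = "ennreal (exp (- (real n * (mi - h))))"
  interpret R: random_coding ?Q1 ?Q2 "typical n e" ?q I1 I2
    by (rule random_coding_gaussian) (use assms in auto)
  interpret N: prob_space ?N by (rule prob_space_gaussian_vector) simp
  interpret N1: pair_sigma_finite ?N ?Q1 ..
  interpret N2: pair_sigma_finite ?N ?Q2 ..
  define D where "D x y z = (if decodable n s h x y z then 1 else 0 :: ennreal)" for x y z
  have D[measurable (raw)]: "(\<lambda>x. D (f x) (g x) (k x)) \<in> borel_measurable M"
    if [measurable]: "f \<in> M \<rightarrow>\<^sub>M real_vectors n" "g \<in> M \<rightarrow>\<^sub>M real_vectors n" "k \<in> M \<rightarrow>\<^sub>M real_vectors n" for f g k M
    unfolding D_def by measurable
  have Dn: "(\<lambda>u. D x' y' (channel_out n s x y u)) \<in> borel_measurable ?N" for x y x' y'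
    unfolding D_def by measurable
  have C: "confusion n s h x y x' y' = (\<integral>\<^sup>+u. D x' y' (channel_out n s x y u) \<partial>?N)" for x y x' y'
    by (simp add: confusion_def D_def)
  have sp: "x \<in> space (real_vectors n)" if "x \<in> space (gaussian_vector n v)" for x v
    using that by (simp add: space_gaussian_vector)
  show ?thesis
  proof unfold_locales
    show "(\<lambda>z. confusion n s h (fst z) (fst (snd z)) (fst (snd (snd z))) (snd (snd (snd z))))
      \<in> borel_measurable (?Q1 \<Otimes>\<^sub>M ?Q2 \<Otimes>\<^sub>M ?Q1 \<Otimes>\<^sub>M ?Q2)"
      unfolding C by measurable
  next
    fix x y assume xy: "x \<in> space ?Q1" "y \<in> space ?Q2"
    note [simp] = xy sp[OF xy(1)] sp[OF xy(2)]
    have cm: "(\<integral>\<^sup>+y'. R.A x' y' * confusion n s h x y x' y' \<partial>?Q2)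
        = (\<integral>\<^sup>+u. \<integral>\<^sup>+y'. R.A x' y' * D x' y' (channel_out n s x y u) \<partial>?Q2 \<partial>?N)" if "x' \<in> space ?Q1" for x'
    proof -
      note [simp] = that sp[OF that]
      have "(\<integral>\<^sup>+y'. R.A x' y' * confusion n s h x y x' y' \<partial>?Q2)
        = (\<integral>\<^sup>+y'. \<integral>\<^sup>+u. R.A x' y' * D x' y' (channel_out n s x y u) \<partial>?N \<partial>?Q2)"
        unfolding C by (intro nn_integral_cong nn_integral_cmult[symmetric] Dn)
      also have "\<dots> = (\<integral>\<^sup>+u. \<integral>\<^sup>+y'. R.A x' y' * D x' y' (channel_out n s x y u) \<partial>?Q2 \<partial>?N)"
        by (intro N2.Fubini') measurable
      finally show ?thesis .
    qed
    have "(\<integral>\<^sup>+x'. \<integral>\<^sup>+y'. R.A x' y' * confusion n s h x y x' y' \<partial>?Q2 \<partial>?Q1)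
        = (\<integral>\<^sup>+x'. \<integral>\<^sup>+u. \<integral>\<^sup>+y'. R.A x' y' * D x' y' (channel_out n s x y u) \<partial>?Q2 \<partial>?N \<partial>?Q1)"
      by (intro nn_integral_cong cm)
    also have "\<dots> = (\<integral>\<^sup>+u. \<integral>\<^sup>+x'. \<integral>\<^sup>+y'. R.A x' y' * D x' y' (channel_out n s x y u) \<partial>?Q2 \<partial>?Q1 \<partial>?N)"
      by (intro N1.Fubini') measurable
    also have "\<dots> \<le> ?q * ennreal (exp (- (real n * (cap12 s - h))))"
    proof (intro N.nn_integral_le_const)
      fix u
      have "(\<integral>\<^sup>+x'. \<integral>\<^sup>+y'. R.A x' y' * D x' y' (channel_out n s x y u) \<partial>?Q2 \<partial>?Q1)
        \<le> (\<integral>\<^sup>+x'. \<integral>\<^sup>+y'. indicator {y'. typical n e x' y' \<and> info_ge n s sump (cap12 s - h) (\<lambda>i. x' i + y' i) (\<lambda>i. x' i + y' i)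
            (channel_out n s x y u)} y' \<partial>?Q2 \<partial>?Q1)"
        by (intro nn_integral_mono) (auto simp: R.A_def D_def decodable_def)
      also have "\<dots> \<le> ennreal (exp (- (real n * (mi - h))) * exp (- (real n * (cap12 s - h))))"
        by (rule nn_integral_typical_info_joint) (use e in auto)
      finally show "(\<integral>\<^sup>+x'. \<integral>\<^sup>+y'. R.A x' y' * D x' y' (channel_out n s x y u) \<partial>?Q2 \<partial>?Q1)
        \<le> ?q * ennreal (exp (- (real n * (cap12 s - h))))"
        by (simp add: ennreal_mult')
    qed
    finally show "(\<integral>\<^sup>+x'. \<integral>\<^sup>+y'. R.A x' y' * confusion n s h x y x' y' \<partial>?Q2 \<partial>?Q1)
      \<le> ?q * ennreal (exp (- (real n * (cap12 s - h))))" .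
  next
    fix x y assume xy: "x \<in> space ?Q1" "y \<in> space ?Q2"
    note [simp] = xy sp[OF xy(1)] sp[OF xy(2)]
    have "(\<integral>\<^sup>+y'. R.A x y' * confusion n s h x y x y' \<partial>?Q2)
        = (\<integral>\<^sup>+y'. \<integral>\<^sup>+u. R.A x y' * D x y' (channel_out n s x y u) \<partial>?N \<partial>?Q2)"
      unfolding C by (intro nn_integral_cong nn_integral_cmult[symmetric] Dn)
    also have "\<dots> = (\<integral>\<^sup>+u. \<integral>\<^sup>+y'. R.A x y' * D x y' (channel_out n s x y u) \<partial>?Q2 \<partial>?N)"
      by (intro N2.Fubini') measurable
    also have "\<dots> \<le> ?q * ennreal (exp (- (real n * (cap_cond s - h))))"
    proof (intro N.nn_integral_le_const)
      fix u
      have "(\<integral>\<^sup>+y'. R.A x y' * D x y' (channel_out n s x y u) \<partial>?Q2)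
        \<le> (\<integral>\<^sup>+y'. indicator {y'. typical n e x y' \<and> info_ge n s rvar (cap_cond s - h) (\<lambda>i. y' i - slope * x i) (\<lambda>i. x i + y' i)
            (channel_out n s x y u)} y' \<partial>?Q2)"
        by (intro nn_integral_mono) (auto simp: R.A_def D_def decodable_def)
      also have "\<dots> \<le> ennreal (exp (- (real n * (mi - h))) * exp (- (real n * (cap_cond s - h))))"
        by (rule nn_integral_typical_info_conditional) (use e in auto)
      finally show "(\<integral>\<^sup>+y'. R.A x y' * D x y' (channel_out n s x y u) \<partial>?Q2)
        \<le> ?q * ennreal (exp (- (real n * (cap_cond s - h))))"
        by (simp add: ennreal_mult')
    qed
    finally show "(\<integral>\<^sup>+y'. R.A x y' * confusion n s h x y x y' \<partial>?Q2)
      \<le> ?q * ennreal (exp (- (real n * (cap_cond s - h))))" .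
    have "(\<integral>\<^sup>+x'. R.A x' y * confusion n s h x y x' y \<partial>?Q1)
        = (\<integral>\<^sup>+x'. \<integral>\<^sup>+u. R.A x' y * D x' y (channel_out n s x y u) \<partial>?N \<partial>?Q1)"
      unfolding C by (intro nn_integral_cong nn_integral_cmult[symmetric] Dn)
    also have "\<dots> = (\<integral>\<^sup>+u. \<integral>\<^sup>+x'. R.A x' y * D x' y (channel_out n s x y u) \<partial>?Q1 \<partial>?N)"
      by (intro N1.Fubini') measurable
    also have "\<dots> \<le> ?q * ennreal (exp (- (real n * (swap.cap_cond s - h))))"
    proof (intro N.nn_integral_le_const)
      fix u
      have "(\<integral>\<^sup>+x'. R.A x' y * D x' y (channel_out n s x y u) \<partial>?Q1)
        \<le> (\<integral>\<^sup>+x'. indicator {x'. swap.typical n e y x' \<and> info_ge n s swap.rvar (swap.cap_cond s - h)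
            (\<lambda>i. x' i - swap.slope * y i) (\<lambda>i. y i + x' i) (channel_out n s x y u)} x' \<partial>?Q1)"
        by (intro nn_integral_mono) (auto simp: R.A_def D_def decodable_def swap_typical add.commute)
      also have "\<dots> \<le> ennreal (exp (- (real n * (swap.mi - h))) * exp (- (real n * (swap.cap_cond s - h))))"
        by (rule swap.nn_integral_typical_info_conditional) (use e in auto)
      finally show "(\<integral>\<^sup>+x'. R.A x' y * D x' y (channel_out n s x y u) \<partial>?Q1)
        \<le> ?q * ennreal (exp (- (real n * (swap.cap_cond s - h))))"
        by (simp add: ennreal_mult' swap_mi)
    qed
    finally show "(\<integral>\<^sup>+x'. R.A x' y * confusion n s h x y x' y \<partial>?Q1)
      \<le> ?q * ennreal (exp (- (real n * (swap.cap_cond s - h))))" .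
  qed
qed

text \<open>Bound on the mean number of collisions per pair \<open>t\<close>: the acceptance
  probability squared, for the two candidates, times one summand for each kind of competitor.
  \<open>(L - 1) / J\<close> of them share the codeword of relay 1 and \<open>(L - 1) / K\<close>
  share the block.\<close>

definition "collision_rate n h S J K s L = (exp (- (real n * (mi - h))))\<^sup>2 * (real (L - 1) * (real S)\<^sup>2 * exp (- (real n * (cap12 s - h)))
   + real (L - 1) / real J * (real S)\<^sup>2 * exp (- (real n * (cap_cond s - h)))
   + real (L - 1) / real K * real S * exp (- (real n * (swap.cap_cond s - h))))"

text \<open>An atypical norm of the codeword of relay 1, plus the rejection of a whole block of
  \<open>S\<close> candidates.\<close>

definition "failure_rate n e h S = 2 * p1\<^sup>2 / (real n * (e / (1 + \<bar>slope\<bar>)\<^sup>2)\<^sup>2) + exp (- (1/2 * exp (- (real n * (mi + h)))) * real S)"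

end

lemma LEAST_eqI_match:
  fixes t :: nat
  assumes "t \<in> K" "P t" "t < N" "\<And>t'. t' \<in> K - {t} \<Longrightarrow> \<not> P t'"
  shows "(LEAST t. t \<in> K \<and> P t \<or> N \<le> t) = t"
  using assms by (intro Least_equality) (auto simp: not_le[symmetric] intro: ccontr)

lemma nn_integral_iterated_add:
  assumes "sigma_finite_measure M2"
    and f: "(\<lambda>z. f (fst z) (snd z)) \<in> borel_measurable (M1 \<Otimes>\<^sub>M M2)"
    and g: "(\<lambda>z. g (fst z) (snd z)) \<in> borel_measurable (M1 \<Otimes>\<^sub>M M2)"
  shows "(\<integral>\<^sup>+x. \<integral>\<^sup>+y. f x y + g x y \<partial>M2 \<partial>M1) = (\<integral>\<^sup>+x. \<integral>\<^sup>+y. f x y \<partial>M2 \<partial>M1) + (\<integral>\<^sup>+x. \<integral>\<^sup>+y. g x y \<partial>M2 \<partial>M1)"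
proof -
  interpret M2: sigma_finite_measure M2 by fact
  have m: "(\<lambda>y. k x y) \<in> borel_measurable M2" "(\<lambda>x. \<integral>\<^sup>+y. k x y \<partial>M2) \<in> borel_measurable M1"
    if k: "(\<lambda>z. k (fst z) (snd z)) \<in> borel_measurable (M1 \<Otimes>\<^sub>M M2)" and "x \<in> space M1" for k :: "_ \<Rightarrow> _ \<Rightarrow> ennreal" and x
  proof -
    show "(\<lambda>y. k x y) \<in> borel_measurable M2"
      using measurable_compose[OF _ k, of "\<lambda>y. (x, y)" M2] that(2) by simp
    show "(\<lambda>x. \<integral>\<^sup>+y. k x y \<partial>M2) \<in> borel_measurable M1"
      using k by (intro M2.borel_measurable_nn_integral) (simp add: split_beta')
  qed
  show ?thesis
  proof (cases "space M1 = {}")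
    case True
    then show ?thesis by (simp add: nn_integral_empty)
  next
    case False
    then obtain x0 where x0: "x0 \<in> space M1" by auto
    have "(\<integral>\<^sup>+x. \<integral>\<^sup>+y. f x y + g x y \<partial>M2 \<partial>M1) = (\<integral>\<^sup>+x. (\<integral>\<^sup>+y. f x y \<partial>M2) + (\<integral>\<^sup>+y. g x y \<partial>M2) \<partial>M1)"
      by (intro nn_integral_cong nn_integral_add m f g)
    also have "\<dots> = (\<integral>\<^sup>+x. \<integral>\<^sup>+y. f x y \<partial>M2 \<partial>M1) + (\<integral>\<^sup>+x. \<integral>\<^sup>+y. g x y \<partial>M2 \<partial>M1)"
      using x0 by (intro nn_integral_add m f g)
    finally show ?thesis .
  qed
qed

context gaussian_pair
begin

text \<open>\<open>F\<close> collects the pairs whose selection failed; they are left out of the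
  candidates. The decoder takes the least index of its group that passes all tests, so it errs only
  if \<open>t\<close> fails its own tests or another candidate of the group passes.\<close>

lemma decoder_exists:
  assumes n: "0 < n" and h: "0 < h" and s: "0 \<le> s" "s \<le> 1"
    and e: "0 < e" "e * modulus \<le> h" "e * swap.modulus \<le> h"
    and T: "\<And>t. t < N \<Longrightarrow> t \<notin> F \<Longrightarrow> typical n e (cx t) (cy t)"
  shows "\<exists>d. (\<forall>g. d g \<in> real_vectors n \<rightarrow>\<^sub>M count_space UNIV) \<and>
    (\<forall>t<N. t \<notin> F \<longrightarrow>
      emeasure (gaussian_vector n 1) {u\<in>space (gaussian_vector n 1). d (t div L) (channel_out n s (cx t) (cy t) u) \<noteq> t}
      \<le> ennreal (not_decodable_const h / real n) + (\<Sum>t'\<in>peers N L t - F. confusion n s h (cx t) (cy t) (cx t') (cy t')))"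
proof -
  let ?N = "gaussian_vector n 1"
  define K where "K g = {t. t < N \<and> t div L = g \<and> t \<notin> F}" for g
  define d :: "nat \<Rightarrow> (nat \<Rightarrow> real) \<Rightarrow> nat" where
    "d g y = (LEAST t. t \<in> K g \<and> decodable n s h (cx t) (cy t) y \<or> N \<le> t)" for g y
    \<comment> \<open>the value \<open>N\<close> signals a decoding failure\<close>
  have dm[measurable]: "d g \<in> real_vectors n \<rightarrow>\<^sub>M count_space UNIV" for g
    unfolding d_def by measurable
  have "emeasure ?N {u\<in>space ?N. d (t div L) (channel_out n s (cx t) (cy t) u) \<noteq> t}
      \<le> ennreal (not_decodable_const h / real n) + (\<Sum>t'\<in>peers N L t - F. confusion n s h (cx t) (cy t) (cx t') (cy t'))"
    if t: "t < N" "t \<notin> F" for t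
  proof -
    let ?o = "channel_out n s (cx t) (cy t)"
    have "{u\<in>space ?N. d (t div L) (?o u) \<noteq> t} \<in> sets ?N" by measurable
    then have "emeasure ?N {u\<in>space ?N. d (t div L) (?o u) \<noteq> t}
      = (\<integral>\<^sup>+u. indicator {u\<in>space ?N. d (t div L) (?o u) \<noteq> t} u \<partial>?N)"
      by (subst nn_integral_indicator) auto
    also have "\<dots> \<le> (\<integral>\<^sup>+u. (if decodable n s h (cx t) (cy t) (?o u) then 0 else 1)
        + (\<Sum>t'\<in>peers N L t - F. if decodable n s h (cx t') (cy t') (?o u) then 1 else 0) \<partial>?N)"
    proof (intro nn_integral_mono)
      fix u
      show "indicator {u\<in>space ?N. d (t div L) (?o u) \<noteq> t} u \<le> (if decodable n s h (cx t) (cy t) (?o u) then 0 else 1)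
        + (\<Sum>t'\<in>peers N L t - F. if decodable n s h (cx t') (cy t') (?o u) then 1 else 0 :: ennreal)"
      proof (cases "decodable n s h (cx t) (cy t) (?o u) \<and> (\<forall>t'\<in>peers N L t - F. \<not> decodable n s h (cx t') (cy t') (?o u))")
        case True
        have "d (t div L) (?o u) = t"
          unfolding d_def using True t by (intro LEAST_eqI_match) (auto simp: K_def peers_def)
        then show ?thesis by simp
      next
        case False
        then consider "\<not> decodable n s h (cx t) (cy t) (?o u)"
          | t' where "t' \<in> peers N L t - F" "decodable n s h (cx t') (cy t') (?o u)" by blast
        then have "1 \<le> (if decodable n s h (cx t) (cy t) (?o u) then 0 else 1)
          + (\<Sum>t'\<in>peers N L t - F. if decodable n s h (cx t') (cy t') (?o u) then 1 else 0 :: ennreal)"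
        proof cases
          case 2
          have "(if decodable n s h (cx t') (cy t') (?o u) then 1 else 0 :: ennreal)
            \<le> (\<Sum>t'\<in>peers N L t - F. if decodable n s h (cx t') (cy t') (?o u) then 1 else 0)"
            using 2(1) by (intro member_le_sum) auto
          then show ?thesis using 2 by (simp add: add_increasing)
        qed (simp add: add_increasing2)
        then show ?thesis
          by (rule order_trans[rotated]) (simp add: indicator_def)
      qed
    qed
    also have "\<dots> = (\<integral>\<^sup>+u. (if decodable n s h (cx t) (cy t) (?o u) then 0 else 1) \<partial>?N)
        + (\<Sum>t'\<in>peers N L t - F. confusion n s h (cx t) (cy t) (cx t') (cy t'))"
      unfolding confusion_def by (subst nn_integral_add, measurable, subst nn_integral_sum) auto
    also have "\<dots> \<le> ennreal (not_decodable_const h / real n) + (\<Sum>t'\<in>peers N L t - F. confusion n s h (cx t) (cy t) (cx t') (cy t'))"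
      by (intro add_right_mono decodable_typical[OF n h s e T] t)
    finally show ?thesis .
  qed
  then show ?thesis using dm by blast
qed

text \<open>The pair \<open>t\<close> uses codeword \<open>t mod J\<close> of relay 1 and block \<open>t mod K\<close> of relay 2. As \<open>J\<close> and
  \<open>K\<close> are coprime, distinct pairs differ in the codeword or in the block, and both are nearly uniform on every set
  of consecutive \<open>t\<close>. The pairs are grouped into intervals of length \<open>L\<close>, the number of the interval being
  known to the decoder: a single group for the destination, one group per message for the eavesdropper.\<close>

lemma codebook_exists:
  fixes s s' :: real
  assumes n: "0 < n" and h: "0 < h" and s: "0 \<le> s" "s \<le> 1" "0 \<le> s'" "s' \<le> 1"
    and e: "0 < e" "e * modulus \<le> h" "e * swap.modulus \<le> h"
    and size: "0 < N" "0 < J" "0 < K" "coprime J K" "N \<le> J * K" "0 < L" "0 < L'"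
    and large: "real n \<ge> 2 * (2 * rvar\<^sup>2 + rvar * (p1 + e / (1 + \<bar>slope\<bar>)\<^sup>2)) / (e / (1 + \<bar>slope\<bar>)\<^sup>2)\<^sup>2"
    and rate: "failure_rate n e h S + collision_rate n h S J K s L + collision_rate n h S J K s' L' < \<delta>" "\<delta> \<le> 1"
  obtains x1 x2 :: "nat \<Rightarrow> nat \<Rightarrow> real" and a b d d' where
    "\<And>t. t < N \<Longrightarrow> a t < J" "\<And>t. t < N \<Longrightarrow> b t < K * S"
    "\<And>j. ip n (x1 j) (x1 j) \<le> real n * (p1 + e)" "\<And>j. ip n (x2 j) (x2 j) \<le> real n * (p2 + e)"
    "\<And>t. t < N \<Longrightarrow> ip n (\<lambda>i. x1 (a t) i + x2 (b t) i) (\<lambda>i. x1 (a t) i + x2 (b t) i) \<le> real n * (sump + 4 * e)"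
    "\<And>g. d g \<in> real_vectors n \<rightarrow>\<^sub>M count_space UNIV" "\<And>g. d' g \<in> real_vectors n \<rightarrow>\<^sub>M count_space UNIV"
    "(\<Sum>t<N. measure (gaussian_vector n 1) {u\<in>space (gaussian_vector n 1).
        d (t div L) (channel_out n s (x1 (a t)) (x2 (b t)) u) \<noteq> t}) \<le> real N * (\<delta> + not_decodable_const h / real n)"
    "(\<Sum>t<N. measure (gaussian_vector n 1) {u\<in>space (gaussian_vector n 1).
        d' (t div L') (channel_out n s' (x1 (a t)) (x2 (b t)) u) \<noteq> t}) \<le> real N * (\<delta> + not_decodable_const h / real n)"
proof -
  let ?Q1 = "gaussian_vector n p1" and ?Q2 = "gaussian_vector n p2" and ?N = "gaussian_vector n 1"
  let ?q = "exp (- (real n * (mi - h)))"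
  let ?A = "typical n e"
  define I1 I2 where "I1 = {..<J}" and "I2 = {..<K * S}"
  define aa bb where "aa t = t mod J" and "bb t = t mod K" for t :: nat
  interpret Q1: prob_space ?Q1 by (rule prob_space_gaussian_vector[OF p1])
  interpret N: prob_space ?N by (rule prob_space_gaussian_vector) simp
  interpret R: random_coding_channel ?Q1 ?Q2 ?A "ennreal ?q" I1 I2 "confusion n s h" "ennreal (exp (- (real n * (cap_cond s - h))))"
    "ennreal (exp (- (real n * (swap.cap_cond s - h))))" "ennreal (exp (- (real n * (cap12 s - h))))"
    by (rule random_coding_channel_gaussian) (use e in \<open>auto simp: I1_def I2_def\<close>)
  interpret R': random_coding_channel ?Q1 ?Q2 ?A "ennreal ?q" I1 I2 "confusion n s' h" "ennreal (exp (- (real n * (cap_cond s' - h))))"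
    "ennreal (exp (- (real n * (swap.cap_cond s' - h))))" "ennreal (exp (- (real n * (cap12 s' - h))))"
    by (rule random_coding_channel_gaussian) (use e in \<open>auto simp: I1_def I2_def\<close>)
  have aaI: "aa t \<in> I1" for t using size by (simp add: aa_def I1_def)
  have bbI: "R.block S (bb t) \<subseteq> I2" for t
  proof -
    have "Suc (bb t) * S \<le> K * S" using size by (intro mult_right_mono) (auto simp: bb_def Suc_le_eq)
    then show ?thesis by (auto simp: R.block_def I2_def)
  qed
  have bbI': "R'.block S (bb t) \<subseteq> I2" for t
    using bbI by (simp add: R.block_def R'.block_def)
  have inj: "aa t \<noteq> aa t' \<or> bb t \<noteq> bb t'" if "t \<in> {..<N}" "t' \<in> {..<N}" "t \<noteq> t'" for t t'
  proof (rule ccontr)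
    assume "\<not> ?thesis"
    then have "[t = t'] (mod J)" "[t = t'] (mod K)" by (auto simp: aa_def bb_def cong_def)
    then have "[t = t'] (mod (J * K))" using size(4) by (metis coprime_cong_mult_nat)
    then show False using that size(5) by (simp add: cong_def)
  qed
  \<comment> \<open>Encoding failures, and collisions at the two receivers. The mean of the total is
    below \<open>N * \<delta>\<close>, so a single codebook serves both receivers.\<close>
  define f1 :: "(nat \<Rightarrow> nat \<Rightarrow> real) \<Rightarrow> (nat \<Rightarrow> nat \<Rightarrow> real) \<Rightarrow> ennreal" where
    "f1 X Y = (\<Sum>t<N. if R.encoding_fails (R.block S (bb t)) X Y (aa t) then 1 else 0)" for X Y
  define f2 where "f2 X Y = (\<Sum>t<N. \<Sum>t'\<in>peers N L t. R.collisions S aa bb X Y t t')" for X Y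
  define f3 where "f3 X Y = (\<Sum>t<N. \<Sum>t'\<in>peers N L' t. R'.collisions S aa bb X Y t t')" for X Y
  have fm: "Measurable.pred (R.P1 \<Otimes>\<^sub>M R.P2) (\<lambda>z. R.encoding_fails (R.block S (bb t)) (fst z) (snd z) (aa t))" for t
    using aaI bbI by (intro R.encoding_fails_measurable) auto
  have m1: "(\<lambda>z. f1 (fst z) (snd z)) \<in> borel_measurable (R.P1 \<Otimes>\<^sub>M R.P2)"
    unfolding f1_def using fm by (intro borel_measurable_sum measurable_If) auto
  have m2: "(\<lambda>z. f2 (fst z) (snd z)) \<in> borel_measurable (R.P1 \<Otimes>\<^sub>M R.P2)"
    unfolding f2_def using aaI bbI by (intro borel_measurable_sum R.collisions_measurable) auto
  have m3: "(\<lambda>z. f3 (fst z) (snd z)) \<in> borel_measurable (R.P1 \<Otimes>\<^sub>M R.P2)"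
    unfolding f3_def using aaI bbI' by (intro borel_measurable_sum R'.collisions_measurable) auto
  have m12: "(\<lambda>z. f1 (fst z) (snd z) + f2 (fst z) (snd z)) \<in> borel_measurable (R.P1 \<Otimes>\<^sub>M R.P2)"
    using m1 m2 by measurable
  have b2: "(\<integral>\<^sup>+X. \<integral>\<^sup>+Y. f2 X Y \<partial>R.P2 \<partial>R.P1) \<le> ennreal (real N * collision_rate n h S J K s L)"
  proof -
    have "(\<integral>\<^sup>+X. \<integral>\<^sup>+Y. f2 X Y \<partial>R.P2 \<partial>R.P1) \<le> of_nat (card {..<N}) * (ennreal ?q * ennreal ?q *
      (ennreal (real (L - 1)) * of_nat (S * S) * ennreal (exp (- (real n * (cap12 s - h))))
      + ennreal (real (L - 1) / real J) * of_nat (S * S) * ennreal (exp (- (real n * (cap_cond s - h))))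
      + ennreal (real (L - 1) / real K) * of_nat S * ennreal (exp (- (real n * (swap.cap_cond s - h))))))"
      unfolding f2_def
    proof (rule R.group_collisions_expectation)
      show "of_nat (card (peers N L t)) \<le> ennreal (real (L - 1))" for t
        using card_peers[OF size(6), of N t] by (simp add: ennreal_of_nat_eq_real_of_nat)
      show "of_nat (card {t'\<in>peers N L t. aa t = aa t'}) \<le> ennreal (real (L - 1) / real J)" for t
        using card_peers_mod[OF size(6,2), of N t] by (simp add: ennreal_of_nat_eq_real_of_nat aa_def)
      show "of_nat (card {t'\<in>peers N L t. bb t = bb t'}) \<le> ennreal (real (L - 1) / real K)" for t
        using card_peers_mod[OF size(6,3), of N t] by (simp add: ennreal_of_nat_eq_real_of_nat bb_def)
    qed (use aaI bbI inj peers_subset in auto)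
    also have "\<dots> = ennreal (real N * collision_rate n h S J K s L)"
      by (simp add: collision_rate_def ennreal_of_nat_eq_real_of_nat ennreal_mult[symmetric] ennreal_plus[symmetric]
        power2_eq_square del: ennreal_plus)
    finally show ?thesis .
  qed
  have b3: "(\<integral>\<^sup>+X. \<integral>\<^sup>+Y. f3 X Y \<partial>R.P2 \<partial>R.P1) \<le> ennreal (real N * collision_rate n h S J K s' L')"
  proof -
    have "(\<integral>\<^sup>+X. \<integral>\<^sup>+Y. f3 X Y \<partial>R.P2 \<partial>R.P1) \<le> of_nat (card {..<N}) * (ennreal ?q * ennreal ?q *
      (ennreal (real (L' - 1)) * of_nat (S * S) * ennreal (exp (- (real n * (cap12 s' - h))))
      + ennreal (real (L' - 1) / real J) * of_nat (S * S) * ennreal (exp (- (real n * (cap_cond s' - h))))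
      + ennreal (real (L' - 1) / real K) * of_nat S * ennreal (exp (- (real n * (swap.cap_cond s' - h))))))"
      unfolding f3_def
    proof (rule R'.group_collisions_expectation)
      show "of_nat (card (peers N L' t)) \<le> ennreal (real (L' - 1))" for t
        using card_peers[OF size(7), of N t] by (simp add: ennreal_of_nat_eq_real_of_nat)
      show "of_nat (card {t'\<in>peers N L' t. aa t = aa t'}) \<le> ennreal (real (L' - 1) / real J)" for t
        using card_peers_mod[OF size(7,2), of N t] by (simp add: ennreal_of_nat_eq_real_of_nat aa_def)
      show "of_nat (card {t'\<in>peers N L' t. bb t = bb t'}) \<le> ennreal (real (L' - 1) / real K)" for t
        using card_peers_mod[OF size(7,3), of N t] by (simp add: ennreal_of_nat_eq_real_of_nat bb_def)
    qed (use aaI bbI' inj peers_subset in auto)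
    also have "\<dots> = ennreal (real N * collision_rate n h S J K s' L')"
      by (simp add: collision_rate_def ennreal_of_nat_eq_real_of_nat ennreal_mult[symmetric] ennreal_plus[symmetric]
        power2_eq_square del: ennreal_plus)
    finally show ?thesis .
  qed
  have b1: "(\<integral>\<^sup>+X. \<integral>\<^sup>+Y. f1 X Y \<partial>R.P2 \<partial>R.P1) \<le> ennreal (real N * failure_rate n e h S)"
  proof -
    define dd where "dd = e / (1 + \<bar>slope\<bar>)\<^sup>2"
    have "1 \<le> 1 + \<bar>slope\<bar>" by simp
    then have dd: "0 < dd" using e by (simp add: dd_def)
    define E where "E = {x\<in>space ?Q1. \<bar>ip n x x - real n * p1\<bar> \<le> real n * dd}"
    have E: "E \<in> sets ?Q1" unfolding E_def by measurable
    have E': "emeasure ?Q1 (space ?Q1 - E) \<le> ennreal (2 * p1\<^sup>2 / (real n * dd\<^sup>2))"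
      unfolding Q1.emeasure_eq_measure
    proof (rule ennreal_leI)
      let ?B = "{x\<in>space ?Q1. real n * dd \<le> \<bar>(\<Sum>i=1..n. (x i)\<^sup>2) - real n * p1\<bar>}"
      have "?B \<in> sets ?Q1" by measurable
      then have "Q1.prob (space ?Q1 - E) \<le> Q1.prob ?B"
        by (intro Q1.finite_measure_mono) (auto simp: E_def ip_def power2_eq_square)
      also have "\<dots> \<le> 2 * p1\<^sup>2 / (real n * dd\<^sup>2)"
        by (rule gaussian_vector_norm_deviation) (use p1 dd n in auto)
      finally show "Q1.prob (space ?Q1 - E) \<le> 2 * p1\<^sup>2 / (real n * dd\<^sup>2)" .
    qed
    have one: "(\<integral>\<^sup>+X. \<integral>\<^sup>+Y. (if R.encoding_fails (R.block S (bb t)) X Y (aa t) then 1 else 0) \<partial>R.P2 \<partial>R.P1)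
        \<le> ennreal (failure_rate n e h S)" for t
    proof -
      have "(\<integral>\<^sup>+X. \<integral>\<^sup>+Y. (if R.encoding_fails (R.block S (bb t)) X Y (aa t) then 1 else 0) \<partial>R.P2 \<partial>R.P1)
        \<le> ennreal (2 * p1\<^sup>2 / (real n * dd\<^sup>2) + exp (- (1/2 * exp (- (real n * (mi + h)))) * card (R.block S (bb t))))"
      proof (rule R.encoding_failure_expectation[OF aaI bbI E E'])
        show "1/2 * exp (- (real n * (mi + h))) \<le> measure ?Q2 {y\<in>space ?Q2. typical n e x y}" if "x \<in> E" for x
          using that large n e unfolding E_def dd_def by (intro typical_covering) auto
      qed auto
      then show ?thesis by (simp add: failure_rate_def dd_def)
    qed
    have mm: "(\<lambda>Y. (if R.encoding_fails (R.block S (bb t)) X Y (aa t) then 1 else 0 :: ennreal)) \<in> borel_measurable R.P2"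
      if "X \<in> space R.P1" for X t
      using that aaI bbI by (intro measurable_If R.encoding_fails_measurable[unfolded pred_def] measurable_const)
        (auto intro!: R.encoding_fails_measurable)
    have "(\<integral>\<^sup>+X. \<integral>\<^sup>+Y. f1 X Y \<partial>R.P2 \<partial>R.P1)
      = (\<integral>\<^sup>+X. (\<Sum>t<N. \<integral>\<^sup>+Y. (if R.encoding_fails (R.block S (bb t)) X Y (aa t) then 1 else 0) \<partial>R.P2) \<partial>R.P1)"
      unfolding f1_def by (intro nn_integral_cong nn_integral_sum mm)
    also have "\<dots> = (\<Sum>t<N. \<integral>\<^sup>+X. \<integral>\<^sup>+Y. (if R.encoding_fails (R.block S (bb t)) X Y (aa t) then 1 else 0) \<partial>R.P2 \<partial>R.P1)"
      using fm by (intro nn_integral_sum R.P2.borel_measurable_nn_integral) (simp add: split_beta')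
    also have "\<dots> \<le> (\<Sum>t<N. ennreal (failure_rate n e h S))"
      by (intro sum_mono one)
    also have "\<dots> = ennreal (real N * failure_rate n e h S)"
      by (simp add: ennreal_of_nat_eq_real_of_nat ennreal_mult')
    finally show ?thesis .
  qed
  have nn: "0 \<le> failure_rate n e h S" "0 \<le> collision_rate n h S J K s L" "0 \<le> collision_rate n h S J K s' L'"
    by (simp_all add: failure_rate_def collision_rate_def)
  have "(\<integral>\<^sup>+X. \<integral>\<^sup>+Y. f1 X Y + f2 X Y + f3 X Y \<partial>R.P2 \<partial>R.P1)
    = (\<integral>\<^sup>+X. \<integral>\<^sup>+Y. f1 X Y \<partial>R.P2 \<partial>R.P1) + (\<integral>\<^sup>+X. \<integral>\<^sup>+Y. f2 X Y \<partial>R.P2 \<partial>R.P1) + (\<integral>\<^sup>+X. \<integral>\<^sup>+Y. f3 X Y \<partial>R.P2 \<partial>R.P1)"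
    using nn_integral_iterated_add[OF R.P2.sigma_finite_measure_axioms m12 m3]
      nn_integral_iterated_add[OF R.P2.sigma_finite_measure_axioms m1 m2] by simp
  also have "\<dots> \<le> ennreal (real N * failure_rate n e h S) + ennreal (real N * collision_rate n h S J K s L)
      + ennreal (real N * collision_rate n h S J K s' L')"
    by (intro add_mono b1 b2 b3)
  also have "\<dots> = ennreal (real N * (failure_rate n e h S + collision_rate n h S J K s L + collision_rate n h S J K s' L'))"
    using nn by (simp add: ennreal_plus[symmetric] distrib_left del: ennreal_plus)
  also have "\<dots> < ennreal (real N * \<delta>)"
    using rate nn size by (intro ennreal_lessI) auto
  finally have "(\<integral>\<^sup>+X. \<integral>\<^sup>+Y. f1 X Y + f2 X Y + f3 X Y \<partial>R.P2 \<partial>R.P1) < ennreal (real N * \<delta>)" .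
  then obtain X where "X \<in> space R.P1" "(\<integral>\<^sup>+Y. f1 X Y + f2 X Y + f3 X Y \<partial>R.P2) < ennreal (real N * \<delta>)"
    using R.P1.nn_integral_less_imp_ex by blast
  moreover then obtain Y where "Y \<in> space R.P2" "f1 X Y + f2 X Y + f3 X Y < ennreal (real N * \<delta>)"
    using R.P2.nn_integral_less_imp_ex by blast
  ultimately have XY: "f1 X Y + f2 X Y + f3 X Y < ennreal (real N * \<delta>)" by simp
  define F where "F = {t. t < N \<and> R.encoding_fails (R.block S (bb t)) X Y (aa t)}"
  have f1F: "f1 X Y = of_nat (card F)"
    by (simp add: f1_def F_def sum.If_cases) (simp add: Int_def conj_commute)
  \<comment> \<open>As \<open>\<delta> \<le> 1\<close>, fewer than \<open>N\<close> selections fail,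
    which leaves at least one typical pair as a substitute for the failed ones.\<close>
  have "f1 X Y < ennreal (real N)"
  proof -
    have "f1 X Y \<le> f1 X Y + f2 X Y + f3 X Y" by (simp add: add_increasing2)
    also have "\<dots> < ennreal (real N * \<delta>)" by fact
    also have "\<dots> \<le> ennreal (real N)" using rate(2) by (intro ennreal_leI) (simp add: mult_left_le)
    finally show ?thesis .
  qed
  then have "card F < N" by (simp add: f1F ennreal_of_nat_eq_real_of_nat ennreal_less_iff)
  have "\<exists>t0<N. t0 \<notin> F"
  proof (rule ccontr)
    assume "\<not> ?thesis"
    then have "{..<N} \<subseteq> F" by auto
    then have "card {..<N} \<le> card F" by (intro card_mono) (auto simp: F_def)
    then show False using \<open>card F < N\<close> by simp
  qed
  then obtain t0 where t0: "t0 < N" "t0 \<notin> F" by blast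
  have "\<exists>b. b \<in> R.block S (bb t) \<and> ?A (X (aa t)) (Y b)" if "t < N" "t \<notin> F" for t
    using that by (auto simp: F_def R.encoding_fails_def)
  then obtain sel where sel: "\<And>t. t < N \<Longrightarrow> t \<notin> F \<Longrightarrow> sel t \<in> R.block S (bb t) \<and> ?A (X (aa t)) (Y (sel t))"
    by metis
  \<comment> \<open>A failed pair borrows the codewords of \<open>t0\<close>. It is counted as a
    decoding error anyway, but its input must still obey the power bound on the sum, which the
    leakage estimate asks of every pair.\<close>
  define rep where "rep t = (if t < N \<and> t \<notin> F then t else t0)" for t
  have rep: "rep t < N" "rep t \<notin> F" for t using t0 by (auto simp: rep_def)
  define a where "a t = aa (rep t)" for t
  define b where "b t = sel (rep t)" for t
  \<comment> \<open>Codewords of atypical norm become zero, so that the power constraint holds at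
    every index of the codebook and not only at the selected ones.\<close>
  define x1 where "x1 j = (if \<bar>ip n (X j) (X j) - real n * p1\<bar> \<le> real n * e then X j else (\<lambda>_. 0))" for j
  define x2 where "x2 j = (if \<bar>ip n (Y j) (Y j) - real n * p2\<bar> \<le> real n * e then Y j else (\<lambda>_. 0))" for j
  have typi: "?A (X (a t)) (Y (b t))" for t using sel[OF rep] by (simp add: a_def b_def)
  have x12: "x1 (a t) = X (a t)" "x2 (b t) = Y (b t)" for t
    using typi[of t] by (simp_all add: x1_def x2_def typical_def)
  \<comment> \<open>Stated for an arbitrary gain, group length and collision bound
    \<open>col\<close>, to serve both receivers. Failed pairs count as one error each, which
    \<open>f1\<close> pays for.\<close>
  have tot: "(\<Sum>t<N. measure ?N {u\<in>space ?N. d (t div L) (channel_out n s (x1 (a t)) (x2 (b t)) u) \<noteq> t})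
      \<le> real N * (\<delta> + not_decodable_const h / real n)"
    if d: "\<And>g. d g \<in> real_vectors n \<rightarrow>\<^sub>M count_space UNIV" "\<And>t. t < N \<Longrightarrow> t \<notin> F \<Longrightarrow>
      emeasure ?N {u\<in>space ?N. d (t div L) (channel_out n s (X (a t)) (Y (b t)) u) \<noteq> t}
      \<le> ennreal (not_decodable_const h / real n) + (\<Sum>t'\<in>peers N L t - F. confusion n s h (X (a t)) (Y (b t)) (X (a t')) (Y (b t')))"
      and col: "\<And>t t'. t < N \<Longrightarrow> t \<notin> F \<Longrightarrow> t' < N \<Longrightarrow> t' \<notin> F \<Longrightarrow>
        confusion n s h (X (a t)) (Y (b t)) (X (a t')) (Y (b t')) \<le> col t t'"
      and le: "f1 X Y + (\<Sum>t<N. \<Sum>t'\<in>peers N L t. col t t') \<le> ennreal (real N * \<delta>)"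
    for d :: "nat \<Rightarrow> (nat \<Rightarrow> real) \<Rightarrow> nat" and L :: nat and s :: real and col
  proof -
    have c0: "0 \<le> not_decodable_const h"
      using sump_pos rvar_pos swap.rvar_pos h by (simp add: not_decodable_const_def)
    have d0: "0 \<le> \<delta>" using nn rate by linarith
    have "ennreal (\<Sum>t<N. measure ?N {u\<in>space ?N. d (t div L) (channel_out n s (x1 (a t)) (x2 (b t)) u) \<noteq> t})
      = (\<Sum>t<N. emeasure ?N {u\<in>space ?N. d (t div L) (channel_out n s (x1 (a t)) (x2 (b t)) u) \<noteq> t})"
      by (simp add: N.emeasure_eq_measure)
    also have "\<dots> \<le> (\<Sum>t<N. (if t \<in> F then 1 else 0) + (ennreal (not_decodable_const h / real n) + (\<Sum>t'\<in>peers N L t. col t t')))"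
    proof (intro sum_mono)
      fix t assume t: "t \<in> {..<N}"
      show "emeasure ?N {u\<in>space ?N. d (t div L) (channel_out n s (x1 (a t)) (x2 (b t)) u) \<noteq> t}
        \<le> (if t \<in> F then 1 else 0) + (ennreal (not_decodable_const h / real n) + (\<Sum>t'\<in>peers N L t. col t t'))"
      proof (cases "t \<in> F")
        case True
        have "emeasure ?N {u\<in>space ?N. d (t div L) (channel_out n s (x1 (a t)) (x2 (b t)) u) \<noteq> t} \<le> 1"
          by (rule N.measure_le_1)
        then show ?thesis using True by (simp add: add_increasing2)
      next
        case False
        have "(\<Sum>t'\<in>peers N L t - F. confusion n s h (X (a t)) (Y (b t)) (X (a t')) (Y (b t')))
          \<le> (\<Sum>t'\<in>peers N L t - F. col t t')"
          using t False by (intro sum_mono col) (auto simp: peers_def)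
        also have "\<dots> \<le> (\<Sum>t'\<in>peers N L t. col t t')"
          by (intro sum_mono2) auto
        finally show ?thesis
          using False t d(2)[of t] unfolding x12
          by (auto intro: order_trans add_left_mono)
      qed
    qed
    also have "\<dots> = f1 X Y + (\<Sum>t<N. \<Sum>t'\<in>peers N L t. col t t') + of_nat N * ennreal (not_decodable_const h / real n)"
    proof -
      have "{..<N} \<inter> F = F" by (auto simp: F_def)
      then show ?thesis
        by (simp add: sum.distrib f1F sum.If_cases add_ac)
    qed
    also have "\<dots> \<le> ennreal (real N * \<delta>) + of_nat N * ennreal (not_decodable_const h / real n)"
      by (intro add_right_mono le)
    also have "\<dots> = ennreal (real N * (\<delta> + not_decodable_const h / real n))"
      using d0 c0 by (simp add: ennreal_of_nat_eq_real_of_nat ennreal_mult[symmetric] ennreal_plus[symmetric] distrib_left del: ennreal_plus)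
    finally show ?thesis
      using d0 c0 by (subst (asm) ennreal_le_iff) auto
  qed
  have ab: "a t = aa t" "b t = sel t" if "t < N" "t \<notin> F" for t using that by (simp_all add: a_def b_def rep_def)
  have col: "confusion n s h (X (a t)) (Y (b t)) (X (a t')) (Y (b t')) \<le> R.collisions S aa bb X Y t t'"
    if t: "t < N" "t \<notin> F" "t' < N" "t' \<notin> F" for t t'
  proof -
    have "confusion n s h (X (a t)) (Y (b t)) (X (a t')) (Y (b t')) = R.collision X Y (aa t) (sel t) (aa t') (sel t')"
      using sel[OF t(1,2)] sel[OF t(3,4)] t by (simp add: R.collision_def R.A_def ab)
    also have "\<dots> \<le> (\<Sum>b'\<in>R.block S (bb t'). R.collision X Y (aa t) (sel t) (aa t') b')"
      using sel[OF t(3,4)] by (intro member_le_sum) auto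
    also have "\<dots> \<le> R.collisions S aa bb X Y t t'"
      unfolding R.collisions_def using sel[OF t(1,2)]
      by (intro member_le_sum[where f="\<lambda>b. \<Sum>b'\<in>R.block S (bb t'). R.collision X Y (aa t) b (aa t') b'"]) auto
    finally show ?thesis .
  qed
  have col': "confusion n s' h (X (a t)) (Y (b t)) (X (a t')) (Y (b t')) \<le> R'.collisions S aa bb X Y t t'"
    if t: "t < N" "t \<notin> F" "t' < N" "t' \<notin> F" for t t'
  proof -
    have "confusion n s' h (X (a t)) (Y (b t)) (X (a t')) (Y (b t')) = R'.collision X Y (aa t) (sel t) (aa t') (sel t')"
      using sel[OF t(1,2)] sel[OF t(3,4)] t by (simp add: R'.collision_def R.A_def ab)
    also have "\<dots> \<le> (\<Sum>b'\<in>R.block S (bb t'). R'.collision X Y (aa t) (sel t) (aa t') b')"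
      using sel[OF t(3,4)] by (intro member_le_sum) auto
    also have "\<dots> \<le> R'.collisions S aa bb X Y t t'"
      unfolding R'.collisions_def using sel[OF t(1,2)]
      by (intro member_le_sum[where f="\<lambda>b. \<Sum>b'\<in>R'.block S (bb t'). R'.collision X Y (aa t) b (aa t') b'"])
        (auto simp: R.block_def R'.block_def)
    finally show ?thesis .
  qed
  have T: "typical n e (X (a t)) (Y (b t))" for t by (rule typi)
  obtain d where d: "\<And>g. d g \<in> real_vectors n \<rightarrow>\<^sub>M count_space UNIV" "\<And>t. t < N \<Longrightarrow> t \<notin> F \<Longrightarrow>
      emeasure ?N {u\<in>space ?N. d (t div L) (channel_out n s (X (a t)) (Y (b t)) u) \<noteq> t}
      \<le> ennreal (not_decodable_const h / real n) + (\<Sum>t'\<in>peers N L t - F. confusion n s h (X (a t)) (Y (b t)) (X (a t')) (Y (b t')))"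
    using decoder_exists[OF n h s(1,2) e, where N=N and F=F and L=L and cx="\<lambda>t. X (a t)" and cy="\<lambda>t. Y (b t)"] T by blast
  obtain d' where d': "\<And>g. d' g \<in> real_vectors n \<rightarrow>\<^sub>M count_space UNIV" "\<And>t. t < N \<Longrightarrow> t \<notin> F \<Longrightarrow>
      emeasure ?N {u\<in>space ?N. d' (t div L') (channel_out n s' (X (a t)) (Y (b t)) u) \<noteq> t}
      \<le> ennreal (not_decodable_const h / real n) + (\<Sum>t'\<in>peers N L' t - F. confusion n s' h (X (a t)) (Y (b t)) (X (a t')) (Y (b t')))"
    using decoder_exists[OF n h s(3,4) e, where N=N and F=F and L=L' and cx="\<lambda>t. X (a t)" and cy="\<lambda>t. Y (b t)"] T by blast
  show thesis
  proof (rule that)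
    show "a t < J" for t using aaI by (simp add: a_def I1_def)
    show "b t < K * S" for t using sel[OF rep, of t] bbI by (auto simp: b_def I2_def)
    show "ip n (x1 j) (x1 j) \<le> real n * (p1 + e)" for j
    proof (cases "\<bar>ip n (X j) (X j) - real n * p1\<bar> \<le> real n * e")
      case True
      then have "ip n (X j) (X j) \<le> real n * p1 + real n * e" by linarith
      then show ?thesis using True by (simp add: x1_def distrib_left)
    next
      case False
      then show ?thesis using p1 e by (simp add: x1_def ip_def)
    qed
    show "ip n (x2 j) (x2 j) \<le> real n * (p2 + e)" for j
    proof (cases "\<bar>ip n (Y j) (Y j) - real n * p2\<bar> \<le> real n * e")
      case True
      then have "ip n (Y j) (Y j) \<le> real n * p2 + real n * e" by linarith
      then show ?thesis using True by (simp add: x2_def distrib_left)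
    next
      case False
      then show ?thesis using p2 e by (simp add: x2_def ip_def)
    qed
    show "ip n (\<lambda>i. x1 (a t) i + x2 (b t) i) (\<lambda>i. x1 (a t) i + x2 (b t) i) \<le> real n * (sump + 4 * e)" for t
      using typical_sum(1)[OF typi[of t] e(2,1)] unfolding x12 distrib_left by linarith
    show "d g \<in> real_vectors n \<rightarrow>\<^sub>M count_space UNIV" "d' g \<in> real_vectors n \<rightarrow>\<^sub>M count_space UNIV" for g
      by (fact d(1) d'(1))+
    show "(\<Sum>t<N. measure ?N {u\<in>space ?N. d (t div L) (channel_out n s (x1 (a t)) (x2 (b t)) u) \<noteq> t})
      \<le> real N * (\<delta> + not_decodable_const h / real n)"
      by (rule tot[OF d col]) (use XY in \<open>auto simp: f2_def[symmetric] intro: order_trans[OF _ less_imp_le[OF XY]] add_increasing2\<close>)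
    show "(\<Sum>t<N. measure ?N {u\<in>space ?N. d' (t div L') (channel_out n s' (x1 (a t)) (x2 (b t)) u) \<noteq> t})
      \<le> real N * (\<delta> + not_decodable_const h / real n)"
    proof (rule tot[OF d' col'])
      have "f1 X Y + f3 X Y \<le> f1 X Y + f2 X Y + f3 X Y" by (intro add_right_mono) (simp add: add_increasing2)
      then show "f1 X Y + (\<Sum>t<N. \<Sum>t'\<in>peers N L' t. R'.collisions S aa bb X Y t t') \<le> ennreal (real N * \<delta>)"
        unfolding f3_def[symmetric] by (rule order_trans[OF _ less_imp_le[OF XY]])
    qed
  qed
qed

end

section \<open>Rates of Gaussian codebooks\<close>

lemma ex_power_between:
  fixes x :: real
  assumes "2 \<le> (b::nat)" "1 \<le> x"
  shows "\<exists>k. real (b ^ k) \<le> x \<and> x < real b * real (b ^ k)"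
proof -
  have "1 \<le> nat \<lfloor>x\<rfloor>" using assms by linarith
  then obtain k where k: "b ^ k \<le> nat \<lfloor>x\<rfloor>" "nat \<lfloor>x\<rfloor> < b ^ (k + 1)"
    using ex_power_ivl1[OF assms(1)] by blast
  have "real (b ^ k) \<le> real (nat \<lfloor>x\<rfloor>)" using k(1) by (simp only: of_nat_le_iff)
  also have "\<dots> \<le> x" using assms by linarith
  finally have 1: "real (b ^ k) \<le> x" .
  have "nat \<lfloor>x\<rfloor> + 1 \<le> b ^ (k + 1)" using k(2) by simp
  then have "real (nat \<lfloor>x\<rfloor> + 1) \<le> real (b ^ (k + 1))" by (simp only: of_nat_le_iff)
  moreover have "x < real (nat \<lfloor>x\<rfloor> + 1)" using assms by linarith
  ultimately have "x < real b * real (b ^ k)" by (simp add: power_add mult.commute)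
  with 1 show ?thesis by blast
qed

context gaussian_pair
begin

text \<open>The three packing conditions at gain \<open>s\<close>, with a common margin
  \<open>m\<close> and rates in nats.\<close>

definition rate_ok :: "real \<Rightarrow> real \<Rightarrow> real \<Rightarrow> real \<Rightarrow> real \<Rightarrow> bool" where
  "rate_ok c1 c2 s m r \<longleftrightarrow> r + m \<le> cap12 s \<and> r + m \<le> c1 + cap_cond s \<and> r + m \<le> c2 + swap.cap_cond s"

text \<open>In the exponent the squared acceptance probability loses \<open>2 * h\<close>, the
  squared block size \<open>4 * h\<close> and the test \<open>h\<close>, together
  \<open>7 * h\<close>, so a margin of \<open>8 * h\<close> leaves \<open>exp (- n * h)\<close>. The
  factors 4, 8 and 12 come from rounding \<open>S\<close>, \<open>J\<close> and \<open>K\<close>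
  within factors 2, 2 and 3. In the third term \<open>1 / K\<close> becomes
  \<open>3 * S * exp (- n * c2)\<close>, since the \<open>K\<close> blocks of size \<open>S\<close>
  together make up the codebook of relay 2.\<close>

lemma collision_rate_le:
  assumes h: "0 < h" and S: "real S \<le> 2 * exp (real n * (mi + 2 * h))"
    and J: "exp (real n * c1) < 2 * real J" and K: "exp (real n * c2) < 3 * real S * real K"
    and L: "0 < L" "L = 1 \<or> real L \<le> exp (real n * r) \<and> rate_ok c1 c2 s (8 * h) r"
  shows "collision_rate n h S J K s L \<le> 24 * exp (- (real n * h))"
proof (cases "L = 1")
  case True
  then show ?thesis by (simp add: collision_rate_def)
next
  case False
  then have L': "real L \<le> exp (real n * r)" and r: "rate_ok c1 c2 s (8 * h) r" using L by auto
  have l: "real (L - 1) \<le> exp (real n * r)" using L' by linarith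
  have S2: "(real S)\<^sup>2 \<le> (2 * exp (real n * (mi + 2 * h)))\<^sup>2" using S by (intro power_mono) auto
  have Jp: "0 < real J" using less_trans[OF exp_gt_zero J] by simp
  have Kp: "0 < real K" "0 < real S"
  proof -
    have "0 < 3 * real S * real K" using K by (rule less_trans[OF exp_gt_zero])
    then show "0 < real K" "0 < real S" by (auto simp: zero_less_mult_iff)
  qed
  have J': "1 / real J \<le> 2 * exp (- (real n * c1))"
    using J Jp by (simp add: exp_minus field_simps)
  have K': "1 / real K \<le> 3 * real S * exp (- (real n * c2))"
    using K Kp by (simp add: exp_minus field_simps)
  let ?q = "exp (- (real n * (mi - h)))"
  have margin: "exp (real n * x) \<le> exp (- (real n * h))" if "x \<le> - h" for x
    using that h mult_left_mono[of x "- h" "real n"] by simp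
  have "?q\<^sup>2 * (real (L - 1) * (real S)\<^sup>2 * exp (- (real n * (cap12 s - h))))
    \<le> ?q\<^sup>2 * (exp (real n * r) * (2 * exp (real n * (mi + 2 * h)))\<^sup>2 * exp (- (real n * (cap12 s - h))))"
    using l S2 by (intro mult_left_mono mult_right_mono mult_mono) auto
  also have "\<dots> = 4 * exp (real n * (r + 7 * h - cap12 s))"
    by (simp add: power2_eq_square mult_exp_exp algebra_simps)
  also have "\<dots> \<le> 4 * exp (- (real n * h))"
    using r by (intro mult_left_mono margin) (auto simp: rate_ok_def)
  finally have 1: "?q\<^sup>2 * (real (L - 1) * (real S)\<^sup>2 * exp (- (real n * (cap12 s - h)))) \<le> 4 * exp (- (real n * h))" .
  have "?q\<^sup>2 * (real (L - 1) / real J * (real S)\<^sup>2 * exp (- (real n * (cap_cond s - h))))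
    = ?q\<^sup>2 * (real (L - 1) * (1 / real J) * (real S)\<^sup>2 * exp (- (real n * (cap_cond s - h))))" by simp
  also have "\<dots> \<le> ?q\<^sup>2 * (exp (real n * r) * (2 * exp (- (real n * c1))) * (2 * exp (real n * (mi + 2 * h)))\<^sup>2 * exp (- (real n * (cap_cond s - h))))"
    using l S2 J' by (intro mult_left_mono mult_right_mono mult_mono) auto
  also have "\<dots> = 8 * exp (real n * (r + 7 * h - (c1 + cap_cond s)))"
    by (simp add: power2_eq_square mult_exp_exp algebra_simps)
  also have "\<dots> \<le> 8 * exp (- (real n * h))"
    using r by (intro mult_left_mono margin) (auto simp: rate_ok_def)
  finally have 2: "?q\<^sup>2 * (real (L - 1) / real J * (real S)\<^sup>2 * exp (- (real n * (cap_cond s - h)))) \<le> 8 * exp (- (real n * h))" .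
  have "?q\<^sup>2 * (real (L - 1) / real K * real S * exp (- (real n * (swap.cap_cond s - h))))
    = ?q\<^sup>2 * (real (L - 1) * (1 / real K * real S) * exp (- (real n * (swap.cap_cond s - h))))" by simp
  also have "\<dots> \<le> ?q\<^sup>2 * (exp (real n * r) * ((3 * real S * exp (- (real n * c2))) * real S) * exp (- (real n * (swap.cap_cond s - h))))"
    using l K' by (intro mult_left_mono mult_right_mono mult_mono) auto
  also have "\<dots> = ?q\<^sup>2 * (exp (real n * r) * (3 * exp (- (real n * c2)) * (real S)\<^sup>2) * exp (- (real n * (swap.cap_cond s - h))))"
    by (simp add: power2_eq_square)
  also have "\<dots> \<le> ?q\<^sup>2 * (exp (real n * r) * (3 * exp (- (real n * c2)) * (2 * exp (real n * (mi + 2 * h)))\<^sup>2) * exp (- (real n * (swap.cap_cond s - h))))"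
    using S2 by (intro mult_left_mono mult_right_mono) auto
  also have "\<dots> = 12 * exp (real n * (r + 7 * h - (c2 + swap.cap_cond s)))"
    by (simp add: power2_eq_square mult_exp_exp algebra_simps)
  also have "\<dots> \<le> 12 * exp (- (real n * h))"
    using r by (intro mult_left_mono margin) (auto simp: rate_ok_def)
  finally have 3: "?q\<^sup>2 * (real (L - 1) / real K * real S * exp (- (real n * (swap.cap_cond s - h)))) \<le> 12 * exp (- (real n * h))" .
  show ?thesis
    unfolding collision_rate_def using 1 2 3 by (simp add: distrib_left)
qed

text \<open>The errors are averaged over all pairs, failed selections included. \<open>d\<close>
  works on groups of length \<open>L\<close> at gain \<open>s\<close>, \<open>d'\<close> on groups
  of length \<open>L'\<close> at gain \<open>s'\<close>.\<close>

definition good_codebook :: "nat \<Rightarrow> nat \<Rightarrow> real \<Rightarrow> real \<Rightarrow> real \<Rightarrow> nat \<Rightarrow> nat \<Rightarrow> real \<Rightarrow> real \<Rightarrow> nat \<Rightarrow> nat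
    \<Rightarrow> (nat \<Rightarrow> nat \<Rightarrow> real) \<Rightarrow> (nat \<Rightarrow> nat \<Rightarrow> real) \<Rightarrow> (nat \<Rightarrow> nat) \<Rightarrow> (nat \<Rightarrow> nat)
    \<Rightarrow> (nat \<Rightarrow> (nat \<Rightarrow> real) \<Rightarrow> nat) \<Rightarrow> (nat \<Rightarrow> (nat \<Rightarrow> real) \<Rightarrow> nat) \<Rightarrow> bool" where
  "good_codebook n N c1 c2 \<epsilon> L L' s s' J1 J2 x1 x2 a b d d' \<longleftrightarrow>
    real J1 \<le> exp (real n * c1) \<and> real J2 \<le> exp (real n * c2) \<and>
    (\<forall>t<N. a t < J1 \<and> b t < J2) \<and>
    (\<forall>j. ip n (x1 j) (x1 j) \<le> real n * (p1 + \<epsilon>)) \<and> (\<forall>j. ip n (x2 j) (x2 j) \<le> real n * (p2 + \<epsilon>)) \<and>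
    (\<forall>t<N. ip n (\<lambda>i. x1 (a t) i + x2 (b t) i) (\<lambda>i. x1 (a t) i + x2 (b t) i) \<le> real n * (sump + \<epsilon>)) \<and>
    (\<forall>g. d g \<in> real_vectors n \<rightarrow>\<^sub>M count_space UNIV) \<and> (\<forall>g. d' g \<in> real_vectors n \<rightarrow>\<^sub>M count_space UNIV) \<and>
    (\<Sum>t<N. measure (gaussian_vector n 1) {u\<in>space (gaussian_vector n 1).
        d (t div L) (channel_out n s (x1 (a t)) (x2 (b t)) u) \<noteq> t}) \<le> real N * \<epsilon> \<and>
    (\<Sum>t<N. measure (gaussian_vector n 1) {u\<in>space (gaussian_vector n 1).
        d' (t div L') (channel_out n s' (x1 (a t)) (x2 (b t)) u) \<noteq> t}) \<le> real N * \<epsilon>"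

text \<open>The alternatives on \<open>L\<close> and \<open>L'\<close> admit a receiver with groups
  of one element, which has no competitors to exclude; this is how rate 0 of the randomness
  \<open>k\<close> is covered.\<close>

lemma good_codebook_eventually:
  fixes N L L' :: "nat \<Rightarrow> nat" and s s' :: real
  assumes c: "0 \<le> c1" "mi < c2" "r < c1 + c2 - mi"
    and N: "\<And>n. 0 < N n" "\<And>n. real (N n) \<le> exp (real n * r)"
    and s: "0 \<le> s" "s \<le> 1" "0 \<le> s'" "s' \<le> 1"
    and L: "\<And>n. 0 < L n" "(\<forall>n. L n = 1) \<or> (\<forall>n. real (L n) \<le> exp (real n * l)) \<and> (\<exists>m>0. rate_ok c1 c2 s m l)"
    and L': "\<And>n. 0 < L' n" "(\<forall>n. L' n = 1) \<or> (\<forall>n. real (L' n) \<le> exp (real n * l')) \<and> (\<exists>m>0. rate_ok c1 c2 s' m l')"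
    and eps: "0 < \<epsilon>"
  shows "\<forall>\<^sub>F n in sequentially. \<exists>J1 J2 x1 x2 a b d d'. good_codebook n (N n) c1 c2 \<epsilon> (L n) (L' n) s s' J1 J2 x1 x2 a b d d'"
proof -
  obtain m where m: "0 < m" "(\<forall>n. L n = 1) \<or> (\<forall>n. real (L n) \<le> exp (real n * l)) \<and> rate_ok c1 c2 s m l"
    using L(2) by (metis zero_less_one)
  obtain m' where m': "0 < m'" "(\<forall>n. L' n = 1) \<or> (\<forall>n. real (L' n) \<le> exp (real n * l')) \<and> rate_ok c1 c2 s' m' l'"
    using L'(2) by (metis zero_less_one)
  \<comment> \<open>An eighth of every slack: the collision exponents consume \<open>7 * h\<close>,
    and \<open>h\<close> remains.\<close>
  define h where "h = min (min m m') (min (c2 - mi) (c1 + c2 - mi - r)) / 8"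
  have h: "0 < h" "8 * h \<le> m" "8 * h \<le> m'" "8 * h \<le> c2 - mi" "8 * h \<le> c1 + c2 - mi - r"
    using m(1) m'(1) c by (auto simp: h_def)
  have mL: "L n = 1 \<or> real (L n) \<le> exp (real n * l) \<and> rate_ok c1 c2 s (8 * h) l" for n
    using m h by (auto simp: rate_ok_def)
  have mL': "L' n = 1 \<or> real (L' n) \<le> exp (real n * l') \<and> rate_ok c1 c2 s' (8 * h) l'" for n
    using m' h by (auto simp: rate_ok_def)
  \<comment> \<open>Fine enough that exponents move by at most \<open>h\<close> in both regression
    directions, and that the powers exceed their targets by at most \<open>\<epsilon>\<close>; the
    tolerance for the sum is \<open>4 * e\<close>.\<close>
  define e where "e = min (\<epsilon> / 4) (min (h / modulus) (h / swap.modulus))"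
  note mod_pos = modulus_nonneg swap.modulus_nonneg
  have e: "0 < e" "e * modulus \<le> h" "e * swap.modulus \<le> h" "4 * e \<le> \<epsilon>"
  proof -
    have "e \<le> h / modulus" "e \<le> h / swap.modulus" by (auto simp: e_def)
    then show "e * modulus \<le> h" "e * swap.modulus \<le> h" using mod_pos by (simp_all add: pos_le_divide_eq)
    show "0 < e" using eps h mod_pos by (auto simp: e_def)
    show "4 * e \<le> \<epsilon>" by (auto simp: e_def)
  qed
  define \<delta> where "\<delta> = min (\<epsilon> / 2) 1"
  have \<delta>: "0 < \<delta>" "\<delta> \<le> 1" "\<delta> \<le> \<epsilon> / 2" using eps by (auto simp: \<delta>_def)
  define dd where "dd = e / (1 + \<bar>slope\<bar>)\<^sup>2"
  have dd: "0 < dd" using e by (simp add: dd_def add_pos_nonneg)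
  have ev1: "\<forall>\<^sub>F n in sequentially. 12 \<le> exp (real n * h)"
    using h(1) by real_asymp
  have ev2: "\<forall>\<^sub>F n in sequentially. C \<le> real n" for C by real_asymp
  have ev3: "\<forall>\<^sub>F n in sequentially. C / real n < \<delta> / 4" for C
  proof -
    have "(\<lambda>n. C / real n) \<longlonglongrightarrow> 0" by real_asymp
    then show ?thesis using \<delta>(1) by (intro order_tendstoD(2)[of _ 0]) auto
  qed
  have ev4: "\<forall>\<^sub>F n in sequentially. 24 * exp (- (real n * h)) < \<delta> / 4"
  proof -
    have "(\<lambda>n. 24 * exp (- (real n * h))) \<longlonglongrightarrow> 0" using h(1) by real_asymp
    then show ?thesis using \<delta>(1) by (intro order_tendstoD(2)[of _ 0]) auto
  qed
  have ev5: "\<forall>\<^sub>F n in sequentially. exp (- (1/2 * exp (real n * h))) < \<delta> / 4"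
  proof -
    have "(\<lambda>n. exp (- (1/2 * exp (real n * h)))) \<longlonglongrightarrow> 0" using h(1) by real_asymp
    then show ?thesis using \<delta>(1) by (intro order_tendstoD(2)[of _ 0]) auto
  qed
  show ?thesis
    using ev1 ev2[of 1] ev2[of "2 * (2 * rvar\<^sup>2 + rvar * (p1 + dd)) / dd\<^sup>2"] ev3[of "2 * p1\<^sup>2 / dd\<^sup>2"]
      ev3[of "not_decodable_const h"] ev4 ev5
  proof eventually_elim
    case (elim n)
    have n: "0 < n" using elim(2) by (cases n) auto
    \<comment> \<open>A candidate is accepted with probability at least
      \<open>exp (- n * (mi + h)) / 2\<close>, so \<open>exp (n * (mi + 2 * h))\<close> candidates
      all fail with probability at most \<open>exp (- exp (n * h) / 2)\<close>.\<close>
    define S where "S = nat \<lceil>exp (real n * (mi + 2 * h))\<rceil>"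
    have ge1: "1 \<le> exp (real n * (mi + 2 * h))" using mi_nonneg h by simp
    have S: "exp (real n * (mi + 2 * h)) \<le> real S" "real S \<le> 2 * exp (real n * (mi + 2 * h))"
      unfolding S_def using ge1 by linarith+
    then have S0: "0 < S" using ge1 by (cases S) auto
    obtain i where J: "real (2 ^ i) \<le> exp (real n * c1)" "exp (real n * c1) < real 2 * real (2 ^ i)"
      using ex_power_between[of 2 "exp (real n * c1)"] c by auto
    have "2 * exp (real n * (mi + 2 * h)) \<le> exp (real n * h) * exp (real n * (mi + 2 * h))"
      using elim(1) by (intro mult_right_mono) auto
    also have "\<dots> = exp (real n * (mi + 3 * h))" by (simp add: mult_exp_exp algebra_simps)
    also have "\<dots> \<le> exp (real n * c2)" using h by (simp add: mult_left_mono)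
    finally have "real S \<le> exp (real n * c2)" using S by linarith
    then have "1 \<le> exp (real n * c2) / real S" using S0 by (simp add: pos_le_divide_eq)
    then obtain k where K: "real (3 ^ k) \<le> exp (real n * c2) / real S" "exp (real n * c2) / real S < real 3 * real (3 ^ k)"
      using ex_power_between[of 3 "exp (real n * c2) / real S"] by auto
    have K1: "real (3 ^ k * S) \<le> exp (real n * c2)" using K(1) S0 by (simp add: pos_le_divide_eq)
    have K2: "exp (real n * c2) < 3 * real S * real (3 ^ k)" using K(2) S0 by (simp add: pos_divide_less_eq mult_ac)
    \<comment> \<open>The constant 12 is the product of the rounding losses 2, 3 and 2 of
      \<open>J\<close>, \<open>K\<close> and \<open>S\<close>; \<open>exp (n * h)\<close> absorbs
      it.\<close>
    have size: "N n \<le> 2 ^ i * 3 ^ k"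
    proof -
      have "exp (real n * (c1 + c2)) = exp (real n * c1) * exp (real n * c2)"
        by (simp add: mult_exp_exp algebra_simps)
      also have "\<dots> \<le> (real 2 * real (2 ^ i)) * (3 * real S * real (3 ^ k))"
        using J(2) K2 by (intro mult_mono) auto
      also have "\<dots> = real S * (6 * real (2 ^ i * 3 ^ k))" by simp
      also have "\<dots> \<le> (2 * exp (real n * (mi + 2 * h))) * (6 * real (2 ^ i * 3 ^ k))"
        using S by (intro mult_right_mono) auto
      also have "\<dots> = exp (real n * (mi + 2 * h)) * (12 * real (2 ^ i * 3 ^ k))" by simp
      finally have "exp (real n * (c1 + c2)) * exp (- (real n * (mi + 2 * h)))
          \<le> exp (real n * (mi + 2 * h)) * (12 * real (2 ^ i * 3 ^ k)) * exp (- (real n * (mi + 2 * h)))"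
        by (intro mult_right_mono) auto
      also have "\<dots> = 12 * real (2 ^ i * 3 ^ k)" by (simp add: exp_minus)
      finally have "exp (real n * (c1 + c2)) * exp (- (real n * (mi + 2 * h))) \<le> 12 * real (2 ^ i * 3 ^ k)" .
      moreover have "12 * exp (real n * r) \<le> exp (real n * (c1 + c2)) * exp (- (real n * (mi + 2 * h)))"
      proof -
        have "12 * exp (real n * r) \<le> exp (real n * h) * exp (real n * r)" using elim(1) by (intro mult_right_mono) auto
        also have "\<dots> = exp (real n * (h + r))" by (simp add: mult_exp_exp algebra_simps)
        also have "\<dots> \<le> exp (real n * (c1 + c2 - mi - 2 * h))" using h by (simp add: mult_left_mono)
        also have "\<dots> = exp (real n * (c1 + c2)) * exp (- (real n * (mi + 2 * h)))" by (simp add: mult_exp_exp algebra_simps)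
        finally show ?thesis .
      qed
      ultimately have "real (N n) \<le> real (2 ^ i * 3 ^ k)" using N(2)[of n] by linarith
      then show ?thesis by (simp only: of_nat_le_iff)
    qed
    have fr: "failure_rate n e h S < \<delta> / 2"
    proof -
      have "exp (real n * h) = exp (- (real n * (mi + h))) * exp (real n * (mi + 2 * h))"
        by (simp add: mult_exp_exp algebra_simps)
      also have "\<dots> \<le> exp (- (real n * (mi + h))) * real S" using S by (intro mult_left_mono) auto
      finally have "exp (- (1/2 * exp (- (real n * (mi + h)))) * real S) \<le> exp (- (1/2 * exp (real n * h)))"
        by simp
      moreover have "2 * p1\<^sup>2 / (real n * dd\<^sup>2) = 2 * p1\<^sup>2 / dd\<^sup>2 / real n" by (simp add: mult.commute)
      ultimately show ?thesis using elim(4,7) unfolding failure_rate_def dd_def[symmetric] by linarith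
    qed
    have c1: "collision_rate n h S (2 ^ i) (3 ^ k) s (L n) \<le> 24 * exp (- (real n * h))"
      by (rule collision_rate_le[OF h(1) S(2) _ K2 L(1) mL]) (use J in simp)
    have c2: "collision_rate n h S (2 ^ i) (3 ^ k) s' (L' n) \<le> 24 * exp (- (real n * h))"
      by (rule collision_rate_le[OF h(1) S(2) _ K2 L'(1) mL']) (use J in simp)
    have rate: "failure_rate n e h S + collision_rate n h S (2 ^ i) (3 ^ k) s (L n) + collision_rate n h S (2 ^ i) (3 ^ k) s' (L' n) < \<delta>"
      using fr c1 c2 elim(6) by linarith
    \<comment> \<open>powers of 2 and 3 are coprime and approximate any size up to a constant factor\<close>
    have cop: "coprime (2 ^ i) (3 ^ k :: nat)"
    proof -
      have "coprime 2 (3::nat)" by (simp add: coprime_left_2_iff_odd)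
      then show ?thesis by simp
    qed
    have le: "x + not_decodable_const h / real n \<le> \<epsilon>" if "x = \<delta>" for x
      using that elim(5) \<delta> by linarith
    have pos: "0 < (2::nat) ^ i" "0 < (3::nat) ^ k" by simp_all
    have large: "2 * (2 * rvar\<^sup>2 + rvar * (p1 + e / (1 + \<bar>slope\<bar>)\<^sup>2)) / (e / (1 + \<bar>slope\<bar>)\<^sup>2)\<^sup>2 \<le> real n"
      using elim(3) unfolding dd_def .
    obtain x1 x2 :: "nat \<Rightarrow> nat \<Rightarrow> real" and a b :: "nat \<Rightarrow> nat" and d d' :: "nat \<Rightarrow> (nat \<Rightarrow> real) \<Rightarrow> nat" where C:
      "\<And>t. t < N n \<Longrightarrow> a t < 2 ^ i" "\<And>t. t < N n \<Longrightarrow> b t < 3 ^ k * S"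
      "\<And>j. ip n (x1 j) (x1 j) \<le> real n * (p1 + e)" "\<And>j. ip n (x2 j) (x2 j) \<le> real n * (p2 + e)"
      "\<And>t. t < N n \<Longrightarrow> ip n (\<lambda>i. x1 (a t) i + x2 (b t) i) (\<lambda>i. x1 (a t) i + x2 (b t) i) \<le> real n * (sump + 4 * e)"
      "\<And>g. d g \<in> real_vectors n \<rightarrow>\<^sub>M count_space UNIV" "\<And>g. d' g \<in> real_vectors n \<rightarrow>\<^sub>M count_space UNIV"
      "(\<Sum>t<N n. measure (gaussian_vector n 1) {u\<in>space (gaussian_vector n 1).
          d (t div L n) (channel_out n s (x1 (a t)) (x2 (b t)) u) \<noteq> t}) \<le> real (N n) * (\<delta> + not_decodable_const h / real n)"
      "(\<Sum>t<N n. measure (gaussian_vector n 1) {u\<in>space (gaussian_vector n 1).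
          d' (t div L' n) (channel_out n s' (x1 (a t)) (x2 (b t)) u) \<noteq> t}) \<le> real (N n) * (\<delta> + not_decodable_const h / real n)"
    proof (rule codebook_exists[OF n h(1) s e(1-3) N(1) pos cop size L(1) L'(1) large rate \<delta>(2)], goal_cases)
      case (1 x1 x2 a b d d')
      show ?case by (rule that[OF 1(2-)])
    qed
    have mono: "real n * (p + x) \<le> real n * (p + \<epsilon>)" if "x \<le> \<epsilon>" for p x
      using that by (intro mult_left_mono) auto
    have mono': "real (N n) * (\<delta> + not_decodable_const h / real n) \<le> real (N n) * \<epsilon>"
      by (intro mult_left_mono le) auto
    have e': "e \<le> \<epsilon>" using e by linarith
    have "good_codebook n (N n) c1 c2 \<epsilon> (L n) (L' n) s s' (2 ^ i) (3 ^ k * S) x1 x2 a b d d'"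
      unfolding good_codebook_def
    proof (intro conjI allI impI)
      show "real (2 ^ i) \<le> exp (real n * c1)" by fact
      show "real (3 ^ k * S) \<le> exp (real n * c2)" by fact
    qed (use C(1,2,6,7) in simp, use C(1,2,6,7) in simp, 
      rule order_trans[OF C(3) mono[OF e']], rule order_trans[OF C(4) mono[OF e']],
      rule order_trans[OF C(5) mono[OF e(4)]], assumption, fact C(6), fact C(7),
      rule order_trans[OF C(8) mono'], rule order_trans[OF C(9) mono'])
    then show ?case by blast
  qed
qed

end

section \<open>Bounding the leakage by a decoding error\<close>

lemma log2_ge_1_minus_inverse: "0 < (x::real) \<Longrightarrow> (1 - 1 / x) / ln 2 \<le> log 2 x"
proof -
  assume x: "0 < x"
  have "ln (1 / x) \<le> 1 / x - 1" using x by (intro ln_le_minus_one) auto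
  then have "1 - 1 / x \<le> ln x" using x by (simp add: ln_div)
  then show ?thesis by (simp add: log_def divide_right_mono)
qed

text \<open>\<open>f w\<close> is the density of the output given \<open>w\<close> over a reference
  law \<open>T\<close>. The mutual information is the mean of \<open>f w * log 2 (f w)\<close> minus
  the relative entropy of the output law to \<open>T\<close>. The latter is nonnegative and is
  dropped; the former is majorised by \<open>G\<close>. The \<open>max 0\<close> covers a
  nonintegrable integrand, whose integral is 0 by convention.\<close>

lemma mutual_information_uniform_le:
  fixes W :: "'w set" and f :: "'w \<Rightarrow> 'z \<Rightarrow> real" and G :: "'z \<Rightarrow> real"
  assumes \<Omega>: "prob_space \<Omega>" and W: "finite W" "W \<noteq> {}" and T: "prob_space T" "sets T = sets T'"
    and X[measurable]: "X \<in> \<Omega> \<rightarrow>\<^sub>M count_space W" and Y: "Y \<in> \<Omega> \<rightarrow>\<^sub>M T'"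
    and f: "\<And>w. w \<in> W \<Longrightarrow> f w \<in> borel_measurable T" "\<And>w z. w \<in> W \<Longrightarrow> z \<in> space T \<Longrightarrow> 0 < f w z"
    and law: "\<And>F. F \<in> borel_measurable (count_space W \<Otimes>\<^sub>M T) \<Longrightarrow>
      (\<integral>\<^sup>+\<omega>. F (X \<omega>, Y \<omega>) \<partial>\<Omega>) = (\<Sum>w\<in>W. \<integral>\<^sup>+z. ennreal (f w z / card W) * F (w, z) \<partial>T)"
    and norm: "\<And>w. w \<in> W \<Longrightarrow> (\<integral>\<^sup>+z. ennreal (f w z) \<partial>T) = 1"
    and G: "integrable T G" "\<And>z. z \<in> space T \<Longrightarrow> (\<Sum>w\<in>W. f w z * log 2 (f w z)) \<le> card W * G z"
  shows "0 \<le> prob_space.mutual_information \<Omega> 2 (count_space W) T' X Y"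
    and "prob_space.mutual_information \<Omega> 2 (count_space W) T' X Y \<le> max 0 (\<integral>z. G z \<partial>T)"
proof -
  interpret O: information_space \<Omega> 2 
    using \<Omega> by (intro information_space.intro information_space_axioms.intro) auto
  interpret T: prob_space T by fact
  interpret S: sigma_finite_measure "count_space W"
    by (rule sigma_finite_measure_count_space_finite[OF W(1)])
  interpret ST: pair_sigma_finite "count_space W" T ..
  let ?S = "count_space W"
  let ?MI = "O.mutual_information 2 ?S T' X Y"
  have Y'[measurable]: "Y \<in> \<Omega> \<rightarrow>\<^sub>M T" using Y T(2) by (simp cong: measurable_cong_sets)
  have c: "0 < real (card W)" using W by (simp add: card_gt_0_iff)
  define Px where "Px = (\<lambda>w::'w. 1 / real (card W))"
  define Py where "Py z = (\<Sum>w\<in>W. f w z) / card W" for z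
  define Pxy where "Pxy p = f (fst p) (snd p) / card W" for p
  have Py_m[measurable]: "Py \<in> borel_measurable T"
    unfolding Py_def using f(1) by (intro borel_measurable_divide borel_measurable_sum) auto
  have Pxy_m[measurable]: "Pxy \<in> borel_measurable (?S \<Otimes>\<^sub>M T)"
    using W f(1) by (intro measurable_pair_measure_countable1) (auto simp: Pxy_def countable_finite)
  have Py_pos: "0 < Py z" if "z \<in> space T" for z
    unfolding Py_def using W f(2) that c by (intro divide_pos_pos sum_pos) auto
  have fint: "has_bochner_integral T (f w) 1" if "w \<in> W" for w
    using that norm f by (intro has_bochner_integral_nn_integral) (auto simp: less_imp_le)
  have dxy: "distributed \<Omega> (?S \<Otimes>\<^sub>M T) (\<lambda>\<omega>. (X \<omega>, Y \<omega>)) Pxy"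
    unfolding distributed_def
  proof (intro conjI measure_eqI)
    fix A assume "A \<in> sets (distr \<Omega> (?S \<Otimes>\<^sub>M T) (\<lambda>\<omega>. (X \<omega>, Y \<omega>)))"
    then have A[measurable]: "A \<in> sets (?S \<Otimes>\<^sub>M T)" by simp
    have "emeasure (distr \<Omega> (?S \<Otimes>\<^sub>M T) (\<lambda>\<omega>. (X \<omega>, Y \<omega>))) A = (\<integral>\<^sup>+\<omega>. indicator A (X \<omega>, Y \<omega>) \<partial>\<Omega>)"
      by (rule emeasure_distr_eq_nn_integral) auto
    also have "\<dots> = (\<Sum>w\<in>W. \<integral>\<^sup>+z. ennreal (f w z / card W) * indicator A (w, z) \<partial>T)"
      by (rule law) auto
    also have "\<dots> = (\<integral>\<^sup>+w. \<integral>\<^sup>+z. ennreal (Pxy (w, z)) * indicator A (w, z) \<partial>T \<partial>?S)"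
      using W by (simp add: nn_integral_count_space_finite Pxy_def)
    also have "\<dots> = (\<integral>\<^sup>+p. ennreal (Pxy p) * indicator A p \<partial>(?S \<Otimes>\<^sub>M T))"
      by (intro T.nn_integral_fst[where f="\<lambda>p. ennreal (Pxy p) * indicator A p"]) measurable
    also have "\<dots> = emeasure (density (?S \<Otimes>\<^sub>M T) Pxy) A"
      by (subst emeasure_density) auto
    finally show "emeasure (distr \<Omega> (?S \<Otimes>\<^sub>M T) (\<lambda>\<omega>. (X \<omega>, Y \<omega>))) A = emeasure (density (?S \<Otimes>\<^sub>M T) Pxy) A" .
  qed auto
  have dx: "distributed \<Omega> ?S X Px"
    unfolding distributed_def
  proof (intro conjI measure_eqI)
    fix A assume "A \<in> sets (distr \<Omega> ?S X)"
    then have A: "A \<subseteq> W" by simp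
    have "emeasure (distr \<Omega> ?S X) A = (\<integral>\<^sup>+\<omega>. indicator A (fst (X \<omega>, Y \<omega>)) \<partial>\<Omega>)"
      using A by (subst emeasure_distr_eq_nn_integral) (auto simp: indicator_def intro!: nn_integral_cong)
    also have "\<dots> = (\<Sum>w\<in>W. \<integral>\<^sup>+z. ennreal (f w z / card W) * indicator A (fst (w, z)) \<partial>T)"
      by (rule law[where F="\<lambda>p. indicator A (fst p)"], rule measurable_compose[OF measurable_fst]) simp
    also have "\<dots> = (\<Sum>w\<in>W. ennreal (Px w) * indicator A w)"
    proof (intro sum.cong refl)
      fix w assume w: "w \<in> W"
      have "(\<integral>\<^sup>+z. ennreal (f w z / card W) * indicator A (fst (w, z)) \<partial>T)
          = (\<integral>\<^sup>+z. (ennreal (1 / card W) * indicator A w) * ennreal (f w z) \<partial>T)"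
        using w f(2) by (intro nn_integral_cong) (auto simp: indicator_def ennreal_mult[symmetric] less_imp_le)
      also have "\<dots> = ennreal (Px w) * indicator A w"
        using w f(1) norm by (subst nn_integral_cmult) (auto simp: Px_def)
      finally show "(\<integral>\<^sup>+z. ennreal (f w z / card W) * indicator A (fst (w, z)) \<partial>T) = ennreal (Px w) * indicator A w" .
    qed
    also have "\<dots> = emeasure (density ?S Px) A"
      using A W by (subst emeasure_density) (auto simp: nn_integral_count_space_finite)
    finally show "emeasure (distr \<Omega> ?S X) A = emeasure (density ?S Px) A" .
  qed auto
  have dy: "distributed \<Omega> T Y Py"
    unfolding distributed_def
  proof (intro conjI measure_eqI)
    fix A assume "A \<in> sets (distr \<Omega> T Y)"
    then have A[measurable]: "A \<in> sets T" by simp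
    have "emeasure (distr \<Omega> T Y) A = (\<integral>\<^sup>+\<omega>. indicator A (snd (X \<omega>, Y \<omega>)) \<partial>\<Omega>)"
      by (subst emeasure_distr_eq_nn_integral) auto
    also have "\<dots> = (\<Sum>w\<in>W. \<integral>\<^sup>+z. ennreal (f w z / card W) * indicator A (snd (w, z)) \<partial>T)"
      by (rule law) measurable
    also have "\<dots> = (\<integral>\<^sup>+z. (\<Sum>w\<in>W. ennreal (f w z / card W) * indicator A (snd (w, z))) \<partial>T)"
      using f(1) by (subst nn_integral_sum) auto
    also have "\<dots> = (\<integral>\<^sup>+z. ennreal (Py z) * indicator A z \<partial>T)"
      using f(2) c by (intro nn_integral_cong)
        (auto simp: Py_def sum_divide_distrib less_imp_le sum_distrib_right[symmetric] intro!: arg_cong2[where f="(*)"] sum_ennreal)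
    also have "\<dots> = emeasure (density T Py) A"
      by (subst emeasure_density) auto
    finally show "emeasure (distr \<Omega> T Y) A = emeasure (density T Py) A" .
  qed auto
  define k where "k p = Pxy p * log 2 (Pxy p / (Px (fst p) * Py (snd p)))" for p
  \<comment> \<open>The output space enters the mutual information only through its measurable sets,
    so the reference law may take the place of \<open>T'\<close>.\<close>
  have mi_T: "?MI = O.mutual_information 2 ?S T X Y"
  proof -
    have "distr \<Omega> T' Y = distr \<Omega> T Y" by (rule distr_cong) (use T in auto)
    moreover have "distr \<Omega> (?S \<Otimes>\<^sub>M T') (\<lambda>x. (X x, Y x)) = distr \<Omega> (?S \<Otimes>\<^sub>M T) (\<lambda>x. (X x, Y x))"
      by (rule distr_cong) (use T in \<open>auto intro!: sets_pair_measure_cong\<close>)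
    ultimately show ?thesis by (simp add: O.mutual_information_def)
  qed
  note A = S.sigma_finite_measure_axioms T.sigma_finite_measure_axioms dx _ dy _ dxy
  have eq: "?MI = (\<integral>p. k p \<partial>(?S \<Otimes>\<^sub>M T))"
    unfolding mi_T k_def using f(2) c Py_pos
    by (intro O.mutual_information_distr[OF A]) (auto simp: Px_def Pxy_def less_imp_le)
  have nonneg: "0 \<le> ?MI" if "integrable (?S \<Otimes>\<^sub>M T) k"
    unfolding mi_T using that f(2) c Py_pos unfolding k_def
    by (intro O.mutual_information_nonneg[OF A]) (auto simp: Px_def Pxy_def less_imp_le)
  have upper: "?MI \<le> (\<integral>z. G z \<partial>T)" if int: "integrable (?S \<Otimes>\<^sub>M T) k"
  proof -
    have kint: "integrable T (\<lambda>z. k (w, z))" if "w \<in> W" for w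
      using ST.AE_integrable_fst'[OF int] that by (simp add: AE_count_space)
    have "?MI = (\<integral>w. \<integral>z. k (w, z) \<partial>T \<partial>?S)"
      unfolding eq by (rule ST.integral_fst'[symmetric, OF int])
    also have "\<dots> = (\<Sum>w\<in>W. \<integral>z. k (w, z) \<partial>T)"
      using W by (simp add: lebesgue_integral_count_space_finite)
    also have "\<dots> = (\<integral>z. (\<Sum>w\<in>W. k (w, z)) \<partial>T)"
      using kint by (subst Bochner_Integration.integral_sum) auto
    \<comment> \<open>\<open>Py * log 2 Py\<close> is at least \<open>(Py - 1) / ln 2\<close>, whose
      integral vanishes: this is the nonnegativity of the dropped relative entropy.\<close>
    also have "\<dots> \<le> (\<integral>z. G z - (Py z - 1) / ln 2 \<partial>T)"
    proof (rule integral_mono)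
      show "integrable T (\<lambda>z. \<Sum>w\<in>W. k (w, z))" using kint by auto
      have "integrable T Py"
        unfolding Py_def using fint by (intro integrable_divide Bochner_Integration.integrable_sum) (auto simp: has_bochner_integral_iff)
      then show "integrable T (\<lambda>z. G z - (Py z - 1) / ln 2)" using G by auto
      fix z assume z: "z \<in> space T"
      have "k (w, z) = f w z * log 2 (f w z) / card W - f w z / card W * log 2 (Py z)" if "w \<in> W" for w
      proof -
        have "Pxy (w, z) / (Px w * Py z) = f w z / Py z"
          using c by (simp add: Pxy_def Px_def)
        then have "k (w, z) = Pxy (w, z) * log 2 (f w z / Py z)"
          by (simp only: k_def fst_conv snd_conv)
        then show ?thesis
          using f(2)[OF that z] Py_pos[OF z] by (simp add: Pxy_def log_divide right_diff_distrib diff_divide_distrib)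
      qed
      then have "(\<Sum>w\<in>W. k (w, z)) = (\<Sum>w\<in>W. f w z * log 2 (f w z)) / card W - Py z * log 2 (Py z)"
        by (simp add: sum_subtractf sum_divide_distrib Py_def sum_distrib_right)
      also have "(\<Sum>w\<in>W. f w z * log 2 (f w z)) / card W \<le> G z"
        using G(2)[OF z] c by (simp add: pos_divide_le_eq mult.commute)
      finally have "(\<Sum>w\<in>W. k (w, z)) \<le> G z - Py z * log 2 (Py z)" by simp
      moreover have "(Py z - 1) / ln 2 \<le> Py z * log 2 (Py z)"
      proof -
        have "(Py z - 1) / ln 2 = Py z * ((1 - 1 / Py z) / ln 2)"
          using Py_pos[OF z] by (simp add: right_diff_distrib)
        also have "\<dots> \<le> Py z * log 2 (Py z)"
          using Py_pos[OF z] by (intro mult_left_mono log2_ge_1_minus_inverse) auto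
        finally show ?thesis .
      qed
      ultimately show "(\<Sum>w\<in>W. k (w, z)) \<le> G z - (Py z - 1) / ln 2" by simp
    qed
    also have "\<dots> = (\<integral>z. G z \<partial>T)"
    proof -
      have "has_bochner_integral T (\<lambda>z. \<Sum>w\<in>W. f w z) (\<Sum>w\<in>W. 1)"
        by (intro has_bochner_integral_sum fint)
      then have "has_bochner_integral T (\<lambda>z. (\<Sum>w\<in>W. f w z) / card W) ((\<Sum>w\<in>W. 1) / card W)"
        by (intro has_bochner_integral_divide_zero)
      then have "has_bochner_integral T Py 1"
        unfolding Py_def using c by simp
      then show ?thesis using G(1) by (simp add: has_bochner_integral_iff T.prob_space)
    qed
    finally show ?thesis .
  qed
  have z: "?MI = 0" if "\<not> integrable (?S \<Otimes>\<^sub>M T) k"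
    unfolding eq using that by (rule not_integrable_integral_eq)
  show "0 \<le> ?MI" using nonneg z by (cases "integrable (?S \<Otimes>\<^sub>M T) k") auto
  show "?MI \<le> max 0 (\<integral>z. G z \<partial>T)" using upper z by (cases "integrable (?S \<Otimes>\<^sub>M T) k") (auto simp: le_max_iff_disj)
qed

text \<open>Nonnegativity of the relative entropy of the normalised \<open>a\<close> to a
  sub-probability \<open>q\<close>, scaled by the total mass. The tangent bound on the logarithm
  proves it term by term.\<close>

lemma log_sum_inequality:
  fixes a q :: "'k \<Rightarrow> real"
  assumes K: "finite K" and a: "\<And>k. k \<in> K \<Longrightarrow> 0 \<le> a k" and q: "\<And>k. k \<in> K \<Longrightarrow> 0 < q k" "(\<Sum>k\<in>K. q k) \<le> 1"
  shows "(\<Sum>k\<in>K. a k) * log 2 (\<Sum>k\<in>K. a k) \<le> (\<Sum>k\<in>K. a k * log 2 (a k / q k))"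
proof (cases "(\<Sum>k\<in>K. a k) = 0")
  case True
  then have "\<And>k. k \<in> K \<Longrightarrow> a k = 0" using K a by (simp add: sum_nonneg_eq_0_iff)
  then show ?thesis by simp
next
  case False
  define s where "s = (\<Sum>k\<in>K. a k)"
  have s: "0 < s" using False a by (simp add: s_def sum_nonneg less_le)
  have "(a k - s * q k) / ln 2 \<le> a k * log 2 (a k / q k) - a k * log 2 s" if k: "k \<in> K" for k
  proof (cases "a k = 0")
    case True
    then show ?thesis using s q(1)[OF k] by (simp add: divide_nonneg_pos)
  next
    case False
    then have ak: "0 < a k" using a[OF k] by simp
    have x: "0 < a k / (q k * s)" using ak q(1)[OF k] s by simp
    have "(a k - s * q k) / ln 2 = a k * ((1 - 1 / (a k / (q k * s))) / ln 2)"
      using ak by (simp add: field_simps)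
    also have "\<dots> \<le> a k * log 2 (a k / (q k * s))"
      using ak by (intro mult_left_mono log2_ge_1_minus_inverse x) auto
    also have "\<dots> = a k * log 2 (a k / q k) - a k * log 2 s"
      using ak q(1)[OF k] s by (simp add: log_divide log_mult algebra_simps)
    finally show ?thesis .
  qed
  then have "(\<Sum>k\<in>K. (a k - s * q k) / ln 2) \<le> (\<Sum>k\<in>K. a k * log 2 (a k / q k) - a k * log 2 s)"
    by (intro sum_mono) auto
  also have "(\<Sum>k\<in>K. (a k - s * q k) / ln 2) = (s - s * (\<Sum>k\<in>K. q k)) / ln 2"
    by (simp add: sum_divide_distrib[symmetric] sum_subtractf s_def sum_distrib_left)
  finally have "(s - s * (\<Sum>k\<in>K. q k)) / ln 2 \<le> (\<Sum>k\<in>K. a k * log 2 (a k / q k)) - s * log 2 s"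
    by (simp add: sum_subtractf s_def sum_distrib_right)
  moreover have "0 \<le> (s - s * (\<Sum>k\<in>K. q k)) / ln 2"
    using s q(2) by (intro divide_nonneg_pos) (auto simp: mult_left_le)
  ultimately show ?thesis by (simp add: s_def)
qed

text \<open>A Fano inequality at a single output: \<open>phi k\<close> are densities at that output,
  \<open>p\<close> is the law of \<open>k\<close> and \<open>d\<close> the decoded index. Compared
  with its components the mixture has \<open>log 2 K\<close> less of \<open>x * log 2 x\<close>, up
  to 2 bits and up to the weight of the indices other than \<open>d\<close>.\<close>

lemma mixture_entropy_le:
  fixes phi p :: "nat \<Rightarrow> real"
  assumes K: "0 < K" and phi: "\<And>k. k < K \<Longrightarrow> 0 < phi k" and p: "\<And>k. k < K \<Longrightarrow> 0 \<le> p k" "\<And>k. k < K \<Longrightarrow> p k \<le> 2 / real K"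
  shows "(\<Sum>k<K. p k * phi k) * log 2 (\<Sum>k<K. p k * phi k)
    \<le> (\<Sum>k<K. p k * (phi k * log 2 (phi k))) + (2 - log 2 (real K)) * (\<Sum>k<K. p k * phi k)
      + log 2 (real K) * (\<Sum>k<K. p k * (phi k * (if d = k then 0 else 1)))"
proof -
  \<comment> \<open>Comparison weights for the guess \<open>d\<close>: one half on \<open>d\<close>,
    the other half spread evenly. As \<open>p k \<le> 2 / K\<close>, the ratio
    \<open>p k / q k\<close> is at most \<open>4 / K\<close> for \<open>k = d\<close> and at most 4
    otherwise, which is the source of the 2 bits.\<close>
  define q where "q k = (if k = d then 1/2 else 1 / (2 * real K))" for k
  have q: "0 < q k" for k using K by (simp add: q_def)
  have q1: "(\<Sum>k<K. q k) \<le> 1"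
  proof -
    have "(\<Sum>k<K. q k) \<le> (\<Sum>k<K. (if k = d then 1/2 else 0) + 1 / (2 * real K))"
      by (intro sum_mono) (auto simp: q_def)
    also have "\<dots> = (if d < K then 1/2 else 0) + 1/2"
      using K by (simp add: sum.distrib)
    finally show ?thesis by (auto split: if_splits)
  qed
  have "(\<Sum>k<K. p k * phi k) * log 2 (\<Sum>k<K. p k * phi k) \<le> (\<Sum>k<K. (p k * phi k) * log 2 (p k * phi k / q k))"
    using phi p q q1 by (intro log_sum_inequality) (auto simp: less_imp_le)
  also have "\<dots> \<le> (\<Sum>k<K. p k * (phi k * log 2 (phi k)) + (2 - log 2 (real K)) * (p k * phi k)
      + log 2 (real K) * (p k * (phi k * (if d = k then 0 else 1))))"
  proof (intro sum_mono)
    fix k assume "k \<in> {..<K}"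
    then have k: "k < K" by simp
    show "(p k * phi k) * log 2 (p k * phi k / q k) \<le> p k * (phi k * log 2 (phi k)) + (2 - log 2 (real K)) * (p k * phi k)
      + log 2 (real K) * (p k * (phi k * (if d = k then 0 else 1)))"
    proof (cases "p k = 0")
      case False
      then have pk: "0 < p k" using p(1)[OF k] by simp
      have "log 2 (p k * phi k / q k) = log 2 (phi k) + log 2 (p k / q k)"
        using pk phi[OF k] q[of k] by (simp add: log_mult log_divide)
      moreover have "log 2 (p k / q k) \<le> 2 - log 2 (real K) + log 2 (real K) * (if d = k then 0 else 1)"
      proof -
        have "log 2 (p k / q k) \<le> log 2 (2 / real K / q k)"
        proof -
          have "p k / q k \<le> 2 / real K / q k" using p(2)[OF k] q[of k] by (intro divide_right_mono) auto
          then show ?thesis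
            using log_le_cancel_iff[of 2 "p k / q k" "2 / real K / q k"] pk q[of k] K by simp
        qed
        also have "\<dots> = 2 - log 2 (real K) + log 2 (real K) * (if d = k then 0 else 1)"
        proof -
          have 4: "log 2 (4::real) = 2" using log_pow_cancel[of 2 2] by simp
          show ?thesis using K by (auto simp: q_def log_divide 4)
        qed
        finally show ?thesis .
      qed
      ultimately have "(p k * phi k) * log 2 (p k * phi k / q k)
        \<le> (p k * phi k) * (log 2 (phi k) + (2 - log 2 (real K) + log 2 (real K) * (if d = k then 0 else 1)))"
        using pk phi[OF k] by (intro mult_left_mono) auto
      then show ?thesis by (simp add: algebra_simps)
    qed simp
  qed
  also have "\<dots> = (\<Sum>k<K. p k * (phi k * log 2 (phi k))) + (2 - log 2 (real K)) * (\<Sum>k<K. p k * phi k)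
      + log 2 (real K) * (\<Sum>k<K. p k * (phi k * (if d = k then 0 else 1)))"
    by (simp only: sum.distrib sum_distrib_left)
  finally show ?thesis .
qed

section \<open>Translated Gaussian densities and their relative entropy\<close>

definition shift_density :: "nat \<Rightarrow> real \<Rightarrow> (nat \<Rightarrow> real) \<Rightarrow> (nat \<Rightarrow> real) \<Rightarrow> real" where
  "shift_density n t m z = (\<Prod>i=1..n. gaussian_ratio (m i) 1 t (z i))"

lemma shift_density_measurable [measurable]: "shift_density n t m \<in> borel_measurable (real_vectors n)"
  unfolding shift_density_def by measurable

lemma shift_density_pos: "0 < t \<Longrightarrow> 0 < shift_density n t m z"
  unfolding shift_density_def by (intro prod_pos) (auto intro: gaussian_ratio_pos)

lemma density_shift_density:
  assumes t: "0 < t"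
  shows "density (gaussian_vector n t) (shift_density n t m)
    = distr (gaussian_vector n 1) (real_vectors n) (\<lambda>u. \<lambda>i\<in>{1..n}. m i + u i)"
  using t by (subst distr_gaussian_vector_shift[of 1 t])
    (auto simp: shift_density_def prod_ennreal gaussian_ratio_pos less_imp_le)

lemma nn_integral_shift_density:
  assumes t: "0 < t" and F: "F \<in> borel_measurable (real_vectors n)"
  shows "(\<integral>\<^sup>+z. ennreal (shift_density n t m z) * F z \<partial>gaussian_vector n t)
    = (\<integral>\<^sup>+u. F (\<lambda>i\<in>{1..n}. m i + u i) \<partial>gaussian_vector n 1)"
proof -
  have "(\<integral>\<^sup>+z. ennreal (shift_density n t m z) * F z \<partial>gaussian_vector n t)
    = (\<integral>\<^sup>+z. F z \<partial>density (gaussian_vector n t) (shift_density n t m))"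
    using F by (subst nn_integral_density) auto
  also have "\<dots> = (\<integral>\<^sup>+u. F (\<lambda>i\<in>{1..n}. m i + u i) \<partial>gaussian_vector n 1)"
    unfolding density_shift_density[OF t] using F by (subst nn_integral_distr) auto
  finally show ?thesis .
qed

lemma has_bochner_integral_shift_density:
  fixes F :: "(nat \<Rightarrow> real) \<Rightarrow> real"
  assumes t: "0 < t" and F: "F \<in> borel_measurable (real_vectors n)"
    and "has_bochner_integral (gaussian_vector n 1) (\<lambda>u. F (\<lambda>i\<in>{1..n}. m i + u i)) c"
  shows "has_bochner_integral (gaussian_vector n t) (\<lambda>z. shift_density n t m z * F z) c"
proof -
  have "has_bochner_integral (distr (gaussian_vector n 1) (real_vectors n) (\<lambda>u. \<lambda>i\<in>{1..n}. m i + u i)) F c"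
    using assms by (subst has_bochner_integral_distr) auto
  then have "has_bochner_integral (density (gaussian_vector n t) (shift_density n t m)) F c"
    by (simp only: density_shift_density[OF t])
  then show ?thesis
    using F t by (auto simp: has_bochner_integral_iff integrable_density integral_density shift_density_pos less_imp_le)
qed

lemma gaussian_vector_component:
  assumes "0 < v" "i \<in> {1..n}" "has_bochner_integral (gaussian v) f c"
  shows "has_bochner_integral (gaussian_vector n v) (\<lambda>x. f (x i)) (c::real)"
proof -
  have "distr (gaussian_vector n v) (gaussian v) (\<lambda>x. x i) = gaussian v"
    unfolding gaussian_vector_def using assms prob_space_gaussian by (intro distr_PiM_component) auto
  then have "has_bochner_integral (distr (gaussian_vector n v) (gaussian v) (\<lambda>x. x i)) f c"
    using assms by simp
  moreover have "f \<in> borel_measurable (gaussian v)" using assms(3) by (auto simp: has_bochner_integral_iff)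
  moreover have "(\<lambda>x. x i) \<in> gaussian_vector n v \<rightarrow>\<^sub>M gaussian v"
    unfolding gaussian_vector_def using assms(2) by (rule measurable_component_singleton)
  ultimately show ?thesis
    by (simp only: has_bochner_integral_iff integrable_distr_eq integral_distr)
qed

text \<open>Relative entropy, in bits, of the law of \<open>m + u\<close> to the centred law of
  variance \<open>t\<close>. For \<open>|m|^2 = n * (t - 1)\<close> it equals
  \<open>n/2 * log 2 t\<close>, which is where \<open>f5\<close> enters.\<close>

lemma shift_density_entropy:
  assumes t: "1 \<le> t"
  shows "has_bochner_integral (gaussian_vector n t) (\<lambda>z. shift_density n t m z * log 2 (shift_density n t m z))
    ((real n / 2 * ln t - real n / 2 + (ip n m m + real n) / (2 * t)) / ln 2)"
proof (rule has_bochner_integral_shift_density)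
  interpret prob_space "gaussian_vector n 1" by (rule prob_space_gaussian_vector) simp
  note M = gaussian_moments[of 1, simplified]
  have 1: "has_bochner_integral (gaussian_vector n 1) (\<lambda>u. ip n u u) (real n)"
  proof -
    have "has_bochner_integral (gaussian_vector n 1) (\<lambda>u. \<Sum>i=1..n. (u i)\<^sup>2) (\<Sum>i=1..n. 1)"
      by (intro has_bochner_integral_sum gaussian_vector_component[where f="\<lambda>x. x\<^sup>2"] M) auto
    then show ?thesis by (simp add: ip_def power2_eq_square)
  qed
  have 2: "has_bochner_integral (gaussian_vector n 1) (\<lambda>u. ip n m u) 0"
  proof -
    have "has_bochner_integral (gaussian_vector n 1) (\<lambda>u. \<Sum>i=1..n. m i * u i) (\<Sum>i=1..n. m i * 0)"
      by (intro has_bochner_integral_sum has_bochner_integral_mult_right gaussian_vector_component[where f="\<lambda>x. x"] M) auto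
    then show ?thesis by (simp add: ip_def)
  qed
  have c: "has_bochner_integral (gaussian_vector n 1) (\<lambda>u. w) w" for w :: real
    using prob_space by (simp add: has_bochner_integral_iff)
  have eq: "log 2 (shift_density n t m (\<lambda>i\<in>{1..n}. m i + u i))
      = (real n / 2 * ln t + ip n m m / (2 * t) - 1/2 * ip n u u + 1 / t * ip n m u + 1 / (2 * t) * ip n u u) / ln 2" for u
  proof -
    have "shift_density n t m (\<lambda>i\<in>{1..n}. m i + u i) = (\<Prod>i=1..n. gaussian_ratio (m i) 1 t (m i + u i))"
      by (simp add: shift_density_def)
    also have "\<dots> = exp (real n / 2 * ln (t / 1) - (\<Sum>i=1..n. (m i + u i - m i)\<^sup>2) / (2 * 1) + (\<Sum>i=1..n. (m i + u i)\<^sup>2) / (2 * t))"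
      using t by (intro prod_gaussian_ratio_eq_exp) auto
    also have "(\<Sum>i=1..n. (m i + u i)\<^sup>2) = ip n m m + 2 * ip n m u + ip n u u"
      by (simp add: ip_def power2_eq_square algebra_simps sum.distrib sum_distrib_left)
    also have "(\<Sum>i=1..n. (m i + u i - m i)\<^sup>2) = ip n u u"
      by (simp add: ip_def power2_eq_square)
    finally have e: "shift_density n t m (\<lambda>i\<in>{1..n}. m i + u i)
      = exp (real n / 2 * ln (t / 1) - ip n u u / (2 * 1) + (ip n m m + 2 * ip n m u + ip n u u) / (2 * t))" .
    show ?thesis
      unfolding e log_def ln_exp by (simp add: add_divide_distrib algebra_simps)
  qed
  have hb: "has_bochner_integral (gaussian_vector n 1) (\<lambda>u. (real n / 2 * ln t + ip n m m / (2 * t) - 1/2 * ip n u u + 1 / t * ip n m u + 1 / (2 * t) * ip n u u) / ln 2)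
     ((real n / 2 * ln t + ip n m m / (2 * t) - 1/2 * real n + 1 / t * 0 + 1 / (2 * t) * real n) / ln 2)"
    by (intro has_bochner_integral_divide_zero has_bochner_integral_add has_bochner_integral_diff has_bochner_integral_mult_right 1 2 c)
  have v: "real n / 2 * ln t + ip n m m / (2 * t) - 1/2 * real n + 1 / t * 0 + 1 / (2 * t) * real n
    = real n / 2 * ln t - real n / 2 + (ip n m m + real n) / (2 * t)"
    by (simp add: add_divide_distrib)
  show "has_bochner_integral (gaussian_vector n 1) (\<lambda>u. log 2 (shift_density n t m (\<lambda>i\<in>{1..n}. m i + u i)))
    ((real n / 2 * ln t - real n / 2 + (ip n m m + real n) / (2 * t)) / ln 2)"
    unfolding eq using hb unfolding v .
qed (use t in auto)

section \<open>Expectations over the outcome of a code\<close>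

lemma nn_integral_code_space:
  assumes g: "gain ch < 1" and F: "F \<in> borel_measurable (code_space ch R' R n)"
  shows "(\<integral>\<^sup>+\<omega>. F \<omega> \<partial>code_space ch R' R n)
    = (\<Sum>w\<in>index_set n R. \<Sum>m\<in>index_set n R'. ennreal (1 / (card (index_set n R) * card (index_set n R')))
        * (\<integral>\<^sup>+p. F (w, m, p) \<partial>(gaussian_vector n 1 \<Otimes>\<^sub>M gaussian_vector n (1 - gain ch))))"
proof -
  let ?W = "index_set n R" and ?M = "index_set n R'"
  let ?U = "gaussian_vector n 1" and ?V = "gaussian_vector n (1 - gain ch)"
  interpret U: prob_space ?U by (rule prob_space_gaussian_vector) simp
  interpret V: prob_space ?V using g by (intro prob_space_gaussian_vector) simp
  interpret UV: pair_prob_space ?U ?V ..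
  have fin: "finite ?W" "finite ?M" by (simp_all add: index_set_def)
  interpret M: sigma_finite_measure "uniform_count_measure ?M"
    using fin by (intro finite_measure.axioms(1)[of "uniform_count_measure ?M"] finite_measureI)
      (simp add: space_uniform_count_measure emeasure_uniform_count_measure)
  interpret MUV: pair_sigma_finite "uniform_count_measure ?M" "?U \<Otimes>\<^sub>M ?V" ..
  have F': "F \<in> borel_measurable (uniform_count_measure ?W \<Otimes>\<^sub>M (uniform_count_measure ?M \<Otimes>\<^sub>M (?U \<Otimes>\<^sub>M ?V)))"
    using F by (simp add: code_space_def)
  have cs: "(\<integral>\<^sup>+x. f x \<partial>uniform_count_measure A) = (\<Sum>x\<in>A. ennreal (1 / card A) * f x)" if "finite A"
    for A :: "nat set" and f :: "nat \<Rightarrow> ennreal"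
    using that by (simp add: uniform_count_measure_def nn_integral_point_measure_finite)
  have "(\<integral>\<^sup>+\<omega>. F \<omega> \<partial>code_space ch R' R n)
    = (\<integral>\<^sup>+w. \<integral>\<^sup>+q. F (w, q) \<partial>(uniform_count_measure ?M \<Otimes>\<^sub>M (?U \<Otimes>\<^sub>M ?V)) \<partial>uniform_count_measure ?W)"
    unfolding code_space_def by (rule MUV.nn_integral_fst[symmetric, OF F'])
  also have "\<dots> = (\<Sum>w\<in>?W. ennreal (1 / card ?W) * (\<integral>\<^sup>+q. F (w, q) \<partial>(uniform_count_measure ?M \<Otimes>\<^sub>M (?U \<Otimes>\<^sub>M ?V))))"
    by (rule cs[OF fin(1)])
  also have "\<dots> = (\<Sum>w\<in>?W. ennreal (1 / card ?W) * (\<Sum>m\<in>?M. ennreal (1 / card ?M) * (\<integral>\<^sup>+p. F (w, m, p) \<partial>(?U \<Otimes>\<^sub>M ?V))))"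
  proof (intro sum.cong refl arg_cong2[where f="(*)"])
    fix w assume w: "w \<in> ?W"
    have "(\<lambda>q. F (w, q)) \<in> borel_measurable (uniform_count_measure ?M \<Otimes>\<^sub>M (?U \<Otimes>\<^sub>M ?V))"
      using measurable_compose[OF _ F', of "\<lambda>q. (w, q)"] w by (simp add: space_uniform_count_measure)
    then have "(\<integral>\<^sup>+q. F (w, q) \<partial>(uniform_count_measure ?M \<Otimes>\<^sub>M (?U \<Otimes>\<^sub>M ?V)))
      = (\<integral>\<^sup>+m. \<integral>\<^sup>+p. F (w, m, p) \<partial>(?U \<Otimes>\<^sub>M ?V) \<partial>uniform_count_measure ?M)"
      by (rule UV.nn_integral_fst[symmetric])
    then show "(\<integral>\<^sup>+q. F (w, q) \<partial>(uniform_count_measure ?M \<Otimes>\<^sub>M (?U \<Otimes>\<^sub>M ?V)))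
      = (\<Sum>m\<in>?M. ennreal (1 / card ?M) * (\<integral>\<^sup>+p. F (w, m, p) \<partial>(?U \<Otimes>\<^sub>M ?V)))"
      by (simp add: cs[OF fin(2)])
  qed
  also have "\<dots> = (\<Sum>w\<in>?W. \<Sum>m\<in>?M. ennreal (1 / (card ?W * card ?M)) * (\<integral>\<^sup>+p. F (w, m, p) \<partial>(?U \<Otimes>\<^sub>M ?V)))"
    by (simp add: sum_distrib_left mult.assoc[symmetric] ennreal_mult[symmetric])
  finally show ?thesis .
qed

definition code_input :: "wiretap_code \<Rightarrow> nat \<Rightarrow> nat \<Rightarrow> nat \<Rightarrow> real" where
  "code_input c w m i = relay1 c (fst (source_enc c w m)) i + relay2 c (snd (source_enc c w m)) i"

lemma finite_index_set [simp]: "finite (index_set n R)"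
  by (simp add: index_set_def)

lemma index_set_nonempty: "0 \<le> R \<Longrightarrow> index_set n R \<noteq> {}"
proof -
  assume "0 \<le> R"
  then have "1 \<le> 2 powr (real n * R)" by (intro ge_one_powr_ge_zero) auto
  then have "1 \<le> nat \<lfloor>2 powr (real n * R)\<rfloor>" by linarith
  then show ?thesis by (simp add: index_set_def)
qed

lemma prob_space_code_space:
  assumes "0 \<le> R" "0 \<le> R'" "gain ch < 1"
  shows "prob_space (code_space ch R' R n)"
proof -
  have u: "prob_space (uniform_count_measure (index_set n r))" if "0 \<le> r" for r
    using that by (intro prob_space_uniform_count_measure index_set_nonempty) auto
  show ?thesis unfolding code_space_def
    using assms by (intro prob_space_pair u prob_space_gaussian_vector) auto
qed

text \<open>The messages take finitely many values, so measurability has to be checked in the noises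
  only.\<close>

lemma code_space_countable_measurable:
  assumes f: "\<And>w m. w \<in> index_set n R \<Longrightarrow> m \<in> index_set n R' \<Longrightarrow>
      (\<lambda>p. f w m p) \<in> gaussian_vector n 1 \<Otimes>\<^sub>M gaussian_vector n (1 - gain ch) \<rightarrow>\<^sub>M N"
  shows "(\<lambda>\<omega>. f (fst \<omega>) (fst (snd \<omega>)) (snd (snd \<omega>))) \<in> code_space ch R' R n \<rightarrow>\<^sub>M N"
proof (rule measurable_compose_countable'[where f="\<lambda>w \<omega>. f w (fst (snd \<omega>)) (snd (snd \<omega>))" and I="index_set n R"])
  have u: "sets (uniform_count_measure (index_set n r)) = sets (count_space (index_set n r))" for r
    by (simp add: sets_uniform_count_measure)
  show "fst \<in> code_space ch R' R n \<rightarrow>\<^sub>M count_space (index_set n R)"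
    unfolding code_space_def using measurable_fst measurable_cong_sets[OF refl u[of R]] by blast
  have s: "(\<lambda>\<omega>. snd (snd \<omega>)) \<in> code_space ch R' R n \<rightarrow>\<^sub>M gaussian_vector n 1 \<Otimes>\<^sub>M gaussian_vector n (1 - gain ch)"
    unfolding code_space_def by measurable
  have m: "(\<lambda>\<omega>. fst (snd \<omega>)) \<in> code_space ch R' R n \<rightarrow>\<^sub>M count_space (index_set n R')"
    unfolding code_space_def
    using measurable_compose[OF measurable_snd measurable_fst] measurable_cong_sets[OF refl u[of R']] by blast
  fix w assume w: "w \<in> index_set n R"
  show "(\<lambda>\<omega>. f w (fst (snd \<omega>)) (snd (snd \<omega>))) \<in> code_space ch R' R n \<rightarrow>\<^sub>M N"
    by (rule measurable_compose_countable'[where f="\<lambda>m \<omega>. f w m (snd (snd \<omega>))" and I="index_set n R'"])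
      (use w m measurable_compose[OF s f] in \<open>auto simp: countable_finite\<close>)
qed (simp add: countable_finite)

lemma message_eq: "message = fst"
  by (auto simp: message_def fun_eq_iff)

lemma dest_output_eq: "dest_output n c (w, m, u, v) = (\<lambda>i\<in>{1..n}. code_input c w m i + u i)"
  by (simp add: dest_output_def code_input_def)

lemma eve_output_eq: "eve_output ch n c (w, m, u, v) = (\<lambda>i\<in>{1..n}. sqrt (gain ch) * (code_input c w m i + u i) + v i)"
  by (auto simp: eve_output_def dest_output_eq restrict_def)

lemma message_measurable: "message \<in> code_space ch R' R n \<rightarrow>\<^sub>M count_space (index_set n R)"
  using code_space_countable_measurable[of n R R' "\<lambda>w m p. w" ch "count_space (index_set n R)"]
  by (simp add: message_eq)

lemma dest_output_measurable: "dest_output n c \<in> code_space ch R' R n \<rightarrow>\<^sub>M real_vectors n"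
proof -
  have "(\<lambda>\<omega>. (\<lambda>w m p. \<lambda>i\<in>{1..n}. code_input c w m i + fst p i) (fst \<omega>) (fst (snd \<omega>)) (snd (snd \<omega>)))
      \<in> code_space ch R' R n \<rightarrow>\<^sub>M real_vectors n"
    by (rule code_space_countable_measurable) measurable
  also have "(\<lambda>\<omega>. (\<lambda>w m p. \<lambda>i\<in>{1..n}. code_input c w m i + fst p i) (fst \<omega>) (fst (snd \<omega>)) (snd (snd \<omega>))) = dest_output n c"
    using dest_output_eq by (auto simp: fun_eq_iff)
  finally show ?thesis .
qed

lemma eve_output_measurable: "eve_output ch n c \<in> code_space ch R' R n \<rightarrow>\<^sub>M real_vectors n"
proof -
  have "(\<lambda>\<omega>. (\<lambda>w m p. \<lambda>i\<in>{1..n}. sqrt (gain ch) * (code_input c w m i + fst p i) + snd p i) (fst \<omega>) (fst (snd \<omega>)) (snd (snd \<omega>)))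
      \<in> code_space ch R' R n \<rightarrow>\<^sub>M real_vectors n"
    by (rule code_space_countable_measurable) measurable
  also have "(\<lambda>\<omega>. (\<lambda>w m p. \<lambda>i\<in>{1..n}. sqrt (gain ch) * (code_input c w m i + fst p i) + snd p i) (fst \<omega>) (fst (snd \<omega>)) (snd (snd \<omega>)))
      = eve_output ch n c"
    using eve_output_eq by (auto simp: fun_eq_iff)
  finally show ?thesis .
qed

text \<open>The noises \<open>sqrt g * u\<close> and \<open>v\<close> of the eavesdropper act as one
  standard Gaussian vector, so its decoder can be analysed like that of the destination.\<close>

lemma nn_integral_eve_output:
  assumes g: "0 \<le> gain ch" "gain ch < 1"
    and F: "F \<in> borel_measurable (count_space (index_set n R) \<Otimes>\<^sub>M real_vectors n)"
  shows "(\<integral>\<^sup>+\<omega>. F (message \<omega>, eve_output ch n c \<omega>) \<partial>code_space ch R' R n)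
    = (\<Sum>w\<in>index_set n R. \<Sum>m\<in>index_set n R'. ennreal (1 / (card (index_set n R) * card (index_set n R')))
        * (\<integral>\<^sup>+u. F (w, \<lambda>i\<in>{1..n}. sqrt (gain ch) * code_input c w m i + u i) \<partial>gaussian_vector n 1))"
proof -
  let ?g = "sqrt (gain ch)"
  have m: "(\<lambda>\<omega>. F (message \<omega>, eve_output ch n c \<omega>)) \<in> borel_measurable (code_space ch R' R n)"
    by (rule measurable_compose[OF measurable_Pair[OF message_measurable eve_output_measurable] F])
  have law: "distr (gaussian_vector n 1 \<Otimes>\<^sub>M gaussian_vector n (1 - gain ch)) (real_vectors n)
      (\<lambda>(x, y). \<lambda>i\<in>{1..n}. ?g * x i + y i) = gaussian_vector n 1"
    using distr_gaussian_vector_add[of 1 "1 - gain ch" n ?g] g by simp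
  have "(\<integral>\<^sup>+p. F (message (w, m, p), eve_output ch n c (w, m, p)) \<partial>(gaussian_vector n 1 \<Otimes>\<^sub>M gaussian_vector n (1 - gain ch)))
    = (\<integral>\<^sup>+u. F (w, \<lambda>i\<in>{1..n}. ?g * code_input c w m i + u i) \<partial>gaussian_vector n 1)" if w: "w \<in> index_set n R" for w m
  proof -
    have [measurable]: "(\<lambda>u. F (w, \<lambda>i\<in>{1..n}. ?g * code_input c w m i + u i)) \<in> borel_measurable (real_vectors n)"
      by (rule measurable_compose[OF measurable_Pair F]) (use w in simp, measurable)
    have "(\<integral>\<^sup>+u. F (w, \<lambda>i\<in>{1..n}. ?g * code_input c w m i + u i) \<partial>gaussian_vector n 1)
      = (\<integral>\<^sup>+u. F (w, \<lambda>i\<in>{1..n}. ?g * code_input c w m i + u i) \<partial>distr (gaussian_vector n 1 \<Otimes>\<^sub>M gaussian_vector n (1 - gain ch))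
          (real_vectors n) (\<lambda>(x, y). \<lambda>i\<in>{1..n}. ?g * x i + y i))"
      by (simp only: law)
    also have "\<dots> = (\<integral>\<^sup>+p. F (w, \<lambda>i\<in>{1..n}. ?g * code_input c w m i + (case p of (x, y) \<Rightarrow> \<lambda>i\<in>{1..n}. ?g * x i + y i) i)
        \<partial>(gaussian_vector n 1 \<Otimes>\<^sub>M gaussian_vector n (1 - gain ch)))"
      by (subst nn_integral_distr) auto
    also have "\<dots> = (\<integral>\<^sup>+p. F (message (w, m, p), eve_output ch n c (w, m, p))
        \<partial>(gaussian_vector n 1 \<Otimes>\<^sub>M gaussian_vector n (1 - gain ch)))"
    proof (intro nn_integral_cong)
      fix p :: "(nat \<Rightarrow> real) \<times> (nat \<Rightarrow> real)"
      obtain x y where p: "p = (x, y)" by (cases p)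
      have "(\<lambda>i\<in>{1..n}. ?g * code_input c w m i + (\<lambda>i\<in>{1..n}. ?g * x i + y i) i)
          = eve_output ch n c (w, m, x, y)"
        unfolding eve_output_eq by (auto simp: restrict_def fun_eq_iff algebra_simps)
      then show "F (w, \<lambda>i\<in>{1..n}. ?g * code_input c w m i + (case p of (x, y) \<Rightarrow> \<lambda>i\<in>{1..n}. ?g * x i + y i) i)
          = F (message (w, m, p), eve_output ch n c (w, m, p))"
        by (simp add: p message_def)
    qed
    finally show ?thesis by simp
  qed
  then show ?thesis
    unfolding nn_integral_code_space[OF g(2) m] by (intro sum.cong refl arg_cong2[where f="(*)"]) auto
qed

lemma sum_group_card:
  fixes h :: "nat \<Rightarrow> 'a::semiring_1"
  assumes "finite M" "\<And>m. m \<in> M \<Longrightarrow> \<kappa> m < K"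
  shows "(\<Sum>m\<in>M. h (\<kappa> m)) = (\<Sum>k<K. of_nat (card {m\<in>M. \<kappa> m = k}) * h k)"
proof -
  have "(\<Sum>m\<in>M. h (\<kappa> m)) = (\<Sum>k<K. \<Sum>m\<in>{m\<in>M. \<kappa> m = k}. h (\<kappa> m))"
    using assms by (intro sum.group[symmetric]) auto
  also have "\<dots> = (\<Sum>k<K. of_nat (card {m\<in>M. \<kappa> m = k}) * h k)"
    by (intro sum.cong refl) simp
  finally show ?thesis .
qed

text \<open>Densities are taken with respect to the Gaussian law \<open>T\<close> of variance \<open>1 + g * P\<close>. The assumption
  on \<open>\<kappa>\<close> allows for a fictitious message of rate larger than needed, whose values are merged into \<open>K\<close>
  classes of almost equal size.\<close>

lemma leakage_le:
  fixes X :: "nat \<Rightarrow> nat \<Rightarrow> nat \<Rightarrow> real" and d :: "nat \<Rightarrow> (nat \<Rightarrow> real) \<Rightarrow> nat"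
  assumes g: "0 \<le> gain ch" "gain ch < 1" and R: "0 \<le> R" "0 \<le> R'" and P: "0 \<le> P" and K: "0 < K"
    and \<kappa>: "\<And>m. m \<in> index_set n R' \<Longrightarrow> \<kappa> m < K"
      "\<And>k. k < K \<Longrightarrow> real (card {m\<in>index_set n R'. \<kappa> m = k}) \<le> 2 / real K * real (card (index_set n R'))"
    and X: "\<And>w m i. w \<in> index_set n R \<Longrightarrow> m \<in> index_set n R' \<Longrightarrow> i \<in> {1..n} \<Longrightarrow> code_input c w m i = X w (\<kappa> m) i"
    and d: "\<And>w. d w \<in> real_vectors n \<rightarrow>\<^sub>M count_space UNIV"
    and pow: "\<And>w k. w \<in> index_set n R \<Longrightarrow> k < K \<Longrightarrow> ip n (X w k) (X w k) \<le> real n * (P + \<epsilon>)" and eps: "0 \<le> \<epsilon>"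
    and err: "(\<Sum>w\<in>index_set n R. \<Sum>k<K. measure (gaussian_vector n 1) {u\<in>space (gaussian_vector n 1).
        d w (\<lambda>i\<in>{1..n}. sqrt (gain ch) * X w k i + u i) \<noteq> k}) \<le> real (card (index_set n R)) * real K * \<epsilon>"
  shows "0 \<le> leakage ch R' R n c" (is "0 \<le> ?L")
    and "leakage ch R' R n c \<le> max 0 (real n * (1/2 * log 2 (1 + gain ch * P)) + real n * \<epsilon> + 2 - log 2 (real K) + 2 * \<epsilon> * log 2 (real K))"
proof -
  let ?W = "index_set n R" and ?M = "index_set n R'" and ?g = "sqrt (gain ch)" and ?N = "gaussian_vector n 1"
  define t where "t = 1 + gain ch * P"
  have t: "1 \<le> t" using g P by (simp add: t_def)
  let ?T = "gaussian_vector n t"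
  interpret T: prob_space ?T using t by (intro prob_space_gaussian_vector) simp
  interpret N: prob_space ?N by (intro prob_space_gaussian_vector) simp
  \<comment> \<open>The law of the class of the fictitious message; it need not be uniform, but no
    class has more than twice the uniform weight.\<close>
  define p where "p k = real (card {m\<in>?M. \<kappa> m = k}) / real (card ?M)" for k
  have W: "0 < card ?W" "0 < card ?M"
    using index_set_nonempty[OF R(1)] index_set_nonempty[OF R(2)] by (simp_all add: card_gt_0_iff)
  have p0: "0 \<le> p k" for k by (simp add: p_def)
  have p2: "p k \<le> 2 / real K" if "k < K" for k
    using \<kappa>(2)[OF that] W by (simp add: p_def pos_divide_le_eq)
  have p1: "(\<Sum>k<K. p k) = 1"
    using sum_group_card[of ?M \<kappa> K "\<lambda>_. 1::real"] \<kappa>(1) W by (simp add: p_def sum_divide_distrib[symmetric])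
  define phi where "phi w k = shift_density n t (\<lambda>i. ?g * X w k i)" for w k
  define f where "f w z = (\<Sum>k<K. p k * phi w k z)" for w z
  have phi_pos: "0 < phi w k z" for w k z using t by (simp add: phi_def shift_density_pos)
  have phi_m [measurable]: "phi w k \<in> borel_measurable (real_vectors n)" for w k
    unfolding phi_def by measurable
  have f_pos: "0 < f w z" for w z
  proof -
    obtain k where "k < K" "p k \<noteq> 0" using p1 sum.neutral[of "{..<K}" p] by fastforce
    then have "k < K" "0 < p k" using p0[of k] by simp_all
    then show ?thesis unfolding f_def using p0 phi_pos
      by (intro sum_pos2[of _ k]) (auto simp: less_imp_le)
  qed
  have f_m: "f w \<in> borel_measurable ?T" for w
    unfolding f_def by measurable
  have one: "has_bochner_integral ?T (phi w k) 1" for w k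
  proof -
    have "has_bochner_integral ?N (\<lambda>u. 1) (1::real)"
      using N.prob_space by (simp add: has_bochner_integral_iff)
    then have "has_bochner_integral ?T (\<lambda>z. shift_density n t (\<lambda>i. ?g * X w k i) z * 1) 1"
      by (rule has_bochner_integral_shift_density[rotated 2]) (use t in auto)
    then show ?thesis by (simp only: phi_def mult_1_right)
  qed
  have f1: "has_bochner_integral ?T (f w) 1" for w
  proof -
    have "has_bochner_integral ?T (f w) (\<Sum>k<K. p k * 1)"
      unfolding f_def by (intro has_bochner_integral_sum has_bochner_integral_mult_right one)
    then show ?thesis using p1 by simp
  qed
  define e where "e w k = N.prob {u\<in>space ?N. d w (\<lambda>i\<in>{1..n}. ?g * X w k i + u i) \<noteq> k}" for w k
  define kl where "kl w k = (real n / 2 * ln t - real n / 2 + (ip n (\<lambda>i. ?g * X w k i) (\<lambda>i. ?g * X w k i) + real n) / (2 * t)) / ln 2" for w k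
  have e_int: "has_bochner_integral ?T (\<lambda>z. phi w k z * (if d w z = k then 0 else 1)) (e w k)" for w k
    unfolding phi_def
  proof (rule has_bochner_integral_shift_density)
    note [measurable] = d
    let ?B = "{u\<in>space ?N. d w (\<lambda>i\<in>{1..n}. ?g * X w k i + u i) \<noteq> k}"
    have B: "?B \<in> sets ?N" by measurable
    have "has_bochner_integral ?N (indicator ?B) (N.prob ?B)"
      using B by (intro has_bochner_integral_real_indicator) (auto simp: N.emeasure_eq_measure)
    then show "has_bochner_integral ?N (\<lambda>u. if d w (\<lambda>i\<in>{1..n}. ?g * X w k i + u i) = k then 0 else 1) (e w k)"
      unfolding e_def by (rule has_bochner_integral_cong[THEN iffD1, rotated -1]) (auto simp: indicator_def)
    show "(\<lambda>z. if d w z = k then 0 else 1 :: real) \<in> borel_measurable (real_vectors n)" by measurable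
  qed (use t in auto)
  have kl_int: "has_bochner_integral ?T (\<lambda>z. phi w k z * log 2 (phi w k z)) (kl w k)" for w k
    unfolding phi_def kl_def by (rule shift_density_entropy[OF t])
  \<comment> \<open>The Fano bound averaged over the messages: relative entropies of single
    codewords, an entropy term and an error term.\<close>
  define G where "G z = (\<Sum>w\<in>?W. (\<Sum>k<K. p k * (phi w k z * log 2 (phi w k z))) + (2 - log 2 (real K)) * f w z
      + log 2 (real K) * (\<Sum>k<K. p k * (phi w k z * (if d w z = k then 0 else 1)))) / card ?W" for z
  have G: "has_bochner_integral ?T G ((\<Sum>w\<in>?W. (\<Sum>k<K. p k * kl w k) + (2 - log 2 (real K)) * 1
      + log 2 (real K) * (\<Sum>k<K. p k * e w k)) / card ?W)"
    unfolding G_def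
    by (intro has_bochner_integral_divide_zero has_bochner_integral_sum has_bochner_integral_add
      has_bochner_integral_mult_right kl_int e_int f1)
  have law: "(\<integral>\<^sup>+\<omega>. F (message \<omega>, eve_output ch n c \<omega>) \<partial>code_space ch R' R n)
      = (\<Sum>w\<in>?W. \<integral>\<^sup>+z. ennreal (f w z / card ?W) * F (w, z) \<partial>?T)"
    if F: "F \<in> borel_measurable (count_space ?W \<Otimes>\<^sub>M ?T)" for F
  proof -
    have F': "F \<in> borel_measurable (count_space ?W \<Otimes>\<^sub>M real_vectors n)"
      using F by (simp cong: measurable_cong_sets sets_pair_measure_cong)
    show ?thesis unfolding nn_integral_eve_output[OF g F']
    proof (intro sum.cong refl)
      fix w assume w: "w \<in> ?W"
      have Fw[measurable]: "(\<lambda>z. F (w, z)) \<in> borel_measurable (real_vectors n)"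
        by (rule measurable_compose[OF _ F']) (use w in simp)
      define I where "I k = (\<integral>\<^sup>+u. F (w, \<lambda>i\<in>{1..n}. ?g * X w k i + u i) \<partial>?N)" for k
      have "(\<Sum>m\<in>?M. ennreal (1 / (card ?W * card ?M)) * (\<integral>\<^sup>+u. F (w, \<lambda>i\<in>{1..n}. ?g * code_input c w m i + u i) \<partial>?N))
        = (\<Sum>m\<in>?M. ennreal (1 / (card ?W * card ?M)) * I (\<kappa> m))"
      proof (intro sum.cong refl arg_cong2[where f="(*)"])
        fix m assume m: "m \<in> ?M"
        have "(\<lambda>i\<in>{1..n}. ?g * code_input c w m i + u i) = (\<lambda>i\<in>{1..n}. ?g * X w (\<kappa> m) i + u i)" for u :: "nat \<Rightarrow> real"
          using X[OF w m] by (auto simp: restrict_def fun_eq_iff)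
        then show "(\<integral>\<^sup>+u. F (w, \<lambda>i\<in>{1..n}. ?g * code_input c w m i + u i) \<partial>?N) = I (\<kappa> m)"
          by (simp add: I_def)
      qed
      also have "\<dots> = (\<Sum>k<K. of_nat (card {m\<in>?M. \<kappa> m = k}) * (ennreal (1 / (card ?W * card ?M)) * I k))"
        using \<kappa>(1) by (intro sum_group_card) auto
      also have "\<dots> = (\<Sum>k<K. ennreal (p k / card ?W) * I k)"
        unfolding ennreal_of_nat_eq_real_of_nat mult.assoc[symmetric]
        by (intro sum.cong refl arg_cong2[where f="(*)"], subst ennreal_mult[symmetric]) (auto simp: p_def)
      also have "\<dots> = (\<Sum>k<K. ennreal (p k / card ?W) * (\<integral>\<^sup>+z. ennreal (phi w k z) * F (w, z) \<partial>?T))"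
        unfolding I_def phi_def using t
        by (intro sum.cong refl arg_cong2[where f="(*)"] nn_integral_shift_density[symmetric] Fw) auto
      also have "\<dots> = (\<integral>\<^sup>+z. (\<Sum>k<K. ennreal (p k / card ?W) * (ennreal (phi w k z) * F (w, z))) \<partial>?T)"
        by (subst nn_integral_sum) (auto intro!: sum.cong nn_integral_cmult[symmetric])
      also have "\<dots> = (\<integral>\<^sup>+z. ennreal (f w z / card ?W) * F (w, z) \<partial>?T)"
      proof (intro nn_integral_cong)
        fix z
        have fs: "ennreal (f w z / card ?W) = (\<Sum>k<K. ennreal (p k / card ?W * phi w k z))"
          using p0 phi_pos by (subst sum_ennreal) (auto simp: f_def sum_divide_distrib less_imp_le)
        show "(\<Sum>k<K. ennreal (p k / card ?W) * (ennreal (phi w k z) * F (w, z))) = ennreal (f w z / card ?W) * F (w, z)"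
          unfolding fs sum_distrib_right mult.assoc[symmetric]
          by (intro sum.cong refl arg_cong2[where f="(*)"] ennreal_mult[symmetric])
            (use p0 phi_pos in \<open>auto simp: less_imp_le\<close>)
      qed
      finally show "(\<Sum>m\<in>?M. ennreal (1 / (card ?W * card ?M)) * (\<integral>\<^sup>+u. F (w, \<lambda>i\<in>{1..n}. ?g * code_input c w m i + u i) \<partial>?N))
        = (\<integral>\<^sup>+z. ennreal (f w z / card ?W) * F (w, z) \<partial>?T)" .
    qed
  qed
  have norm: "(\<integral>\<^sup>+z. ennreal (f w z) \<partial>?T) = 1" for w
    using f1[of w] f_pos by (subst nn_integral_eq_integral) (auto simp: has_bochner_integral_iff less_imp_le)
  have Gp: "(\<Sum>w\<in>?W. f w z * log 2 (f w z)) \<le> card ?W * G z" for z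
  proof -
    have "(\<Sum>w\<in>?W. f w z * log 2 (f w z)) \<le> (\<Sum>w\<in>?W. (\<Sum>k<K. p k * (phi w k z * log 2 (phi w k z))) + (2 - log 2 (real K)) * f w z
      + log 2 (real K) * (\<Sum>k<K. p k * (phi w k z * (if d w z = k then 0 else 1))))"
      unfolding f_def using K phi_pos p0 p2 by (intro sum_mono mixture_entropy_le) auto
    then show ?thesis using W by (simp add: G_def)
  qed
  have Gi: "integrable ?T G" using G by (auto simp: has_bochner_integral_iff)
  note mi = mutual_information_uniform_le[OF prob_space_code_space[OF R g(2)] finite_index_set index_set_nonempty[OF R(1)]
    T.prob_space_axioms sets_gaussian_vector message_measurable eve_output_measurable f_m f_pos law norm Gi Gp]
  show "0 \<le> ?L" unfolding leakage_def
    by (rule mi(1))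
  \<comment> \<open>Power \<open>P + \<epsilon>\<close> instead of \<open>P\<close> raises the
    relative entropy by at most \<open>n * g * \<epsilon> / (2 * t * ln 2)\<close>. With
    \<open>g \<le> 1\<close>, \<open>t \<ge> 1\<close> and \<open>2 * ln 2 \<ge> 1\<close> this is
    at most \<open>n * \<epsilon>\<close>.\<close>
  have kl_le: "kl w k \<le> real n * (1/2 * log 2 t) + real n * \<epsilon>" if w: "w \<in> ?W" "k < K" for w k
  proof -
    have "ip n (\<lambda>i. ?g * X w k i) (\<lambda>i. ?g * X w k i) = gain ch * ip n (X w k) (X w k)"
      using g by (simp add: ip_linear mult.assoc[symmetric])
    also have "\<dots> \<le> gain ch * (real n * (P + \<epsilon>))"
      using g pow[OF w] by (intro mult_left_mono)
    also have "\<dots> = real n * (t - 1) + gain ch * (real n * \<epsilon>)" by (simp add: t_def algebra_simps)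
    also have "\<dots> \<le> real n * (t - 1) + 1 * (real n * \<epsilon>)"
      using g eps by (intro add_left_mono mult_right_mono) auto
    finally have "ip n (\<lambda>i. ?g * X w k i) (\<lambda>i. ?g * X w k i) + real n \<le> real n * t + real n * \<epsilon>"
      by (simp add: algebra_simps)
    then have "(ip n (\<lambda>i. ?g * X w k i) (\<lambda>i. ?g * X w k i) + real n) / (2 * t) \<le> (real n * t + real n * \<epsilon>) / (2 * t)"
      using t by (intro divide_right_mono) auto
    also have "\<dots> = real n / 2 + real n * \<epsilon> / (2 * t)" using t by (simp add: field_simps)
    also have "real n * \<epsilon> / (2 * t) \<le> real n * \<epsilon> / 2"
      using t eps by (intro divide_left_mono) auto
    finally have "real n / 2 * ln t - real n / 2 + (ip n (\<lambda>i. ?g * X w k i) (\<lambda>i. ?g * X w k i) + real n) / (2 * t)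
      \<le> real n / 2 * ln t + real n * \<epsilon> / 2" by linarith
    then have "kl w k \<le> (real n / 2 * ln t + real n * \<epsilon> / 2) / ln 2"
      unfolding kl_def by (intro divide_right_mono) auto
    also have "\<dots> = real n * (1/2 * log 2 t) + real n * \<epsilon> / (2 * ln 2)"
      by (simp add: log_def add_divide_distrib)
    also have "real n * \<epsilon> / (2 * ln 2) \<le> real n * \<epsilon> / 1"
      using eps ln2_ge_two_thirds by (intro divide_left_mono) auto
    finally show ?thesis by simp
  qed
  have "(\<Sum>w\<in>?W. \<Sum>k<K. p k * kl w k) \<le> (\<Sum>w\<in>?W. \<Sum>k<K. p k * (real n * (1/2 * log 2 t) + real n * \<epsilon>))"
    using p0 kl_le by (intro sum_mono mult_left_mono) auto
  also have "\<dots> = card ?W * (real n * (1/2 * log 2 t) + real n * \<epsilon>)"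
    by (simp add: sum_distrib_right[symmetric] p1)
  finally have 1: "(\<Sum>w\<in>?W. \<Sum>k<K. p k * kl w k) \<le> card ?W * (real n * (1/2 * log 2 t) + real n * \<epsilon>)" .
  \<comment> \<open>The hypothesis on errors averages uniformly over \<open>k\<close>, while
    \<open>p\<close> may weigh an index twice as much; hence the factor 2 in the error term.\<close>
  have "(\<Sum>w\<in>?W. \<Sum>k<K. p k * e w k) \<le> (\<Sum>w\<in>?W. \<Sum>k<K. 2 / real K * e w k)"
    using p2 by (intro sum_mono mult_right_mono) (auto simp: e_def)
  also have "\<dots> = 2 / real K * (\<Sum>w\<in>?W. \<Sum>k<K. e w k)" by (simp add: sum_distrib_left)
  also have "\<dots> \<le> 2 / real K * (real (card ?W) * real K * \<epsilon>)"
    using err by (intro mult_left_mono) (auto simp: e_def)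
  also have "\<dots> = card ?W * (2 * \<epsilon>)" using K by simp
  finally have 2: "(\<Sum>w\<in>?W. \<Sum>k<K. p k * e w k) \<le> card ?W * (2 * \<epsilon>)" .
  have lK: "0 \<le> log 2 (real K)" using K by simp
  have "(\<integral>z. G z \<partial>?T) = ((\<Sum>w\<in>?W. \<Sum>k<K. p k * kl w k) + card ?W * (2 - log 2 (real K))
      + log 2 (real K) * (\<Sum>w\<in>?W. \<Sum>k<K. p k * e w k)) / card ?W"
    using G by (simp add: has_bochner_integral_iff sum.distrib sum_distrib_left)
  also have "\<dots> \<le> (card ?W * (real n * (1/2 * log 2 t) + real n * \<epsilon>) + card ?W * (2 - log 2 (real K))
      + log 2 (real K) * (card ?W * (2 * \<epsilon>))) / card ?W"
    using 1 2 lK by (intro divide_right_mono add_mono mult_left_mono) auto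
  also have "\<dots> = real n * (1/2 * log 2 t) + real n * \<epsilon> + 2 - log 2 (real K) + 2 * \<epsilon> * log 2 (real K)"
  proof -
    have "(x * a + x * b + l * (x * c)) / x = a + b + l * c" if "0 < x" for x a b l c :: real
      using that by (simp add: add_divide_distrib)
    from this[of "real (card ?W)"] show ?thesis using W by simp
  qed
  finally have Gle: "(\<integral>z. G z \<partial>?T) \<le> real n * (1/2 * log 2 t) + real n * \<epsilon> + 2 - log 2 (real K) + 2 * \<epsilon> * log 2 (real K)" .
  have "?L \<le> max 0 (\<integral>z. G z \<partial>?T)" unfolding leakage_def
    by (rule mi(2))
  also have "\<dots> \<le> max 0 (real n * (1/2 * log 2 t) + real n * \<epsilon> + 2 - log 2 (real K) + 2 * \<epsilon> * log 2 (real K))"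
    using Gle by (intro max.mono) auto
  finally show "?L \<le> max 0 (real n * (1/2 * log 2 (1 + gain ch * P)) + real n * \<epsilon> + 2 - log 2 (real K) + 2 * \<epsilon> * log 2 (real K))"
    unfolding t_def .
qed

text \<open>The factor 2 pays for classes of unequal size, since the hypothesis on errors averages
  uniformly over the \<open>K\<close> classes.\<close>

lemma error_prob_le:
  fixes X :: "nat \<Rightarrow> nat \<Rightarrow> nat \<Rightarrow> real"
  assumes g: "gain ch < 1" and R: "0 \<le> R" "0 \<le> R'" and K: "0 < K"
    and \<kappa>: "\<And>m. m \<in> index_set n R' \<Longrightarrow> \<kappa> m < K"
      "\<And>k. k < K \<Longrightarrow> real (card {m\<in>index_set n R'. \<kappa> m = k}) \<le> 2 / real K * real (card (index_set n R'))"
    and X: "\<And>w m i. w \<in> index_set n R \<Longrightarrow> m \<in> index_set n R' \<Longrightarrow> i \<in> {1..n} \<Longrightarrow> code_input c w m i = X w (\<kappa> m) i"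
    and dec: "decoder c \<in> real_vectors n \<rightarrow>\<^sub>M count_space (index_set n R)"
    and err: "(\<Sum>w\<in>index_set n R. \<Sum>k<K. measure (gaussian_vector n 1) {u\<in>space (gaussian_vector n 1).
        decoder c (\<lambda>i\<in>{1..n}. X w k i + u i) \<noteq> w}) \<le> real (card (index_set n R)) * real K * \<epsilon>"
  shows "error_prob ch R' R n c \<le> 2 * \<epsilon>"
proof -
  let ?W = "index_set n R" and ?M = "index_set n R'" and ?U = "gaussian_vector n 1" and ?V = "gaussian_vector n (1 - gain ch)"
  interpret U: prob_space ?U by (rule prob_space_gaussian_vector) simp
  interpret V: prob_space ?V using g by (intro prob_space_gaussian_vector) simp
  interpret C: prob_space "code_space ch R' R n" by (rule prob_space_code_space[OF R g])
  have W: "0 < card ?W" "0 < card ?M"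
    using index_set_nonempty[OF R(1)] index_set_nonempty[OF R(2)] by (simp_all add: card_gt_0_iff)
  let ?E = "{\<omega> \<in> space (code_space ch R' R n). decoder c (dest_output n c \<omega>) \<noteq> message \<omega>}"
  note [measurable] = dec dest_output_measurable message_measurable
  have dm: "(\<lambda>\<omega>. decoder c (dest_output n c \<omega>)) \<in> code_space ch R' R n \<rightarrow>\<^sub>M count_space (index_set n R)"
    by measurable
  have "(\<lambda>\<omega>. (decoder c (dest_output n c \<omega>), message \<omega>)) \<in> code_space ch R' R n \<rightarrow>\<^sub>M count_space ?W \<Otimes>\<^sub>M count_space ?W"
    using dm message_measurable by (rule measurable_Pair)
  then have pm: "(\<lambda>\<omega>. (decoder c (dest_output n c \<omega>), message \<omega>)) \<in> code_space ch R' R n \<rightarrow>\<^sub>M count_space (?W \<times> ?W)"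
    by (simp add: pair_measure_count_space)
  have Em: "?E \<in> sets (code_space ch R' R n)"
  proof -
    have "(\<lambda>\<omega>. (decoder c (dest_output n c \<omega>), message \<omega>)) -` {p\<in>?W \<times> ?W. fst p \<noteq> snd p} \<inter> space (code_space ch R' R n) \<in> sets (code_space ch R' R n)"
      by (rule measurable_sets[OF pm]) auto
    also have "(\<lambda>\<omega>. (decoder c (dest_output n c \<omega>), message \<omega>)) -` {p\<in>?W \<times> ?W. fst p \<noteq> snd p} \<inter> space (code_space ch R' R n) = ?E"
      using measurable_space[OF pm] by auto
    finally show ?thesis .
  qed
  define e where "e w k = U.prob {u\<in>space ?U. decoder c (\<lambda>i\<in>{1..n}. X w k i + u i) \<noteq> w}" for w k
  have inner: "(\<integral>\<^sup>+p. indicator ?E (w, m, p) \<partial>(?U \<Otimes>\<^sub>M ?V)) = ennreal (e w (\<kappa> m))" if wm: "w \<in> ?W" "m \<in> ?M" for w m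
  proof -
    let ?B = "{u\<in>space ?U. decoder c (\<lambda>i\<in>{1..n}. X w (\<kappa> m) i + u i) \<noteq> w}"
    have B[measurable]: "?B \<in> sets ?U"
    proof -
      have "(\<lambda>u. decoder c (\<lambda>i\<in>{1..n}. X w (\<kappa> m) i + u i)) \<in> ?U \<rightarrow>\<^sub>M count_space ?W" by measurable
      from measurable_sets[OF this, of "?W - {w}"]
      have "(\<lambda>u. decoder c (\<lambda>i\<in>{1..n}. X w (\<kappa> m) i + u i)) -` (?W - {w}) \<inter> space ?U \<in> sets ?U" by simp
      also have "(\<lambda>u. decoder c (\<lambda>i\<in>{1..n}. X w (\<kappa> m) i + u i)) -` (?W - {w}) \<inter> space ?U = ?B"
        using measurable_space[OF \<open>(\<lambda>u. decoder c (\<lambda>i\<in>{1..n}. X w (\<kappa> m) i + u i)) \<in> ?U \<rightarrow>\<^sub>M count_space ?W\<close>] by auto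
      finally show ?thesis .
    qed
    have "(\<integral>\<^sup>+p. indicator ?E (w, m, p) \<partial>(?U \<Otimes>\<^sub>M ?V)) = (\<integral>\<^sup>+p. indicator ?B (fst p) \<partial>(?U \<Otimes>\<^sub>M ?V))"
    proof (intro nn_integral_cong)
      fix p assume p: "p \<in> space (?U \<Otimes>\<^sub>M ?V)"
      obtain x y where xy: "p = (x, y)" by (cases p)
      have sp: "(w, m, p) \<in> space (code_space ch R' R n)"
        using p wm by (simp add: code_space_def space_pair_measure space_uniform_count_measure)
      have "dest_output n c (w, m, x, y) = (\<lambda>i\<in>{1..n}. X w (\<kappa> m) i + x i)"
        unfolding dest_output_eq using X[OF wm] by (auto simp: restrict_def fun_eq_iff)
      then show "indicator ?E (w, m, p) = (indicator ?B (fst p) :: ennreal)"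
        using sp p xy by (auto simp: indicator_def message_def space_pair_measure)
    qed
    also have "\<dots> = (\<integral>\<^sup>+x. \<integral>\<^sup>+y. indicator ?B x \<partial>?V \<partial>?U)"
      by (subst V.nn_integral_fst[symmetric]) auto
    also have "\<dots> = (\<integral>\<^sup>+x. indicator ?B x \<partial>?U)" by (simp add: V.emeasure_space_1)
    also have "\<dots> = ennreal (e w (\<kappa> m))"
      using B by (subst nn_integral_indicator) (auto simp: U.emeasure_eq_measure e_def)
    finally show ?thesis .
  qed
  have "ennreal (error_prob ch R' R n c) = (\<integral>\<^sup>+\<omega>. indicator ?E \<omega> \<partial>code_space ch R' R n)"
    using Em by (simp add: error_prob_def C.emeasure_eq_measure)
  also have "\<dots> = (\<Sum>w\<in>?W. \<Sum>m\<in>?M. ennreal (1 / (card ?W * card ?M)) * (\<integral>\<^sup>+p. indicator ?E (w, m, p) \<partial>(?U \<Otimes>\<^sub>M ?V)))"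
    by (rule nn_integral_code_space[OF g]) (use Em in simp)
  also have "\<dots> = (\<Sum>w\<in>?W. \<Sum>m\<in>?M. ennreal (1 / (card ?W * card ?M) * e w (\<kappa> m)))"
    by (intro sum.cong refl, simp only: inner, intro ennreal_mult[symmetric]) (auto simp: e_def)
  also have "\<dots> = ennreal (\<Sum>w\<in>?W. \<Sum>m\<in>?M. 1 / (card ?W * card ?M) * e w (\<kappa> m))"
    by (simp add: sum_ennreal sum_nonneg e_def)
  finally have "error_prob ch R' R n c = (\<Sum>w\<in>?W. \<Sum>m\<in>?M. 1 / (card ?W * card ?M) * e w (\<kappa> m))"
    by (subst (asm) ennreal_inj) (auto simp: error_prob_def e_def intro!: sum_nonneg)
  also have "\<dots> = (\<Sum>w\<in>?W. \<Sum>k<K. real (card {m\<in>?M. \<kappa> m = k}) * (1 / (card ?W * card ?M) * e w k))"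
    using \<kappa>(1) by (intro sum.cong refl sum_group_card) auto
  also have "\<dots> \<le> (\<Sum>w\<in>?W. \<Sum>k<K. (2 / real K * real (card ?M)) * (1 / (card ?W * card ?M) * e w k))"
    using \<kappa>(2) by (intro sum_mono mult_right_mono) (auto simp: e_def)
  also have "\<dots> = 2 / (real K * card ?W) * (\<Sum>w\<in>?W. \<Sum>k<K. e w k)"
    using W index_set_nonempty[OF R(2)] by (simp add: sum_distrib_left)
  also have "\<dots> \<le> 2 / (real K * card ?W) * (real (card ?W) * real K * \<epsilon>)"
    using err by (intro mult_left_mono) (auto simp: e_def)
  also have "\<dots> = 2 * \<epsilon>" using K W index_set_nonempty[OF R(1)] by simp
  finally show ?thesis .
qed

section \<open>From codebooks to achievable rates\<close>

text \<open>Messages are numbered from 1 and classes from 0, so \<open>(w - 1) * K + k\<close>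
  enumerates all pairs once.\<close>

lemma sum_grid:
  fixes h :: "nat \<Rightarrow> real"
  shows "(\<Sum>w=1..NW. \<Sum>k<K. h ((w - 1) * K + k)) = (\<Sum>t<NW * K. h t)"
proof -
  have "(\<Sum>w=1..NW. \<Sum>k<K. h ((w - 1) * K + k)) = (\<Sum>w<NW. \<Sum>k<K. h (w * K + k))"
    by (rule sum.reindex_bij_witness[of _ Suc "\<lambda>w. w - 1"]) auto
  also have "\<dots> = (\<Sum>w<NW. sum h {w * K..<w * K + K})"
  proof (rule sum.cong[OF refl])
    fix w
    show "(\<Sum>k<K. h (w * K + k)) = sum h {w * K..<w * K + K}"
      by (rule sum.reindex_bij_witness[of _ "\<lambda>t. t - w * K" "\<lambda>k. w * K + k"]) auto
  qed
  also have "\<dots> = (\<Sum>t<NW * K. h t)" by (rule sum.nat_group)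
  finally show ?thesis .
qed

text \<open>A residue class has at most \<open>M div K + 1\<close> members, and
  \<open>K \<le> M\<close> makes this at most \<open>2 * (M div K)\<close>.\<close>

lemma card_mod_class_le:
  fixes K M :: nat
  assumes "0 < K" "K \<le> M"
  shows "real (card {m\<in>{1..M}. m mod K = k}) \<le> 2 / real K * real M"
proof -
  have "inj_on (\<lambda>m. m div K) {m\<in>{1..M}. m mod K = k}"
    by (intro inj_onI) (metis (mono_tags, lifting) div_mult_mod_eq mem_Collect_eq)
  moreover have "(\<lambda>m. m div K) ` {m\<in>{1..M}. m mod K = k} \<subseteq> {..M div K}"
    by (auto intro: div_le_mono)
  ultimately have "card {m\<in>{1..M}. m mod K = k} \<le> card {..M div K}"
    by (intro card_inj_on_le[of "\<lambda>m. m div K"]) auto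
  then have "card {m\<in>{1..M}. m mod K = k} \<le> M div K + 1" by simp
  also have "\<dots> \<le> 2 * (M div K)"
  proof -
    have "0 < M div K" using assms by (simp add: div_greater_zero_iff)
    then show ?thesis by linarith
  qed
  finally have "card {m\<in>{1..M}. m mod K = k} * K \<le> 2 * (M div K * K)"
    by (metis mult.assoc mult_le_mono1)
  also have "\<dots> \<le> 2 * M" by (simp add: div_times_less_eq_dividend)
  finally have "real (card {m\<in>{1..M}. m mod K = k}) * real K \<le> 2 * real M"
    by (metis of_nat_le_iff of_nat_mult of_nat_numeral)
  then show ?thesis using assms by (simp add: pos_le_divide_eq)
qed

text \<open>The pair number is \<open>(w - 1) * K + m mod K\<close>, so the fictitious message
  supplies the randomness by reduction. All \<open>N\<close> pairs form one group for the
  destination; the \<open>K\<close> consecutive pairs of one message form a group for the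
  eavesdropper.\<close>

lemma code_from_codebook:
  fixes y1 y2 :: "nat \<Rightarrow> nat \<Rightarrow> real" and j1 j2 :: "nat \<Rightarrow> nat" and d d' :: "nat \<Rightarrow> (nat \<Rightarrow> real) \<Rightarrow> nat"
  assumes n: "0 < n" and g: "0 \<le> gain ch" "gain ch < 1" and R: "0 \<le> R" "0 \<le> R'" and P: "0 \<le> P" and eps: "0 \<le> \<epsilon>"
    and K: "0 < K" "K \<le> card (index_set n R')"
    and N: "N = card (index_set n R) * K"
    and j: "\<And>t. t < N \<Longrightarrow> j1 t < card (index_set n (cap1 ch))" "\<And>t. t < N \<Longrightarrow> j2 t < card (index_set n (cap2 ch))"
    and pow: "\<And>t. t < card (index_set n (cap1 ch)) \<Longrightarrow> ip n (y1 t) (y1 t) \<le> real n * pow1 ch"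
      "\<And>t. t < card (index_set n (cap2 ch)) \<Longrightarrow> ip n (y2 t) (y2 t) \<le> real n * pow2 ch"
      "\<And>t. t < N \<Longrightarrow> ip n (\<lambda>i. y1 (j1 t) i + y2 (j2 t) i) (\<lambda>i. y1 (j1 t) i + y2 (j2 t) i) \<le> real n * (P + \<epsilon>)"
    and d: "\<And>g. d g \<in> real_vectors n \<rightarrow>\<^sub>M count_space UNIV" "\<And>g. d' g \<in> real_vectors n \<rightarrow>\<^sub>M count_space UNIV"
    and err: "(\<Sum>t<N. measure (gaussian_vector n 1) {u\<in>space (gaussian_vector n 1).
        d (t div N) (channel_out n 1 (y1 (j1 t)) (y2 (j2 t)) u) \<noteq> t}) \<le> real N * \<epsilon>"
      "(\<Sum>t<N. measure (gaussian_vector n 1) {u\<in>space (gaussian_vector n 1).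
        d' (t div K) (channel_out n (sqrt (gain ch)) (y1 (j1 t)) (y2 (j2 t)) u) \<noteq> t}) \<le> real N * \<epsilon>"
  shows "\<exists>c. is_secrecy_code ch R' R n c \<and> error_prob ch R' R n c \<le> 2 * \<epsilon> \<and> 0 \<le> leakage ch R' R n c \<and>
    leakage ch R' R n c \<le> max 0 (real n * (1/2 * log 2 (1 + gain ch * P)) + real n * \<epsilon> + 2 - log 2 (real K) + 2 * \<epsilon> * log 2 (real K))"
proof -
  let ?W = "index_set n R" and ?M = "index_set n R'" and ?U = "gaussian_vector n 1"
  interpret U: prob_space ?U by (rule prob_space_gaussian_vector) simp
  define NW where "NW = card ?W"
  have W: "?W = {1..NW}" by (simp add: NW_def index_set_def)
  have M: "?M = {1..card ?M}" by (simp add: index_set_def)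
  have NW: "0 < NW" using index_set_nonempty[OF R(1), of n] by (simp add: NW_def card_gt_0_iff)
  have N': "N = NW * K" by (simp add: N NW_def)
  define t where "t w k = (w - 1) * K + k" for w k :: nat
  have t_lt: "t w k < N" if "w \<in> ?W" "k < K" for w k
  proof -
    have "t w k < (w - 1) * K + K" using that by (simp add: t_def)
    also have "\<dots> = w * K" using that W by (cases w) auto
    also have "\<dots> \<le> NW * K" using that W by (intro mult_right_mono) auto
    finally show ?thesis by (simp add: N')
  qed
  have t_div: "t w k div K = w - 1" if "k < K" for w k
    using that by (simp add: t_def)
  \<comment> \<open>The destination decodes the whole pair in group 0 and keeps the message part;
    the default 1 is a legal message when decoding fails.\<close>
  define dec where "dec y = (if d 0 y < N then d 0 y div K + 1 else 1)" for y
  \<comment> \<open>Link indices start at 1 and codebook indices at 0, hence the shifts.\<close>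
  define c where "c = \<lparr>source_enc = (\<lambda>w m. (j1 (t w (m mod K)) + 1, j2 (t w (m mod K)) + 1)),
    relay1 = (\<lambda>j. y1 (j - 1)), relay2 = (\<lambda>j. y2 (j - 1)), decoder = dec\<rparr>"
  define X where "X w k i = y1 (j1 (t w k)) i + y2 (j2 (t w k)) i" for w k i
  have idx: "j + 1 \<in> index_set n r" if "j < card (index_set n r)" for j r
    using that by (simp add: index_set_def)
  have idx': "j - 1 < card (index_set n r)" if "j \<in> index_set n r" for j r
    using that by (auto simp: index_set_def)
  have dec_m: "dec \<in> real_vectors n \<rightarrow>\<^sub>M count_space ?W"
  proof -
    have "(if a < N then a div K + 1 else 1) \<in> ?W" for a
    proof -
      have "a div K < NW" if "a < N" using that K by (simp add: N' less_mult_imp_div_less)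
      then show ?thesis using NW by (auto simp: W)
    qed
    then have "(\<lambda>a. if a < N then a div K + 1 else 1) \<in> count_space UNIV \<rightarrow>\<^sub>M count_space ?W" by simp
    from measurable_compose[OF d(1)[of 0] this] show ?thesis unfolding dec_def by simp
  qed
  have code: "is_secrecy_code ch R' R n c"
    unfolding is_secrecy_code_def
  proof (intro conjI ballI)
    show "decoder c \<in> real_vectors n \<rightarrow>\<^sub>M count_space ?W" using dec_m by (simp add: c_def)
    have pc: "power_constraint n p x" if "ip n x x \<le> real n * p" for p x
      using that n by (simp add: power_constraint_def ip_def power2_eq_square pos_divide_le_eq mult.commute)
    show "power_constraint n (pow1 ch) (relay1 c j)" if "j \<in> index_set n (cap1 ch)" for j
      using pc[OF pow(1)[OF idx'[OF that]]] by (simp add: c_def)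
    show "power_constraint n (pow2 ch) (relay2 c j)" if "j \<in> index_set n (cap2 ch)" for j
      using pc[OF pow(2)[OF idx'[OF that]]] by (simp add: c_def)
    show "source_enc c w m \<in> index_set n (cap1 ch) \<times> index_set n (cap2 ch)" if w: "w \<in> ?W" and m: "m \<in> ?M" for w m
      using idx[OF j(1)[OF t_lt[OF w]]] idx[OF j(2)[OF t_lt[OF w]]] K by (simp add: c_def)
  qed
  have inp: "code_input c w m i = X w (m mod K) i" for w m i
    by (simp add: code_input_def c_def X_def)
  have kap: "m mod K < K" for m using K by simp
  have kap2: "real (card {m\<in>?M. m mod K = k}) \<le> 2 / real K * real (card ?M)" for k
    using card_mod_class_le[OF K] M by metis
  have e1: "error_prob ch R' R n c \<le> 2 * \<epsilon>"
  proof (rule error_prob_le[where \<kappa>="\<lambda>m. m mod K" and K=K and X=X])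
    show "decoder c \<in> real_vectors n \<rightarrow>\<^sub>M count_space ?W" using dec_m by (simp add: c_def)
    have "(\<Sum>w\<in>?W. \<Sum>k<K. U.prob {u\<in>space ?U. decoder c (\<lambda>i\<in>{1..n}. X w k i + u i) \<noteq> w})
      \<le> (\<Sum>w\<in>?W. \<Sum>k<K. U.prob {u\<in>space ?U. d (t w k div N) (channel_out n 1 (y1 (j1 (t w k))) (y2 (j2 (t w k))) u) \<noteq> t w k})"
    proof (intro sum_mono U.finite_measure_mono subsetI)
      fix w k u assume w: "w \<in> ?W" and k: "k \<in> {..<K}" and u: "u \<in> {u\<in>space ?U. decoder c (\<lambda>i\<in>{1..n}. X w k i + u i) \<noteq> w}"
      have o: "channel_out n 1 (y1 (j1 (t w k))) (y2 (j2 (t w k))) u = (\<lambda>i\<in>{1..n}. X w k i + u i)"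
        by (simp add: channel_out_def X_def)
      have z: "t w k div N = 0" using t_lt[OF w] k by simp
      have "dec (channel_out n 1 (y1 (j1 (t w k))) (y2 (j2 (t w k))) u) = w"
        if "d 0 (channel_out n 1 (y1 (j1 (t w k))) (y2 (j2 (t w k))) u) = t w k"
        using that t_lt[OF w] k t_div[of k w] w W by (simp add: dec_def)
      then show "u \<in> {u\<in>space ?U. d (t w k div N) (channel_out n 1 (y1 (j1 (t w k))) (y2 (j2 (t w k))) u) \<noteq> t w k}"
        using u by (auto simp: c_def z o)
    next
      fix w k
      note [measurable] = d(1)
      show "{u\<in>space ?U. d (t w k div N) (channel_out n 1 (y1 (j1 (t w k))) (y2 (j2 (t w k))) u) \<noteq> t w k} \<in> U.events"
        by measurable
    qed
    also have "\<dots> = (\<Sum>t<N. U.prob {u\<in>space ?U. d (t div N) (channel_out n 1 (y1 (j1 t)) (y2 (j2 t)) u) \<noteq> t})"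
      unfolding W N' t_def by (rule sum_grid)
    also have "\<dots> \<le> real N * \<epsilon>" by (rule err(1))
    finally show "(\<Sum>w\<in>?W. \<Sum>k<K. U.prob {u\<in>space ?U. decoder c (\<lambda>i\<in>{1..n}. X w k i + u i) \<noteq> w})
      \<le> real (card ?W) * real K * \<epsilon>" by (simp add: N)
  qed (use g R K inp kap kap2 in auto)
  \<comment> \<open>\<open>d'\<close> returns a pair number; subtracting the start of the group of
    \<open>w\<close> gives the class \<open>k\<close>. The message may be used because this decoder
    occurs only in the leakage estimate.\<close>
  define d'' where "d'' w y = d' (w - 1) y - (w - 1) * K" for w y
  have d''m: "d'' w \<in> real_vectors n \<rightarrow>\<^sub>M count_space UNIV" for w
    unfolding d''_def by (rule measurable_compose[OF d(2)]) simp
  have e2: "(\<Sum>w\<in>?W. \<Sum>k<K. U.prob {u\<in>space ?U. d'' w (\<lambda>i\<in>{1..n}. sqrt (gain ch) * X w k i + u i) \<noteq> k})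
      \<le> real (card ?W) * real K * \<epsilon>"
  proof -
    have "(\<Sum>w\<in>?W. \<Sum>k<K. U.prob {u\<in>space ?U. d'' w (\<lambda>i\<in>{1..n}. sqrt (gain ch) * X w k i + u i) \<noteq> k})
      \<le> (\<Sum>w\<in>?W. \<Sum>k<K. U.prob {u\<in>space ?U. d' (t w k div K) (channel_out n (sqrt (gain ch)) (y1 (j1 (t w k))) (y2 (j2 (t w k))) u) \<noteq> t w k})"
    proof (intro sum_mono U.finite_measure_mono subsetI)
      fix w k u assume w: "w \<in> ?W" and k: "k \<in> {..<K}" and u: "u \<in> {u\<in>space ?U. d'' w (\<lambda>i\<in>{1..n}. sqrt (gain ch) * X w k i + u i) \<noteq> k}"
      have o: "channel_out n (sqrt (gain ch)) (y1 (j1 (t w k))) (y2 (j2 (t w k))) u = (\<lambda>i\<in>{1..n}. sqrt (gain ch) * X w k i + u i)"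
        by (simp add: channel_out_def X_def)
      have z: "t w k div K = w - 1" using t_div k by simp
      show "u \<in> {u\<in>space ?U. d' (t w k div K) (channel_out n (sqrt (gain ch)) (y1 (j1 (t w k))) (y2 (j2 (t w k))) u) \<noteq> t w k}"
        using u by (auto simp: d''_def z o) (simp add: t_def)
    next
      fix w k
      note [measurable] = d(2)
      show "{u\<in>space ?U. d' (t w k div K) (channel_out n (sqrt (gain ch)) (y1 (j1 (t w k))) (y2 (j2 (t w k))) u) \<noteq> t w k} \<in> U.events"
        by measurable
    qed
    also have "\<dots> = (\<Sum>t<N. U.prob {u\<in>space ?U. d' (t div K) (channel_out n (sqrt (gain ch)) (y1 (j1 t)) (y2 (j2 t)) u) \<noteq> t})"
      unfolding W N' t_def by (rule sum_grid)
    also have "\<dots> \<le> real N * \<epsilon>" by (rule err(2))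
    finally show ?thesis by (simp add: N)
  qed
  have pw: "ip n (X w k) (X w k) \<le> real n * (P + \<epsilon>)" if "w \<in> ?W" "k < K" for w k
    using pow(3)[OF t_lt[OF that]] by (simp add: X_def[abs_def])
  note L = leakage_le[OF g R P K(1) kap kap2 inp d''m pw eps e2]
  show ?thesis using code e1 L by blast
qed

definition secure_code :: "diamond_wiretap \<Rightarrow> real \<Rightarrow> real \<Rightarrow> nat \<Rightarrow> real \<Rightarrow> wiretap_code \<Rightarrow> bool" where
  "secure_code ch R' R n \<eta> c \<longleftrightarrow> is_secrecy_code ch R' R n c \<and> error_prob ch R' R n c \<le> \<eta> \<and> \<bar>leakage ch R' R n c\<bar> \<le> real n * \<eta>"

lemma is_secrecy_code_exists:
  assumes "0 \<le> R" "0 \<le> cap1 ch" "0 \<le> cap2 ch" "0 \<le> pow1 ch" "0 \<le> pow2 ch"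
  shows "\<exists>c. is_secrecy_code ch R' R n c"
proof -
  have 1: "1 \<in> index_set n r" if "0 \<le> r" for r
    using index_set_nonempty[OF that, of n] by (auto simp: index_set_def)
  have "is_secrecy_code ch R' R n \<lparr>source_enc = (\<lambda>w m. (1, 1)), relay1 = (\<lambda>j i. 0), relay2 = (\<lambda>j i. 0), decoder = (\<lambda>y. 1)\<rparr>"
    using assms 1 by (simp add: is_secrecy_code_def power_constraint_def)
  then show ?thesis by blast
qed

text \<open>Almost optimal codes at each length avoid a diagonal argument over \<open>\<eta>\<close>.\<close>

lemma achievable_if_eventually:
  assumes R: "0 \<le> R" "0 \<le> cap1 ch" "0 \<le> cap2 ch" "0 \<le> pow1 ch" "0 \<le> pow2 ch"
    and ev: "\<And>\<eta>. 0 < \<eta> \<Longrightarrow> \<forall>\<^sub>F n in sequentially. \<exists>c. secure_code ch R' R n \<eta> c"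
  shows "achievable ch R' R"
proof -
  define v where "v n c = max (error_prob ch R' R n c) (\<bar>leakage ch R' R n c\<bar> / real n)" for n c
  define V where "V n = v n ` {c. is_secrecy_code ch R' R n c}" for n
  have v0: "0 \<le> v n c" for n c by (simp add: v_def error_prob_def le_max_iff_disj)
  have bdd: "bdd_below (V n)" for n by (rule bdd_belowI[of _ 0]) (auto simp: V_def v0)
  have ne: "V n \<noteq> {}" for n using is_secrecy_code_exists[OF R] by (auto simp: V_def)
  have "\<exists>c. is_secrecy_code ch R' R n c \<and> v n c < Inf (V n) + 1 / real (Suc n)" for n
    using cInf_lessD[OF ne, of n "Inf (V n) + 1 / real (Suc n)"] by (auto simp: V_def)
  then obtain c where c: "\<And>n. is_secrecy_code ch R' R n (c n)" "\<And>n. v n (c n) < Inf (V n) + 1 / real (Suc n)" by metis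
  have "(\<lambda>n. v n (c n)) \<longlonglongrightarrow> 0"
  proof (rule order_tendstoI)
    fix a :: real assume "a < 0"
    then show "\<forall>\<^sub>F n in sequentially. a < v n (c n)" using v0 by (intro always_eventually allI) (rule less_le_trans)
  next
    fix a :: real assume a: "0 < a"
    have "(\<lambda>n. 1 / real (Suc n)) \<longlonglongrightarrow> 0" by real_asymp
    then have "\<forall>\<^sub>F n in sequentially. 1 / real (Suc n) < a / 2" using a by (intro order_tendstoD(2)) auto
    moreover have "\<forall>\<^sub>F n in sequentially. \<exists>c. secure_code ch R' R n (a / 2) c" using a by (intro ev) simp
    ultimately show "\<forall>\<^sub>F n in sequentially. v n (c n) < a"
      using eventually_gt_at_top[of 0]
    proof eventually_elim
      case (elim n)
      then obtain c' where c': "secure_code ch R' R n (a / 2) c'" by blast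
      have "Inf (V n) \<le> v n c'" using c' bdd by (intro cInf_lower) (auto simp: V_def secure_code_def)
      also have "\<dots> \<le> a / 2" unfolding v_def using c' elim(3)
        by (intro max.boundedI) (auto simp: secure_code_def pos_divide_le_eq mult.commute)
      finally show ?case using c(2)[of n] elim(1) by linarith
    qed
  qed
  then have lim: "(\<lambda>n. v n (c n)) \<longlonglongrightarrow> 0" .
  have "(\<lambda>n. error_prob ch R' R n (c n)) \<longlonglongrightarrow> 0"
    by (rule tendsto_sandwich[OF _ _ tendsto_const lim]) (auto simp: v_def error_prob_def)
  moreover have "(\<lambda>n. 1 / real n * leakage ch R' R n (c n)) \<longlonglongrightarrow> 0"
    by (rule Lim_null_comparison[OF _ lim]) (auto simp: v_def abs_mult)
  ultimately show ?thesis using R(1) c(1) by (auto simp: achievable_def)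
qed

section \<open>Symmetry of the relays and rounding of rates\<close>

definition swap_relays :: "diamond_wiretap \<Rightarrow> diamond_wiretap" where
  "swap_relays ch = \<lparr>cap1 = cap2 ch, cap2 = cap1 ch, pow1 = pow2 ch, pow2 = pow1 ch, gain = gain ch\<rparr>"

text \<open>Block selection treats the two relays differently, so some cases are covered only after
  exchanging them.\<close>

lemma achievable_swap:
  assumes "achievable (swap_relays ch) R' R"
  shows "achievable ch R' R"
proof -
  define S where "S c = \<lparr>source_enc = (\<lambda>w m. prod.swap (source_enc c w m)), relay1 = relay2 c, relay2 = relay1 c, decoder = decoder c\<rparr>"
    for c :: wiretap_code
  have out: "dest_output n (S c) = dest_output n c" for n c
    by (auto simp: dest_output_def S_def fun_eq_iff restrict_def)
  have sp: "code_space (swap_relays ch) R' R n = code_space ch R' R n" for n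
    by (simp add: code_space_def swap_relays_def)
  have err: "error_prob ch R' R n (S c) = error_prob (swap_relays ch) R' R n c" for n c
    unfolding error_prob_def sp out by (simp add: S_def)
  have eve: "eve_output ch n (S c) = eve_output (swap_relays ch) n c" for n c
    by (simp add: eve_output_def out swap_relays_def)
  have leak: "leakage ch R' R n (S c) = leakage (swap_relays ch) R' R n c" for n c
    unfolding leakage_def sp eve ..
  have code: "is_secrecy_code ch R' R n (S c)" if "is_secrecy_code (swap_relays ch) R' R n c" for n c
    using that by (auto simp: is_secrecy_code_def swap_relays_def S_def mem_Times_iff)
  obtain c where c: "0 \<le> R" "\<And>n. n \<ge> 1 \<Longrightarrow> is_secrecy_code (swap_relays ch) R' R n (c n)"
    "(\<lambda>n. error_prob (swap_relays ch) R' R n (c n)) \<longlonglongrightarrow> 0"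
    "(\<lambda>n. 1 / real n * leakage (swap_relays ch) R' R n (c n)) \<longlonglongrightarrow> 0"
    using assms by (auto simp: achievable_def)
  show ?thesis unfolding achievable_def
  proof (intro conjI exI[of _ "\<lambda>n. S (c n)"] allI impI)
    show "is_secrecy_code ch R' R n (S (c n))" if "1 \<le> n" for n by (rule code[OF c(2)[OF that]])
  qed (use c err leak in auto)
qed

lemma card_index_set: "card (index_set n r) = nat \<lfloor>2 powr (real n * r)\<rfloor>"
  by (simp add: index_set_def)

lemma two_powr_eq_exp: "2 powr (real n * r) = exp (real n * (r * ln 2))"
  by (simp add: powr_def mult.assoc)

lemma card_index_set_le: "real (card (index_set n r)) \<le> exp (real n * (r * ln 2))"
  unfolding card_index_set two_powr_eq_exp using exp_ge_zero[of "real n * (r * ln 2)"] by linarith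

lemma le_card_index_set: "real J \<le> exp (real n * (r * ln 2)) \<Longrightarrow> J \<le> card (index_set n r)"
  unfolding card_index_set two_powr_eq_exp by linarith

lemma log_card_index_set:
  assumes r: "0 \<le> r"
  shows "real n * r - 1 \<le> log 2 (real (card (index_set n r)))" "log 2 (real (card (index_set n r))) \<le> real n * r"
proof -
  define x where "x = 2 powr (real n * r)"
  have x: "1 \<le> x" using r by (simp add: x_def ge_one_powr_ge_zero)
  then have "1 \<le> \<lfloor>x\<rfloor>" by simp
  with x have c: "real (card (index_set n r)) \<le> x" "x / 2 \<le> real (card (index_set n r))" "0 < real (card (index_set n r))"
    unfolding card_index_set x_def[symmetric] by linarith+
  have lx: "log 2 x = real n * r" by (simp add: x_def)
  have "log 2 (x / 2) \<le> log 2 (real (card (index_set n r)))"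
    using c x by (subst log_le_cancel_iff) auto
  then show "real n * r - 1 \<le> log 2 (real (card (index_set n r)))"
    using x lx by (simp add: log_divide)
  have "log 2 (real (card (index_set n r))) \<le> log 2 x"
    using c x by (subst log_le_cancel_iff) auto
  then show "log 2 (real (card (index_set n r))) \<le> real n * r" using lx by simp
qed

lemma (in gaussian_pair) rate_ok_margin:
  assumes "r < cap12 s" "r < c1 + cap_cond s" "r < c2 + swap.cap_cond s"
  shows "\<exists>m>0. rate_ok c1 c2 s m r"
proof -
  have "rate_ok c1 c2 s (min (cap12 s - r) (min (c1 + cap_cond s - r) (c2 + swap.cap_cond s - r))) r"
    by (auto simp: rate_ok_def)
  then show ?thesis using assms by (intro exI[of _ "min (cap12 s - r) (min (c1 + cap_cond s - r) (c2 + swap.cap_cond s - r))"]) auto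
qed

definition half_log :: "real \<Rightarrow> real" where "half_log x = 1/2 * log 2 (1 + x)"

lemma half_log_ln: "half_log x * ln 2 = 1/2 * ln (1 + x)"
  by (simp add: half_log_def log_def)

text \<open>The strict inequalities of the random coding argument, in bits. \<open>rM\<close> is the
  rate of \<open>k\<close>, and \<open>c2\<close> the rate of the codebook of relay 2, which may
  differ from the capacity of its link. At \<open>rM = 0\<close> there is a single class and nothing
  for the eavesdropper to decode.\<close>

definition rate_conditions :: "diamond_wiretap \<Rightarrow> real \<Rightarrow> real \<Rightarrow> real \<Rightarrow> real \<Rightarrow> real \<Rightarrow> real \<Rightarrow> bool" where
  "rate_conditions ch R p1 p2 kap rM c2 \<longleftrightarrow>
    (let v1 = p1 - kap\<^sup>2 / p2; v2 = p2 - kap\<^sup>2 / p1; S = p1 + p2 + 2 * kap; I = 1/2 * log 2 (p1 * p2 / (p1 * p2 - kap\<^sup>2)); g = gain ch in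
      I < c2 \<and> R + rM < cap1 ch + c2 - I \<and>
      R + rM < half_log S \<and> R + rM < cap1 ch + half_log v2 \<and> R + rM < c2 + half_log v1 \<and>
      (rM = 0 \<or> rM < half_log (g * S) \<and> rM < cap1 ch + half_log (g * v2) \<and> rM < c2 + half_log (g * v1)))"

text \<open>\<open>small\<close> makes the rate of \<open>k\<close> almost exhaust the information
  rate of the eavesdropper; the remaining gap turns into leakage. The alternative
  \<open>R + rM < cap2 ch\<close> is the case where link 2 carries the pair number.\<close>

lemma secure_codes_eventually:
  assumes ch: "0 \<le> cap1 ch" "0 \<le> gain ch" "gain ch < 1" and R: "0 \<le> R" "0 \<le> R'" and \<eta>: "0 < \<eta>"
    and p: "0 < p1" "p1 < pow1 ch" "0 < p2" "p2 < pow2 ch" "kap\<^sup>2 < p1 * p2"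
    and rM: "0 \<le> rM" "rM \<le> R'" and c2: "c2 = cap2 ch \<or> R + rM < cap2 ch"
    and rc: "rate_conditions ch R p1 p2 kap rM c2"
    and small: "half_log (gain ch * (p1 + p2 + 2 * kap)) - rM \<le> \<eta> / 4"
  shows "\<forall>\<^sub>F n in sequentially. \<exists>c. secure_code ch R' R n \<eta> c"
proof -
  interpret gaussian_pair p1 p2 kap using p by unfold_locales auto
  define g where "g = gain ch"
  define h where "h = sqrt g"
  have h: "0 \<le> h" "h \<le> 1" "h\<^sup>2 = g" using ch by (simp_all add: h_def g_def)
  define l where "l = ln (2::real)"
  have l: "0 < l" by (simp add: l_def)
  have mi_l: "mi = 1/2 * log 2 (p1 * p2 / (p1 * p2 - kap\<^sup>2)) * l"
    by (simp add: mi_def log_def l_def)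
  have caps: "cap12 s = half_log (s\<^sup>2 * sump) * l" "cap_cond s = half_log (s\<^sup>2 * rvar) * l"
    "swap.cap_cond s = half_log (s\<^sup>2 * swap.rvar) * l" for s
    by (simp_all add: cap12_def cap_cond_def swap.cap_cond_def half_log_ln l_def)
  have mul: "x * l < y * l" if "x < y" for x y using that l by simp
  define r where "r = (R + rM) * l"
  define N K where "N n = card (index_set n R) * card (index_set n rM)" and "K n = card (index_set n rM)" for n
  have K0: "0 < K n" for n using index_set_nonempty[OF rM(1)] by (simp add: K_def card_gt_0_iff)
  have N0: "0 < N n" for n using index_set_nonempty[OF R(1)] K0[of n] by (simp add: N_def K_def card_gt_0_iff)
  have Kle: "real (K n) \<le> exp (real n * (rM * l))" for n unfolding K_def l_def by (rule card_index_set_le)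
  have Nle: "real (N n) \<le> exp (real n * r)" for n
  proof -
    have "real (N n) \<le> exp (real n * (R * l)) * exp (real n * (rM * l))"
      unfolding N_def l_def of_nat_mult by (intro mult_mono card_index_set_le) auto
    also have "\<dots> = exp (real n * r)" by (simp add: r_def exp_add[symmetric] algebra_simps)
    finally show ?thesis .
  qed
  have KR: "K n \<le> card (index_set n R')" for n
    using order_trans[OF Kle, of n "exp (real n * (R' * l))"] rM l
    unfolding l_def by (intro le_card_index_set) (auto simp: mult_left_mono)
  note rc' = rc[unfolded rate_conditions_def Let_def, folded sump_def rvar_def swap.rvar_def g_def]
  have c0: "0 \<le> cap1 ch * l" using ch l by simp
  have c1: "mi < c2 * l" unfolding mi_l using rc' by (intro mul) auto
  have c3: "r < cap1 ch * l + c2 * l - mi"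
    using mul[of "R + rM" "cap1 ch + c2 - 1/2 * log 2 (p1 * p2 / (p1 * p2 - kap\<^sup>2))"] rc' unfolding mi_l r_def by (simp add: algebra_simps)
  have Y: "(\<forall>n. N n = 1) \<or> (\<forall>n. real (N n) \<le> exp (real n * r)) \<and> (\<exists>m>0. rate_ok (cap1 ch * l) (c2 * l) 1 m r)"
  proof (intro disjI2 conjI allI Nle rate_ok_margin)
    show "r < cap12 1" unfolding caps r_def using rc' by (intro mul) auto
    show "r < cap1 ch * l + cap_cond 1" unfolding caps r_def distrib_right[symmetric] using rc' by (intro mul) auto
    show "r < c2 * l + swap.cap_cond 1" unfolding caps r_def distrib_right[symmetric] using rc' by (intro mul) auto
  qed
  have Z: "(\<forall>n. K n = 1) \<or> (\<forall>n. real (K n) \<le> exp (real n * (rM * l))) \<and> (\<exists>m>0. rate_ok (cap1 ch * l) (c2 * l) h m (rM * l))"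
  proof (cases "rM = 0")
    case True
    then show ?thesis by (auto simp: K_def card_index_set)
  next
    case False
    show ?thesis
    proof (intro disjI2 conjI allI Kle rate_ok_margin)
      show "rM * l < cap12 h" unfolding caps h(3) using rc' False by (intro mul) auto
      show "rM * l < cap1 ch * l + cap_cond h" unfolding caps h(3) distrib_right[symmetric] using rc' False by (intro mul) auto
      show "rM * l < c2 * l + swap.cap_cond h" unfolding caps h(3) distrib_right[symmetric] using rc' False by (intro mul) auto
    qed
  qed
  \<comment> \<open>Small enough to keep the powers \<open>p1 + \<epsilon>\<close> and
    \<open>p2 + \<epsilon>\<close> admissible, and to confine the leakage terms
    \<open>n * \<epsilon>\<close> and \<open>2 * \<epsilon> * log 2 K\<close>, with
    \<open>log 2 K \<le> n * R'\<close>, to a quarter of \<open>n * \<eta>\<close>.\<close>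
  define \<epsilon> where "\<epsilon> = min (min (pow1 ch - p1) (pow2 ch - p2)) (\<eta> / (4 * (1 + 2 * R')))"
  have eps: "0 < \<epsilon>" using p \<eta> R by (simp add: \<epsilon>_def)
  have eps1: "p1 + \<epsilon> \<le> pow1 ch" "p2 + \<epsilon> \<le> pow2 ch" by (simp_all add: \<epsilon>_def)
  have eps2: "\<epsilon> * (1 + 2 * R') \<le> \<eta> / 4"
  proof -
    have "\<epsilon> \<le> \<eta> / (4 * (1 + 2 * R'))" by (simp add: \<epsilon>_def)
    then have "\<epsilon> * (4 * (1 + 2 * R')) \<le> \<eta>" using R by (simp add: pos_le_divide_eq)
    then show ?thesis by (simp add: algebra_simps)
  qed
  have eps3: "2 * \<epsilon> \<le> \<eta>"
  proof -
    have "\<epsilon> * 1 \<le> \<epsilon> * (1 + 2 * R')" using R eps by (intro mult_left_mono) auto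
    then show ?thesis using eps2 \<eta> by simp
  qed
  have ev3: "\<forall>\<^sub>F n in sequentially. 3 / real n < \<eta> / 4"
  proof -
    have "(\<lambda>n. 3 / real n) \<longlonglongrightarrow> 0" by real_asymp
    then show ?thesis using \<eta> by (intro order_tendstoD(2)[of _ 0]) auto
  qed
  have "\<forall>\<^sub>F n in sequentially. \<exists>J1 J2 x1 x2 a b d d'.
      good_codebook n (N n) (cap1 ch * l) (c2 * l) \<epsilon> (N n) (K n) 1 h J1 J2 x1 x2 a b d d'"
    by (rule good_codebook_eventually[OF c0 c1 c3 N0 Nle _ _ h(1,2) N0 Y K0 Z eps]) auto
  then show ?thesis
    using ev3 eventually_gt_at_top[of 0]
  proof eventually_elim
    case (elim n)
    then obtain J1 J2 x1 x2 a b d d' where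
      G: "good_codebook n (N n) (cap1 ch * l) (c2 * l) \<epsilon> (N n) (K n) 1 h J1 J2 x1 x2 a b d d'" by blast
    have G': "real J1 \<le> exp (real n * (cap1 ch * l))" "real J2 \<le> exp (real n * (c2 * l))"
      "\<And>t. t < N n \<Longrightarrow> a t < J1" "\<And>t. t < N n \<Longrightarrow> b t < J2"
      "\<And>j. ip n (x1 j) (x1 j) \<le> real n * (p1 + \<epsilon>)" "\<And>j. ip n (x2 j) (x2 j) \<le> real n * (p2 + \<epsilon>)"
      "\<And>t. t < N n \<Longrightarrow> ip n (\<lambda>i. x1 (a t) i + x2 (b t) i) (\<lambda>i. x1 (a t) i + x2 (b t) i) \<le> real n * (sump + \<epsilon>)"
      "\<And>g. d g \<in> real_vectors n \<rightarrow>\<^sub>M count_space UNIV" "\<And>g. d' g \<in> real_vectors n \<rightarrow>\<^sub>M count_space UNIV"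
      "(\<Sum>t<N n. measure (gaussian_vector n 1) {u\<in>space (gaussian_vector n 1).
        d (t div N n) (channel_out n 1 (x1 (a t)) (x2 (b t)) u) \<noteq> t}) \<le> real (N n) * \<epsilon>"
      "(\<Sum>t<N n. measure (gaussian_vector n 1) {u\<in>space (gaussian_vector n 1).
        d' (t div K n) (channel_out n h (x1 (a t)) (x2 (b t)) u) \<noteq> t}) \<le> real (N n) * \<epsilon>"
      using G unfolding good_codebook_def by blast+
    have J1: "J1 \<le> card (index_set n (cap1 ch))"
      using G'(1) unfolding l_def by (rule le_card_index_set)
    have a: "a t < card (index_set n (cap1 ch))" if "t < N n" for t
      by (rule less_le_trans[OF G'(3)[OF that] J1])
    \<comment> \<open>When link 2 carries the whole pair, the index sent is \<open>t\<close> itself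
      and relay 2 evaluates the selection \<open>b\<close>.\<close>
    obtain j2 y2 where y2: "\<And>t. t < N n \<Longrightarrow> j2 t < card (index_set n (cap2 ch))" "\<And>t. y2 (j2 t) = x2 (b t)"
      "\<And>j. ip n (y2 j) (y2 j) \<le> real n * (p2 + \<epsilon>)"
    proof (cases "c2 = cap2 ch")
      case True
      have J2: "J2 \<le> card (index_set n (cap2 ch))"
        using G'(2) unfolding l_def True by (rule le_card_index_set)
      show thesis
        by (rule that[of b x2]) (use less_le_trans[OF G'(4) J2] G'(6) in auto)
    next
      case False
      then have "R + rM < cap2 ch" using c2 by simp
      then have "exp (real n * r) \<le> exp (real n * (cap2 ch * l))"
        using l by (simp add: r_def mult_left_mono)
      then have N2: "N n \<le> card (index_set n (cap2 ch))"
        unfolding l_def by (intro le_card_index_set order_trans[OF Nle])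
      show thesis
        by (rule that[of "\<lambda>t. t" "\<lambda>t. x2 (b t)"]) (use N2 G'(6) in auto)
    qed
    have mono: "x \<le> real n * q'" if "x \<le> real n * q" "q \<le> q'" for x q q'
      using that mult_left_mono[of q q' "real n"] by linarith
    have "\<exists>c. is_secrecy_code ch R' R n c \<and> error_prob ch R' R n c \<le> 2 * \<epsilon> \<and> 0 \<le> leakage ch R' R n c \<and>
      leakage ch R' R n c \<le> max 0 (real n * (1/2 * log 2 (1 + gain ch * sump)) + real n * \<epsilon> + 2 - log 2 (real (K n)) + 2 * \<epsilon> * log 2 (real (K n)))"
    proof (rule code_from_codebook[OF elim(3) ch(2,3) R less_imp_le[OF sump_pos] less_imp_le[OF eps] K0 KR, where N="N n" and ?j1.0=a and ?j2.0=j2])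
      show "N n = card (index_set n R) * K n" by (simp add: N_def K_def)
      show "ip n (x1 t) (x1 t) \<le> real n * pow1 ch" for t
        by (rule mono[OF G'(5) eps1(1)])
      show "ip n (y2 t) (y2 t) \<le> real n * pow2 ch" for t
        by (rule mono[OF y2(3) eps1(2)])
      show "ip n (\<lambda>i. x1 (a t) i + y2 (j2 t) i) (\<lambda>i. x1 (a t) i + y2 (j2 t) i) \<le> real n * (sump + \<epsilon>)" if "t < N n" for t
        unfolding y2(2) by (rule G'(7)[OF that])
      show "(\<Sum>t<N n. measure (gaussian_vector n 1) {u\<in>space (gaussian_vector n 1).
        d (t div N n) (channel_out n 1 (x1 (a t)) (y2 (j2 t)) u) \<noteq> t}) \<le> real (N n) * \<epsilon>"
        unfolding y2(2) by (rule G'(10))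
      show "(\<Sum>t<N n. measure (gaussian_vector n 1) {u\<in>space (gaussian_vector n 1).
        d' (t div K n) (channel_out n (sqrt (gain ch)) (x1 (a t)) (y2 (j2 t)) u) \<noteq> t}) \<le> real (N n) * \<epsilon>"
        unfolding y2(2) using G'(11) unfolding h_def g_def .
    qed (fact a y2(1) G'(8) G'(9))+
    then obtain c where c: "is_secrecy_code ch R' R n c" "error_prob ch R' R n c \<le> 2 * \<epsilon>" "0 \<le> leakage ch R' R n c"
      "leakage ch R' R n c \<le> max 0 (real n * half_log (gain ch * sump) + real n * \<epsilon> + 2 - log 2 (real (K n)) + 2 * \<epsilon> * log 2 (real (K n)))"
      unfolding half_log_def by blast
    have lK: "real n * rM - 1 \<le> log 2 (real (K n))" "log 2 (real (K n)) \<le> real n * R'"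
      using log_card_index_set[OF rM(1), of n] mult_left_mono[OF rM(2), of "real n"] unfolding K_def by auto
    have "2 * \<epsilon> * log 2 (real (K n)) \<le> 2 * \<epsilon> * (real n * R')"
      using lK(2) eps by (intro mult_left_mono) auto
    moreover have "real n * \<epsilon> + 2 * \<epsilon> * (real n * R') = real n * (\<epsilon> * (1 + 2 * R'))" by (simp add: algebra_simps)
    moreover have "real n * (\<epsilon> * (1 + 2 * R')) \<le> real n * (\<eta> / 4)" using eps2 by (intro mult_left_mono) auto
    moreover have "real n * (half_log (gain ch * sump) - rM) \<le> real n * (\<eta> / 4)"
      using small by (intro mult_left_mono) (auto simp: sump_def)
    \<comment> \<open>Two bits from the Fano bound and one from rounding the number of
      classes.\<close>
    moreover have "3 \<le> real n * (\<eta> / 4)" using elim(2,3) by (simp add: field_simps)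
    ultimately have "real n * half_log (gain ch * sump) + real n * \<epsilon> + 2 - log 2 (real (K n)) + 2 * \<epsilon> * log 2 (real (K n))
        \<le> real n * (\<eta> / 4) + real n * (\<eta> / 4) + real n * (\<eta> / 4)"
      using lK(1) unfolding right_diff_distrib by linarith
    also have "\<dots> \<le> real n * \<eta>" using \<eta> by (simp add: field_simps)
    finally have "leakage ch R' R n c \<le> max 0 (real n * \<eta>)"
      using c(4) by (meson max.mono order_refl order_trans)
    also have "\<dots> = real n * \<eta>" using \<eta> by simp
    finally show ?case using c eps3 by (intro exI[of _ c]) (auto simp: secure_code_def)
  qed
qed

section \<open>Perturbation towards boundary parameters\<close>

lemma half_log_nonneg: "0 \<le> x \<Longrightarrow> 0 \<le> half_log x"
  by (simp add: half_log_def)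

lemma half_log_mono: "0 \<le> x \<Longrightarrow> x \<le> y \<Longrightarrow> half_log x \<le> half_log y"
  by (simp add: half_log_def)

lemma tendsto_half_log:
  assumes "(f \<longlongrightarrow> a) F" "0 \<le> a"
  shows "((\<lambda>x. half_log (f x)) \<longlongrightarrow> half_log a) F"
  unfolding half_log_def using assms by (intro tendsto_intros) auto

text \<open>\<open>F\<close> is the full information rate of the eavesdropper, which the rate of
  \<open>k\<close> approaches from below; the conditions for decoding \<open>k\<close> are therefore
  relaxed by \<open>\<eta>\<close>. The alternative \<open>R + F < cap2 ch\<close>, where link 2
  carries everything, admits a degenerate covariance.\<close>

definition limit_conditions :: "diamond_wiretap \<Rightarrow> real \<Rightarrow> real \<Rightarrow> real \<Rightarrow> real \<Rightarrow> real \<Rightarrow> real \<Rightarrow> bool" where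
  "limit_conditions ch R' R \<eta> P1 P2 k \<longleftrightarrow>
    (let v1 = P1 - k\<^sup>2 / P2; v2 = P2 - k\<^sup>2 / P1; S = P1 + P2 + 2 * k; g = gain ch; F = half_log (g * S);
         I = 1/2 * log 2 (P1 * P2 / (P1 * P2 - k\<^sup>2)) in
      F < R' + \<eta> \<and> R + F < half_log S \<and> R + F < cap1 ch + half_log v2 \<and> F < cap1 ch + half_log (g * v2) + \<eta> \<and>
      (R + F < cap2 ch \<or>
       k\<^sup>2 < P1 * P2 \<and> I < cap2 ch \<and> R + F < cap1 ch + cap2 ch - I \<and> R + F < cap2 ch + half_log v1 \<and>
         F < cap2 ch + half_log (g * v1) + \<eta>))"

text \<open>Powers are scaled by \<open>x\<close> and the covariance by \<open>x^2\<close>, with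
  \<open>x\<close> slightly below 1; this makes the power constraints strict and the covariance
  nondegenerate. The rate expressions are continuous in \<open>x\<close>, so the strict inequalities
  survive.\<close>

lemma achievable_limit:
  assumes ch: "0 < pow1 ch" "0 < pow2 ch" "0 \<le> cap1 ch" "0 \<le> cap2 ch" "0 \<le> gain ch" "gain ch < 1"
    and R: "0 \<le> R" "0 \<le> R'"
    and H: "\<And>\<eta>. 0 < \<eta> \<Longrightarrow> \<exists>P1 P2 k. 0 < P1 \<and> P1 \<le> pow1 ch \<and> 0 < P2 \<and> P2 \<le> pow2 ch \<and> k\<^sup>2 \<le> P1 * P2 \<and>
      limit_conditions ch R' R \<eta> P1 P2 k"
  shows "achievable ch R' R"
proof (rule achievable_if_eventually)
  fix \<eta> :: real assume \<eta>: "0 < \<eta>"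
  define \<mu> where "\<mu> = \<eta> / 4"
  have \<mu>: "0 < \<mu>" using \<eta> by (simp add: \<mu>_def)
  obtain P1 P2 k where P: "0 < P1" "P1 \<le> pow1 ch" "0 < P2" "P2 \<le> pow2 ch" "k\<^sup>2 \<le> P1 * P2"
    and lc: "limit_conditions ch R' R \<mu> P1 P2 k" using H[OF \<mu>] by blast
  define g where "g = gain ch"
  have g: "0 \<le> g" using ch by (simp add: g_def)
  define v1 v2 S F I where "v1 = P1 - k\<^sup>2 / P2" and "v2 = P2 - k\<^sup>2 / P1" and "S = P1 + P2 + 2 * k"
    and "F = half_log (g * S)" and "I = 1/2 * log 2 (P1 * P2 / (P1 * P2 - k\<^sup>2))"
  note lc' = lc[unfolded limit_conditions_def Let_def, folded g_def v1_def v2_def S_def I_def, folded F_def]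
  have v: "0 \<le> v1" "0 \<le> v2" using P by (simp_all add: v1_def v2_def pos_divide_le_eq mult.commute)
  have S: "0 \<le> S"
  proof -
    have "0 \<le> (P1 + k)\<^sup>2 + (P1 * P2 - k\<^sup>2)" using P by simp
    also have "\<dots> = P1 * S" by (simp add: S_def power2_eq_square algebra_simps)
    finally show ?thesis using P by (simp add: zero_le_mult_iff)
  qed
  have F: "0 \<le> F" using g S by (simp add: F_def half_log_nonneg)
  define Sx where "Sx x = x * P1 + x * P2 + 2 * (x\<^sup>2 * k)" for x
  define v1x where "v1x x = x * P1 - (x\<^sup>2 * k)\<^sup>2 / (x * P2)" for x
  define v2x where "v2x x = x * P2 - (x\<^sup>2 * k)\<^sup>2 / (x * P1)" for x
  define Ix where "Ix x = 1/2 * log 2 ((x * P1) * (x * P2) / ((x * P1) * (x * P2) - (x\<^sup>2 * k)\<^sup>2))" for x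
  define Fx where "Fx x = half_log (g * Sx x)" for x
  \<comment> \<open>Lowered by \<open>\<mu>\<close> to be strictly decodable at the eavesdropper,
    and cut off at 0, where there is nothing to decode.\<close>
  define rM where "rM x = max 0 (Fx x - \<mu>)" for x
  have id: "((\<lambda>x::real. x) \<longlongrightarrow> 1) (at_left 1)" by (rule tendsto_ident_at)
  have tS: "(Sx \<longlongrightarrow> S) (at_left 1)"
    unfolding Sx_def S_def by (rule tendsto_eq_intros id refl | simp)+
  have tv1: "(v1x \<longlongrightarrow> v1) (at_left 1)"
    unfolding v1x_def v1_def using P by (auto intro!: tendsto_eq_intros id)
  have tv2: "(v2x \<longlongrightarrow> v2) (at_left 1)"
    unfolding v2x_def v2_def using P by (auto intro!: tendsto_eq_intros id)
  have tF: "(Fx \<longlongrightarrow> F) (at_left 1)"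
    unfolding Fx_def F_def using g S by (intro tendsto_half_log tendsto_mult tendsto_const tS) auto
  have tI: "(Ix \<longlongrightarrow> I) (at_left 1)" if "k\<^sup>2 < P1 * P2"
    unfolding Ix_def I_def using P that by (auto intro!: tendsto_eq_intros id)
  have lt: "\<forall>\<^sub>F x in at_left 1. a x < b x" if "(a \<longlongrightarrow> l) (at_left 1)" "(b \<longlongrightarrow> m) (at_left 1)" "l < m" for a b :: "real \<Rightarrow> real" and l m
    using order_tendstoD(1)[OF tendsto_diff[OF that(2,1)], of 0] that(3) by (simp add: less_diff_eq)
  have hl: "((\<lambda>x. half_log (g * f x)) \<longlongrightarrow> half_log (g * a)) (at_left 1)" "((\<lambda>x. half_log (f x)) \<longlongrightarrow> half_log a) (at_left 1)"
    if "(f \<longlongrightarrow> a) (at_left 1)" "0 \<le> a" for f a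
    using that g by (intro tendsto_half_log tendsto_mult tendsto_const; simp)+
  have E1: "\<forall>\<^sub>F x in at_left 1. Fx x < F + \<mu>"
    using \<mu> by (intro lt[OF tF tendsto_const]) auto
  have E2: "\<forall>\<^sub>F x in at_left 1. Fx x < R' + \<mu>"
    using lc' by (intro lt[OF tF tendsto_const]) auto
  have E3: "\<forall>\<^sub>F x in at_left 1. R + F < half_log (Sx x)"
    using lc' by (intro lt[OF tendsto_const hl(2)[OF tS S]]) auto
  have E4: "\<forall>\<^sub>F x in at_left 1. R + F < cap1 ch + half_log (v2x x)"
    using lc' by (intro lt[OF tendsto_const tendsto_add[OF tendsto_const hl(2)[OF tv2 v(2)]]]) auto
  have E5: "\<forall>\<^sub>F x in at_left 1. Fx x < (cap1 ch + half_log (g * v2x x)) + \<mu>"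
    using lc' by (intro lt[OF tF tendsto_add[OF tendsto_add[OF tendsto_const hl(1)[OF tv2 v(2)]] tendsto_const]]) auto
  have E6: "\<forall>\<^sub>F x in at_left 1. 0 < x \<and> x < (1::real)"
    using eventually_at_left_real[of 0 1] by (auto elim: eventually_mono)
  have E7: "\<forall>\<^sub>F x in at_left 1. R + F < cap2 ch \<or>
      (Ix x < cap2 ch \<and> R + F < cap1 ch + cap2 ch - Ix x \<and> R + F < cap2 ch + half_log (v1x x) \<and>
         Fx x < (cap2 ch + half_log (g * v1x x)) + \<mu>)"
  proof (cases "R + F < cap2 ch")
    case False
    then have c: "k\<^sup>2 < P1 * P2" "I < cap2 ch" "R + F < cap1 ch + cap2 ch - I" "R + F < cap2 ch + half_log v1"
      "F < (cap2 ch + half_log (g * v1)) + \<mu>" using lc' by auto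
    have "\<forall>\<^sub>F x in at_left 1. Ix x < cap2 ch" by (rule lt[OF tI[OF c(1)] tendsto_const c(2)])
    moreover have "\<forall>\<^sub>F x in at_left 1. R + F < cap1 ch + cap2 ch - Ix x"
      by (rule lt[OF tendsto_const tendsto_diff[OF tendsto_const tI[OF c(1)]] c(3)])
    moreover have "\<forall>\<^sub>F x in at_left 1. R + F < cap2 ch + half_log (v1x x)"
      by (rule lt[OF tendsto_const tendsto_add[OF tendsto_const hl(2)[OF tv1 v(1)]] c(4)])
    moreover have "\<forall>\<^sub>F x in at_left 1. Fx x < (cap2 ch + half_log (g * v1x x)) + \<mu>"
      by (rule lt[OF tF tendsto_add[OF tendsto_add[OF tendsto_const hl(1)[OF tv1 v(1)]] tendsto_const] c(5)])
    ultimately show ?thesis by eventually_elim blast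
  qed simp
  have "\<forall>\<^sub>F x in at_left 1. 0 < x \<and> x < 1 \<and> Fx x < F + \<mu> \<and> Fx x < R' + \<mu> \<and> R + F < half_log (Sx x) \<and>
      R + F < cap1 ch + half_log (v2x x) \<and> Fx x < (cap1 ch + half_log (g * v2x x)) + \<mu> \<and>
      (R + F < cap2 ch \<or> (Ix x < cap2 ch \<and> R + F < cap1 ch + cap2 ch - Ix x \<and> R + F < cap2 ch + half_log (v1x x) \<and>
         Fx x < (cap2 ch + half_log (g * v1x x)) + \<mu>))"
    using E1 E2 E3 E4 E5 E6 E7 by eventually_elim blast
  then obtain x where x: "0 < x" "x < 1" "Fx x < F + \<mu>" "Fx x < R' + \<mu>" "R + F < half_log (Sx x)"
    "R + F < cap1 ch + half_log (v2x x)" "Fx x < (cap1 ch + half_log (g * v2x x)) + \<mu>"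
    "R + F < cap2 ch \<or> (Ix x < cap2 ch \<and> R + F < cap1 ch + cap2 ch - Ix x \<and> R + F < cap2 ch + half_log (v1x x) \<and>
         Fx x < (cap2 ch + half_log (g * v1x x)) + \<mu>)"
    using eventually_happens'[OF trivial_limit_at_left_real] by blast
  \<comment> \<open>The different scalings matter here: \<open>x^4 * k^2 < x^2 * P1 * P2\<close>
    even if \<open>k^2 = P1 * P2\<close>.\<close>
  have kx: "(x\<^sup>2 * k)\<^sup>2 < (x * P1) * (x * P2)"
  proof -
    have "x\<^sup>2 < 1" using x by (simp add: power2_less_1_iff abs_less_iff)
    have "(x\<^sup>2 * k)\<^sup>2 = x\<^sup>2 * (x\<^sup>2 * k\<^sup>2)" by (simp add: power2_eq_square)
    also have "\<dots> \<le> x\<^sup>2 * (x\<^sup>2 * (P1 * P2))" using P by (intro mult_left_mono) auto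
    also have "\<dots> < x\<^sup>2 * (1 * (P1 * P2))"
      using P x \<open>x\<^sup>2 < 1\<close> by (intro mult_strict_left_mono mult_strict_right_mono) auto
    finally show ?thesis by (simp add: power2_eq_square mult_ac)
  qed
  have rM: "0 \<le> rM x" "rM x \<le> R'" "R + rM x \<le> R + F" "rM x = 0 \<or> rM x = Fx x - \<mu>" "Fx x - rM x \<le> \<mu>"
    using x(3,4) F R by (auto simp: rM_def max_def)
  have px: "0 < x * P1" "x * P1 < pow1 ch" "0 < x * P2" "x * P2 < pow2 ch"
    using x P by (auto intro: less_le_trans[OF mult_strict_right_mono[of x 1]])
  have v1x: "0 \<le> v1x x"
    using kx px by (simp add: v1x_def pos_divide_le_eq)
  \<comment> \<open>When link 2 carries the whole pair, the codebook of relay 2 may be as large as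
    desired; this value meets every condition that involves \<open>c2\<close>.\<close>
  define c2 where "c2 = (if R + F < cap2 ch then 1 + \<bar>Ix x\<bar> + (R + rM x) else cap2 ch)"
  have c2: "c2 = cap2 ch \<or> R + rM x < cap2 ch" using rM(3) by (auto simp: c2_def)
  have "rate_conditions ch R (x * P1) (x * P2) (x\<^sup>2 * k) (rM x) c2"
    unfolding rate_conditions_def Let_def g_def[symmetric] Sx_def[symmetric] v1x_def[symmetric] v2x_def[symmetric] Ix_def[symmetric]
      Fx_def[symmetric]
  proof (intro conjI)
    have h1: "0 \<le> half_log (v1x x)" "0 \<le> half_log (g * v1x x)" using v1x g by (auto intro!: half_log_nonneg)
    show "Ix x < c2" "R + rM x < cap1 ch + c2 - Ix x" "R + rM x < c2 + half_log (v1x x)"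
      using x(8) rM(1,3) R h1 ch by (auto simp: c2_def)
    show "R + rM x < half_log (Sx x)" "R + rM x < cap1 ch + half_log (v2x x)" using x rM(3) by linarith+
    have "rM x < c2 + half_log (g * v1x x)" if "rM x = Fx x - \<mu>"
      using x(8) that rM(1) R h1 by (auto simp: c2_def)
    then show "rM x = 0 \<or> rM x < Fx x \<and> rM x < cap1 ch + half_log (g * v2x x) \<and> rM x < c2 + half_log (g * v1x x)"
      using rM(4) \<mu> x(7) by auto
  qed
  then show "\<forall>\<^sub>F n in sequentially. \<exists>c. secure_code ch R' R n \<eta> c"
    using rM(5) by (intro secure_codes_eventually[OF ch(3,5,6) R \<eta> px kx rM(1,2) c2])
      (simp_all add: g_def[symmetric] Sx_def[symmetric] Fx_def[symmetric] \<mu>_def)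
qed (use ch R in auto)

text \<open>Negative rate expressions and a vanishing indicator call for capacity at least 0,
  whereas the supremum of an empty set would be minus infinity. With one message and one class all
  inputs can be 0, and the leakage bound leaves 2 bits plus an arbitrarily small multiple of
  \<open>n\<close>.\<close>

lemma achievable_zero:
  assumes ch: "0 < pow1 ch" "0 < pow2 ch" "0 \<le> cap1 ch" "0 \<le> cap2 ch" "0 \<le> gain ch" "gain ch < 1" and R': "0 \<le> R'"
  shows "achievable ch R' 0"
proof (rule achievable_if_eventually)
  fix \<eta> :: real assume \<eta>: "0 < \<eta>"
  have "\<forall>\<^sub>F n in sequentially. 2 \<le> real n * (\<eta> / 2)" using \<eta> by real_asymp
  then show "\<forall>\<^sub>F n in sequentially. \<exists>c. secure_code ch R' 0 n \<eta> c"
    using eventually_gt_at_top[of 0]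
  proof eventually_elim
    case (elim n)
    have c1: "0 < card (index_set n r)" if "0 \<le> r" for r
      using index_set_nonempty[OF that] by (simp add: card_gt_0_iff)
    have c0: "card (index_set n 0) = 1" by (simp add: card_index_set)
    have "\<exists>c. is_secrecy_code ch R' 0 n c \<and> error_prob ch R' 0 n c \<le> 2 * (\<eta> / 2) \<and> 0 \<le> leakage ch R' 0 n c \<and>
      leakage ch R' 0 n c \<le> max 0 (real n * (1/2 * log 2 (1 + gain ch * 0)) + real n * (\<eta> / 2) + 2 - log 2 (real 1) + 2 * (\<eta> / 2) * log 2 (real 1))"
      by (rule code_from_codebook[where N=1 and ?j1.0="\<lambda>_. 0" and ?j2.0="\<lambda>_. 0" and ?y1.0="\<lambda>_ _. 0" and ?y2.0="\<lambda>_ _. 0"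
          and d="\<lambda>_ _. 0" and d'="\<lambda>_ _. 0"])
        (use elim ch R' \<eta> c1[OF R'] c1[OF ch(3)] c1[OF ch(4)] c0 in \<open>auto simp: ip_def\<close>)
    then obtain c where c: "is_secrecy_code ch R' 0 n c" "error_prob ch R' 0 n c \<le> 2 * (\<eta> / 2)" "0 \<le> leakage ch R' 0 n c"
      "leakage ch R' 0 n c \<le> max 0 (real n * (1/2 * log 2 (1 + gain ch * 0)) + real n * (\<eta> / 2) + 2 - log 2 (real 1) + 2 * (\<eta> / 2) * log 2 (real 1))"
      by blast
    have "leakage ch R' 0 n c \<le> real n * (\<eta> / 2) + 2" using c(4) \<eta> by simp
    also have "\<dots> \<le> real n * \<eta>" using elim by (simp add: field_simps)
    finally show ?case using c by (intro exI[of _ c]) (simp add: secure_code_def)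
  qed
qed (use ch in auto)

text \<open>Relay 1 has to be given a positive power \<open>x\<close>, which tends to 0.\<close>

lemma achievable_relay2_alone:
  assumes ch: "0 < pow1 ch" "0 < pow2 ch" "0 \<le> cap1 ch" "0 \<le> cap2 ch" "0 \<le> gain ch" "gain ch < 1"
    and R: "0 \<le> R" and v: "0 < v" "v \<le> pow2 ch"
    and c: "half_log (gain ch * v) \<le> R'" "R + half_log (gain ch * v) < half_log v" "R + half_log (gain ch * v) < cap2 ch"
  shows "achievable ch R' R"
proof (rule achievable_limit)
  fix \<eta> :: real assume \<eta>: "0 < \<eta>"
  define F where "F x = half_log (gain ch * (x + v + 2 * 0))" for x
  have g: "0 \<le> gain ch * v" using ch v by simp
  have tF: "(F \<longlongrightarrow> half_log (gain ch * v)) (at_right 0)"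
    unfolding F_def using g by (intro tendsto_half_log) (auto intro!: tendsto_eq_intros)
  have E: "\<forall>\<^sub>F x in at_right 0. F x < a" if "half_log (gain ch * v) < a" for a
    using order_tendstoD(2)[OF tF that] .
  have "\<forall>\<^sub>F x in at_right 0. 0 < x \<and> x < pow1 ch"
    using eventually_at_right_real[OF ch(1)] by (auto elim: eventually_mono)
  moreover have "\<forall>\<^sub>F x in at_right 0. F x < R' + \<eta>" using c \<eta> by (intro E) auto
  moreover have "\<forall>\<^sub>F x in at_right 0. F x < half_log v - R" using c by (intro E) auto
  moreover have "\<forall>\<^sub>F x in at_right 0. F x < half_log (gain ch * v) + \<eta>" using \<eta> by (intro E) auto
  moreover have "\<forall>\<^sub>F x in at_right 0. F x < cap2 ch - R" using c by (intro E) auto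
  ultimately have "\<forall>\<^sub>F x in at_right 0. 0 < x \<and> x < pow1 ch \<and> F x < R' + \<eta> \<and> F x < half_log v - R \<and>
      F x < half_log (gain ch * v) + \<eta> \<and> F x < cap2 ch - R"
    by eventually_elim blast
  then obtain x where x: "0 < x" "x < pow1 ch" "F x < R' + \<eta>" "F x < half_log v - R" "F x < half_log (gain ch * v) + \<eta>" "F x < cap2 ch - R"
    using eventually_happens'[OF trivial_limit_at_right_real] by blast
  have "half_log v \<le> half_log (x + v + 2 * 0)" using v x by (intro half_log_mono) auto
  \<comment> \<open>At covariance 0 the conditional variance of the input of relay 2 is
    \<open>v\<close> itself, so the conditions involving \<open>cap1 ch\<close> hold even for a link
    of capacity 0.\<close>
  then have "limit_conditions ch R' R \<eta> x v 0"
    unfolding limit_conditions_def Let_def F_def[symmetric] using x ch by auto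
  then show "\<exists>P1 P2 k. 0 < P1 \<and> P1 \<le> pow1 ch \<and> 0 < P2 \<and> P2 \<le> pow2 ch \<and> k\<^sup>2 \<le> P1 * P2 \<and> limit_conditions ch R' R \<eta> P1 P2 k"
    using x v by (intro exI[of _ x] exI[of _ v] exI[of _ 0]) auto
next
  have "0 \<le> half_log (gain ch * v)" using ch v by (intro half_log_nonneg) auto
  then show "0 \<le> R'" using c by linarith
qed (use ch R in auto)

text \<open>A relay that knows the whole pair also knows the codeword of the other relay, so
  correlation costs no link rate: the term of \<open>f3\<close> disappears and
  \<open>k^2 = pow1 ch * pow2 ch\<close> is allowed.\<close>

lemma achievable_relay2_informed:
  assumes ch: "0 < pow1 ch" "0 < pow2 ch" "0 \<le> cap1 ch" "0 \<le> cap2 ch" "0 \<le> gain ch" "gain ch < 1"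
    and R: "0 \<le> R" and k: "k\<^sup>2 \<le> pow1 ch * pow2 ch"
    and F: "half_log (gain ch * (pow1 ch + pow2 ch + 2 * k)) = F" "F \<le> R'" "0 \<le> F"
    and r: "R + F < half_log (pow1 ch + pow2 ch + 2 * k)" "R + F < cap2 ch"
      "R + F < cap1 ch + half_log (pow2 ch - k\<^sup>2 / pow1 ch)"
      "F \<le> cap1 ch + half_log (gain ch * (pow2 ch - k\<^sup>2 / pow1 ch))"
  shows "achievable ch R' R"
proof (rule achievable_limit)
  fix \<eta> :: real assume \<eta>: "0 < \<eta>"
  have "limit_conditions ch R' R \<eta> (pow1 ch) (pow2 ch) k"
    unfolding limit_conditions_def Let_def F(1) using F r \<eta> by auto
  then show "\<exists>P1 P2 k. 0 < P1 \<and> P1 \<le> pow1 ch \<and> 0 < P2 \<and> P2 \<le> pow2 ch \<and> k\<^sup>2 \<le> P1 * P2 \<and> limit_conditions ch R' R \<eta> P1 P2 k"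
    using ch k by blast
qed (use ch R F in auto)

text \<open>Block selection requires link 2 to exceed the mutual information of the inputs. The sum
  condition yields this once \<open>cap1 ch \<le> R + F\<close>; if instead
  \<open>R + F < cap1 ch\<close>, link 1 carries the whole pair and the relays are
  exchanged.\<close>

lemma achievable_marton:
  assumes ch: "0 < pow1 ch" "0 < pow2 ch" "0 \<le> cap1 ch" "0 \<le> cap2 ch" "0 \<le> gain ch" "gain ch < 1"
    and R: "0 \<le> R" and k: "k\<^sup>2 < pow1 ch * pow2 ch"
    and F: "half_log (gain ch * (pow1 ch + pow2 ch + 2 * k)) = F" "F \<le> R'" "0 \<le> F"
    and r: "R + F < half_log (pow1 ch + pow2 ch + 2 * k)"
      "R + F < cap1 ch + half_log (pow2 ch - k\<^sup>2 / pow1 ch)" "R + F < cap2 ch + half_log (pow1 ch - k\<^sup>2 / pow2 ch)"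
      "R + F < cap1 ch + cap2 ch - 1/2 * log 2 (pow1 ch * pow2 ch / (pow1 ch * pow2 ch - k\<^sup>2))"
    and z: "F \<le> cap1 ch + half_log (gain ch * (pow2 ch - k\<^sup>2 / pow1 ch))"
      "F \<le> cap2 ch + half_log (gain ch * (pow1 ch - k\<^sup>2 / pow2 ch))"
  shows "achievable ch R' R"
proof (cases "R + F < cap1 ch")
  case True
  have sw: "pow1 (swap_relays ch) = pow2 ch" "pow2 (swap_relays ch) = pow1 ch" "cap1 (swap_relays ch) = cap2 ch"
    "cap2 (swap_relays ch) = cap1 ch" "gain (swap_relays ch) = gain ch" by (simp_all add: swap_relays_def)
  show ?thesis
    by (rule achievable_swap, rule achievable_relay2_informed[where k=k and F=F])
      (use True ch R k F r z in \<open>simp_all add: sw mult.commute add.commute add.left_commute less_imp_le\<close>)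
next
  case False
  show ?thesis
  proof (rule achievable_limit)
    fix \<eta> :: real assume \<eta>: "0 < \<eta>"
    have "limit_conditions ch R' R \<eta> (pow1 ch) (pow2 ch) k"
      unfolding limit_conditions_def Let_def F(1) using False F r z k \<eta> by auto
    then show "\<exists>P1 P2 k. 0 < P1 \<and> P1 \<le> pow1 ch \<and> 0 < P2 \<and> P2 \<le> pow2 ch \<and> k\<^sup>2 \<le> P1 * P2 \<and> limit_conditions ch R' R \<eta> P1 P2 k"
      using ch k by (meson less_imp_le order_refl)
  qed (use ch R F in auto)
qed

section \<open>The three rate expressions\<close>

lemma ereal_Min4_minus:
  fixes a b d e R :: real
  assumes "ereal R < Min {ereal a, ereal b, c, ereal d} - ereal e"
  shows "R + e < a" "R + e < b" "ereal (R + e) < c" "R + e < d"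
proof -
  have "ereal (R + e) < Min {ereal a, ereal b, c, ereal d}"
    using assms by (simp only: plus_ereal.simps(1)[symmetric] ereal_less_minus_iff) auto
  then show "R + e < a" "R + e < b" "ereal (R + e) < c" "R + e < d" by simp_all
qed

theorem theorem5:
  fixes ch :: diamond_wiretap and R' \<rho> :: real
  assumes "0 < pow1 ch" and "0 < pow2 ch"
    and "0 \<le> cap1 ch" and "0 \<le> cap2 ch"
    and "0 \<le> gain ch" and "gain ch < 1"
    and "-1 \<le> \<rho>" and "\<rho> \<le> 1"
    and "f5 ch \<rho> \<le> R'"
  shows "Max {R_DF ch \<rho>, R_PDF_DF_M ch \<rho>, R_PDF_PDF_M ch \<rho>} \<le> secrecy_capacity ch R'"
proof -
  note ch = assms(1-6)
  define k where "k = \<rho> * sqrt (pow1 ch * pow2 ch)"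
  define S where "S = pow1 ch + pow2 ch + 2 * k"
  define g where "g = gain ch"
  define F where "F = half_log (g * S)"
  define v1 v2 where "v1 = (1 - \<rho>\<^sup>2) * pow1 ch" and "v2 = (1 - \<rho>\<^sup>2) * pow2 ch"
  have \<rho>: "\<rho>\<^sup>2 \<le> 1" using assms(7,8) by (simp add: abs_le_square_iff[of \<rho> 1, simplified, symmetric] abs_le_iff)
  have k2: "k\<^sup>2 = \<rho>\<^sup>2 * (pow1 ch * pow2 ch)" using ch by (simp add: k_def power_mult_distrib)
  have kle: "k\<^sup>2 \<le> pow1 ch * pow2 ch"
    unfolding k2 using ch \<rho> mult_right_mono[of "\<rho>\<^sup>2" 1 "pow1 ch * pow2 ch"] by simp
  have v: "pow1 ch - k\<^sup>2 / pow2 ch = v1" "pow2 ch - k\<^sup>2 / pow1 ch = v2"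
    using ch by (simp_all add: k2 v1_def v2_def left_diff_distrib)
  have v0: "0 \<le> v1" "0 \<le> v2" using ch \<rho> by (simp_all add: v1_def v2_def)
  have vle: "v1 \<le> pow1 ch" "v2 \<le> pow2 ch" using ch by (simp_all add: v1_def v2_def left_diff_distrib)
  \<comment> \<open>\<open>S - v2\<close> is the variance of the sum explained by the input of relay
    1, namely \<open>(pow1 ch + k)^2 / pow1 ch\<close>; likewise for the other relay.\<close>
  have S12: "v1 \<le> S" "v2 \<le> S"
  proof -
    have "0 \<le> (pow1 ch + k)\<^sup>2 / pow1 ch" "0 \<le> (pow2 ch + k)\<^sup>2 / pow2 ch" using ch by auto
    moreover have "(pow1 ch + k)\<^sup>2 / pow1 ch = S - v2" "(pow2 ch + k)\<^sup>2 / pow2 ch = S - v1"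
      using ch unfolding v[symmetric] S_def by (simp_all add: power2_eq_square field_simps)
    ultimately show "v1 \<le> S" "v2 \<le> S" by linarith+
  qed
  have g0: "0 \<le> g" using ch by (simp add: g_def)
  have S0: "0 \<le> S" using S12 v0 by linarith
  have rp: "received_power ch \<rho> = S" by (simp add: received_power_def S_def k_def)
  have F5: "f5 ch \<rho> = F" by (simp add: f5_def F_def rp g_def half_log_def)
  have F4: "f4 ch \<rho> = half_log S" by (simp add: f4_def rp half_log_def)
  have F1: "f1 ch \<rho> = cap1 ch + half_log v2" by (simp add: f1_def half_log_def v2_def)
  have F2: "f2 ch \<rho> = cap2 ch + half_log v1" by (simp add: f2_def half_log_def v1_def)
  have pos: "0 < 1 + g * S" "0 < 1 + g * v1" "0 < 1 + g * v2"
    using g0 S0 v0 by (simp_all add: add_pos_nonneg)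
  have "f6 ch \<rho> = 1/2 * log 2 ((1 + g * S) / (1 + g * v2))" by (simp add: f6_def rp g_def v2_def mult.assoc)
  then have F6: "f6 ch \<rho> = F - half_log (g * v2)"
    using pos by (simp add: log_divide F_def half_log_def)
  have "f7 ch \<rho> = 1/2 * log 2 ((1 + g * S) / (1 + g * v1))" by (simp add: f7_def rp g_def v1_def mult.assoc)
  then have F7: "f7 ch \<rho> = F - half_log (g * v1)"
    using pos by (simp add: log_divide F_def half_log_def)
  have F0: "0 \<le> F" unfolding F_def using g0 S0 by (intro half_log_nonneg) auto
  have FR: "F \<le> R'" using assms(9) F5 by simp
  have gv: "0 \<le> half_log (g * v1)" "0 \<le> half_log (g * v2)" "half_log (g * v1) \<le> F" "half_log (g * v2) \<le> F"
    unfolding F_def using g0 v0 S12 by (auto intro!: half_log_nonneg half_log_mono mult_left_mono)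
  have hv: "0 \<le> half_log v1" "0 \<le> half_log v2" using v0 by (auto intro: half_log_nonneg)
  have Feq: "half_log (gain ch * (pow1 ch + pow2 ch + 2 * k)) = F" by (simp add: F_def S_def g_def)
  \<comment> \<open>Each link carries the whole pair, so the conditions on \<open>cap1 ch\<close>
    hold already without their nonnegative conditional terms; |\<rho>| = 1 is included.\<close>
  have df: "achievable ch R' R" if "0 \<le> R" "ereal R < R_DF ch \<rho>" for R
  proof -
    have "R + F < cap1 ch" "R + F < cap2 ch" "R + F < half_log S"
      using that(2) by (auto simp: R_DF_def F5 F4)
    then show ?thesis
      using that(1) ch kle FR F0 hv gv by (intro achievable_relay2_informed[OF ch that(1) kle Feq FR F0]) (auto simp: v S_def[symmetric] g_def[symmetric])
  qed
  \<comment> \<open>Shared by the last two rates. A value of \<open>f3\<close> above a real number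
    forces |\<rho>| < 1. The link conditions may hold with equality, as the limit argument leaves
    slack.\<close>
  have marton: "achievable ch R' R"
    if R: "0 \<le> R" and c: "cap1 ch \<ge> f6 ch \<rho>" "cap2 ch \<ge> f7 ch \<rho>"
      and r: "R + F < f1 ch \<rho>" "R + F < f2 ch \<rho>" "ereal (R + F) < f3 ch \<rho>" "R + F < f4 ch \<rho>" for R
  proof -
    have \<rho>1: "\<bar>\<rho>\<bar> \<noteq> 1" using r(3) by (auto simp: f3_def)
    then have \<rho>2: "\<rho>\<^sup>2 < 1" using \<rho> by (simp add: less_le power2_eq_1_iff) (auto simp: abs_if)
    have klt: "k\<^sup>2 < pow1 ch * pow2 ch"
      unfolding k2 using ch \<rho>2 mult_strict_right_mono[of "\<rho>\<^sup>2" 1 "pow1 ch * pow2 ch"] by simp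
    have "pow1 ch * pow2 ch - k\<^sup>2 = (1 - \<rho>\<^sup>2) * (pow1 ch * pow2 ch)" by (simp add: k2 left_diff_distrib)
    then have I: "pow1 ch * pow2 ch / (pow1 ch * pow2 ch - k\<^sup>2) = 1 / (1 - \<rho>\<^sup>2)"
      using ch by simp
    have r3: "R + F < cap1 ch + cap2 ch - 1/2 * log 2 (1 / (1 - \<rho>\<^sup>2))"
      using r(3) \<rho>1 by (simp add: f3_def)
    show ?thesis
      by (rule achievable_marton[OF ch R klt Feq FR F0])
        (use r r3 c in \<open>simp_all add: v I S_def[symmetric] g_def[symmetric] F1 F2 F4 F6 F7\<close>)
  qed
  have pdf_pdf: "achievable ch R' R" if R: "0 \<le> R" "ereal R < R_PDF_PDF_M ch \<rho>" for R
  proof -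
    have c: "cap1 ch > f6 ch \<rho> \<and> cap2 ch > f7 ch \<rho>"
      using R by (auto simp: R_PDF_PDF_M_def split: if_splits)
    then have "ereal R < Min {ereal (f1 ch \<rho>), ereal (f2 ch \<rho>), f3 ch \<rho>, ereal (f4 ch \<rho>)} - ereal (f5 ch \<rho>)"
      using R(2) by (simp add: R_PDF_PDF_M_def)
    note ereal_Min4_minus[OF this]
    then show ?thesis using c by (intro marton R(1)) (auto simp: F5)
  qed
  have pdf_df: "achievable ch R' R" if R: "0 \<le> R" "ereal R < R_PDF_DF_M ch \<rho>" for R
  proof -
    note r = ereal_Min4_minus[OF R(2)[unfolded R_PDF_DF_M_def], unfolded F5]
    have \<rho>1: "\<bar>\<rho>\<bar> \<noteq> 1" using r(3) by (auto simp: f3_def)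
    then have \<rho>2: "\<rho>\<^sup>2 < 1" using \<rho> by (simp add: less_le power2_eq_1_iff) (auto simp: abs_if)
    have r3: "R + F + F < cap1 ch + cap2 ch - 1/2 * log 2 (1 / (1 - \<rho>\<^sup>2))"
      using r(3) \<rho>1 by (simp add: f3_def)
    have "0 \<le> 1/2 * log 2 (1 / (1 - \<rho>\<^sup>2))" using \<rho>2 by simp
    then have r3': "R + F + F < cap1 ch + cap2 ch" using r3 by linarith
    have vpos: "0 < v1" "0 < v2" using ch \<rho>2 by (simp_all add: v1_def v2_def)
    \<comment> \<open>If both link conditions hold, \<open>f3 - f5\<close> implies the bound by
      \<open>f3\<close>, as \<open>F \<ge> 0\<close>. If \<open>cap1 ch \<le> f6 ch \<rho>\<close>,
      inserting this into the \<open>f1\<close> bound and into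
      \<open>R + 2 * F < cap1 ch + cap2 ch\<close> gives the conditions for relay 2 alone.\<close>
    consider "cap1 ch > f6 ch \<rho>" "cap2 ch > f7 ch \<rho>" | "cap1 ch \<le> f6 ch \<rho>" | "cap2 ch \<le> f7 ch \<rho>" by linarith
    then show ?thesis
    proof cases
      case 1
      have "ereal (R + F) < f3 ch \<rho>" using r3 F0 \<rho>1 by (simp add: f3_def)
      then show ?thesis using 1 r by (intro marton R(1)) auto
    next
      case 2
      show ?thesis
      proof (rule achievable_relay2_alone[OF ch R(1) vpos(2) vle(2)])
        show "half_log (gain ch * v2) \<le> R'" using gv FR by (simp add: g_def)
        show "R + half_log (gain ch * v2) < half_log v2" using 2 r(1) by (simp add: F1 F6 g_def)
        show "R + half_log (gain ch * v2) < cap2 ch" using 2 r3' gv by (simp add: F6 g_def)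
      qed
    next
      case 3
      have sw: "pow1 (swap_relays ch) = pow2 ch" "pow2 (swap_relays ch) = pow1 ch" "cap1 (swap_relays ch) = cap2 ch"
        "cap2 (swap_relays ch) = cap1 ch" "gain (swap_relays ch) = gain ch" by (simp_all add: swap_relays_def)
      show ?thesis
      proof (rule achievable_swap, rule achievable_relay2_alone[where v=v1], unfold sw)
        show "half_log (gain ch * v1) \<le> R'" using gv FR by (simp add: g_def)
        show "R + half_log (gain ch * v1) < half_log v1" using 3 r(2) by (simp add: F2 F7 g_def)
        show "R + half_log (gain ch * v1) < cap1 ch" using 3 r3' gv by (simp add: F7 g_def)
      qed (use ch R vpos vle in auto)
    qed
  qed
  have cap: "ereal R \<le> secrecy_capacity ch R'" if "achievable ch R' R" for R
    unfolding secrecy_capacity_def using that by (intro SUP_upper) simp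
  have zero: "0 \<le> secrecy_capacity ch R'"
    using cap[OF achievable_zero[OF ch]] FR F0 by (simp add: zero_ereal_def)
  \<comment> \<open>Nonnegative rates strictly below \<open>x\<close> suffice: the capacity is at
    least 0, so if \<open>x\<close> exceeded it, a real rate strictly between them would be
    achievable.\<close>
  have le: "x \<le> secrecy_capacity ch R'" if x: "\<And>R. 0 \<le> R \<Longrightarrow> ereal R < x \<Longrightarrow> achievable ch R' R" for x
  proof (rule ccontr)
    assume "\<not> x \<le> secrecy_capacity ch R'"
    then obtain R where R: "secrecy_capacity ch R' < ereal R" "ereal R < x"
      using ereal_dense2[of "secrecy_capacity ch R'" x] by (auto simp: not_le)
    have "0 \<le> R" using le_less_trans[OF zero R(1)] by simp
    then show False using cap[OF x[OF _ R(2)]] R(1) by simp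
  qed
  show ?thesis using le[OF df] le[OF pdf_pdf] le[OF pdf_df] by simp
qed

end
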